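(* Let $\{X_n\}_{n\in\mathbb Z_+}$ be a sequence of separable Fréchet spaces. There is a hypercyclic operator on the locally convex direct sum $\bigoplus_{n\in\mathbb Z_+}X_n$ if and only if $X_n$ is infinite dimensional for infinitely many $n$.
   Context: All vector spaces are over $\mathbb K$, which is either $\mathbb R$ or $\mathbb C$; all topological spaces are Hausdorff; all topological vector spaces (in particular each $X_n$) are non-trivial ($\neq\{0\}$). A Fréchet space is a complete metrizable locally convex space. $\mathbb Z_+$ is the set of non-negative integers. The (locally convex) direct sum of a family $\{X_\alpha\}$ of locally convex spaces is the algebraic direct sum $\bigoplus_\alpha X_\alpha$ endowed with the strongest locally convex topology which induces the original topology on each $X_\alpha$. A continuous linear operator $T$ on a topological vector space $X$ is hypercyclic if there is $x\in X$ such that $\{T^nx:n\in\mathbb Z_+\}$ is dense in $X$. *)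

theory Defs
  imports "HOL-Analysis.Analysis" "HOL-Library.Function_Algebras"
begin

text \<open>
  A topological vector space is given by a scalar multiplication \<open>s\<close> on an ambient group \<open>'v\<close> and a
  topology \<open>T\<close> whose carrier \<open>topspace T\<close> is a linear subspace; \<open>'v\<close> itself carries no topology.
  Spaces that live on different carriers can thus be indexed by \<open>n\<close>. Nothing is lost by
  a common \<open>'v\<close>: any family of vector spaces embeds in a single one, e.g. its algebraic direct sum.
  No relation between the carriers is assumed; they may overlap or coincide.
\<close>

definition tvs :: "('k::real_normed_field \<Rightarrow> 'v::ab_group_add \<Rightarrow> 'v) \<Rightarrow> 'v topology \<Rightarrow> bool" where
  "tvs s T \<longleftrightarrow>
     vector_space s \<and> module.subspace s (topspace T) \<and> topspace T \<noteq> {0} \<and>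
     Hausdorff_space T \<and>
     continuous_map (prod_topology T T) T (\<lambda>(x, y). x + y) \<and>
     continuous_map (prod_topology euclidean T) T (\<lambda>(c, x). s c x)"

definition convex_wrt :: "('k::real_normed_field \<Rightarrow> 'v::ab_group_add \<Rightarrow> 'v) \<Rightarrow> 'v set \<Rightarrow> bool" where
  "convex_wrt s A \<longleftrightarrow>
     (\<forall>x\<in>A. \<forall>y\<in>A. \<forall>t::real. 0 \<le> t \<and> t \<le> 1 \<longrightarrow> s (of_real (1 - t)) x + s (of_real t) y \<in> A)"

definition locally_convex :: "('k::real_normed_field \<Rightarrow> 'v::ab_group_add \<Rightarrow> 'v) \<Rightarrow> 'v topology \<Rightarrow> bool" where
  "locally_convex s T \<longleftrightarrow> tvs s T \<and>
     (\<forall>U. openin T U \<and> 0 \<in> U \<longrightarrow> (\<exists>V. openin T V \<and> 0 \<in> V \<and> V \<subseteq> U \<and> convex_wrt s V))"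

text \<open>Completeness for the uniform structure of the group: every Cauchy filter converges.\<close>

definition tvs_cauchy_filter :: "'v::ab_group_add topology \<Rightarrow> 'v filter \<Rightarrow> bool" where
  "tvs_cauchy_filter T F \<longleftrightarrow> F \<noteq> bot \<and> eventually (\<lambda>x. x \<in> topspace T) F \<and>
     (\<forall>U. openin T U \<and> 0 \<in> U \<longrightarrow>
        (\<exists>A. eventually (\<lambda>x. x \<in> A) F \<and> (\<forall>x\<in>A. \<forall>y\<in>A. x - y \<in> U)))"

definition tvs_complete :: "'v::ab_group_add topology \<Rightarrow> bool" where
  "tvs_complete T \<longleftrightarrow> (\<forall>F. tvs_cauchy_filter T F \<longrightarrow> (\<exists>l. limitin T (\<lambda>x. x) l F))"

definition frechet_space :: "('k::real_normed_field \<Rightarrow> 'v::ab_group_add \<Rightarrow> 'v) \<Rightarrow> 'v topology \<Rightarrow> bool" where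
  "frechet_space s T \<longleftrightarrow> locally_convex s T \<and> metrizable_space T \<and> tvs_complete T"

definition finite_dimensional :: "('k::real_normed_field \<Rightarrow> 'v::ab_group_add \<Rightarrow> 'v) \<Rightarrow> 'v set \<Rightarrow> bool" where
  "finite_dimensional s V \<longleftrightarrow> (\<exists>B. finite B \<and> module.span s B = V)"

text \<open>The algebraic direct sum consists of the finitely supported families, with pointwise
  operations.\<close>

definition dsum_carrier :: "('i \<Rightarrow> 'v::ab_group_add topology) \<Rightarrow> ('i \<Rightarrow> 'v) set" where
  "dsum_carrier X = {f. (\<forall>i. f i \<in> topspace (X i)) \<and> finite {i. f i \<noteq> 0}}"

definition dsum_scale :: "('k \<Rightarrow> 'v \<Rightarrow> 'v) \<Rightarrow> 'k \<Rightarrow> ('i \<Rightarrow> 'v) \<Rightarrow> ('i \<Rightarrow> 'v)" where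
  "dsum_scale s c f = (\<lambda>i. s c (f i))"

definition dsum_inj :: "'i \<Rightarrow> 'v::ab_group_add \<Rightarrow> ('i \<Rightarrow> 'v)" where
  "dsum_inj i x = (\<lambda>j. if j = i then x else 0)"

definition dsum_admissible ::
  "('k::real_normed_field \<Rightarrow> 'v::ab_group_add \<Rightarrow> 'v) \<Rightarrow> ('i \<Rightarrow> 'v topology) \<Rightarrow> ('i \<Rightarrow> 'v) topology \<Rightarrow> bool" where
  "dsum_admissible s X D \<longleftrightarrow>
     locally_convex (dsum_scale s) D \<and> topspace D = dsum_carrier X \<and>
     (\<forall>i. embedding_map (X i) D (dsum_inj i))"

definition dsum_topology ::
  "('k::real_normed_field \<Rightarrow> 'v::ab_group_add \<Rightarrow> 'v) \<Rightarrow> ('i \<Rightarrow> 'v topology) \<Rightarrow> ('i \<Rightarrow> 'v) topology" where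
  "dsum_topology s X = (THE D. dsum_admissible s X D \<and>
     (\<forall>D'. dsum_admissible s X D' \<longrightarrow> (\<forall>U. openin D' U \<longrightarrow> openin D U)))"

definition continuous_operator ::
  "('k::real_normed_field \<Rightarrow> 'v::ab_group_add \<Rightarrow> 'v) \<Rightarrow> 'v topology \<Rightarrow> ('v \<Rightarrow> 'v) \<Rightarrow> bool" where
  "continuous_operator s T f \<longleftrightarrow> continuous_map T T f \<and>
     (\<forall>x\<in>topspace T. \<forall>y\<in>topspace T. f (x + y) = f x + f y) \<and>
     (\<forall>c. \<forall>x\<in>topspace T. f (s c x) = s c (f x))"

definition hypercyclic ::
  "('k::real_normed_field \<Rightarrow> 'v::ab_group_add \<Rightarrow> 'v) \<Rightarrow> 'v topology \<Rightarrow> ('v \<Rightarrow> 'v) \<Rightarrow> bool" where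
  "hypercyclic s T f \<longleftrightarrow> continuous_operator s T f \<and>
     (\<exists>x\<in>topspace T. T closure_of {(f ^^ n) x |n. True} = topspace T)"

text \<open>
  The strongest admissible topology exists, so the description in \<open>dsum_topology\<close> denotes it:
  the topology induced by the product is admissible, and so is the supremum of all admissible ones.
\<close>

lemma continuous_map_sup:
  assumes "topspace S = topspace D" "\<And>U. openin D U \<Longrightarrow> openin S U"
  shows "continuous_map S D (\<lambda>x. x)"
  using assms openin_subset[of D] by (auto simp: continuous_map_def Int_absorb2 Int_def[symmetric] intro: back_subst[of "openin S"])

lemma continuous_map_gen:
  assumes "f \<in> topspace Z \<rightarrow> C" 
    and "\<And>D. D \<in> A \<Longrightarrow> continuous_map Z D f" and "\<And>D. D \<in> A \<Longrightarrow> topspace D = C" "A \<noteq> {}"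
  shows "continuous_map Z (topology_generated_by {U. \<exists>D\<in>A. openin D U}) f"
proof (rule continuous_on_generated_topo)
  fix U assume "U \<in> {U. \<exists>D\<in>A. openin D U}"
  then obtain D where "D \<in> A" "openin D U" by auto
  then have "openin Z {x \<in> topspace Z. f x \<in> U}" using assms(2) by (auto simp: continuous_map_def)
  moreover have "f -` U \<inter> topspace Z = {x \<in> topspace Z. f x \<in> U}" by auto
  ultimately show "openin Z (f -` U \<inter> topspace Z)" by simp
next
  obtain D where D: "D \<in> A" using assms by auto
  then have "openin D C" using assms(3) by (metis openin_topspace)
  then show "f ` topspace Z \<subseteq> \<Union> {U. \<exists>D\<in>A. openin D U}"
    using assms(1) D by blast
qed

lemma vector_space_dsum_scale:
  assumes "vector_space s" shows "vector_space (dsum_scale s)"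
proof -
  interpret vector_space s by fact
  show ?thesis
    by unfold_locales (auto simp: dsum_scale_def fun_eq_iff scale_right_distrib scale_left_distrib)
qed

lemma subspace_dsum_carrier:
  assumes "vector_space s" "\<forall>i. module.subspace s (topspace (X i))"
  shows "module.subspace (dsum_scale s) (dsum_carrier X)"
proof -
  interpret vector_space s by fact
  interpret d: vector_space "dsum_scale s" using vector_space_dsum_scale[OF assms(1)] .
  have fin: "finite {i. f i + g i \<noteq> 0}" if "finite {i. f i \<noteq> 0}" "finite {i. g i \<noteq> 0}" for f g :: "'c \<Rightarrow> 'b"
    by (rule finite_subset[of _ "{i. f i \<noteq> 0} \<union> {i. g i \<noteq> 0}"]) (use that in auto)
  have fin2: "finite {i. s c (f i) \<noteq> 0}" if "finite {i. f i \<noteq> 0}" for c and f :: "'c \<Rightarrow> 'b"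
    by (rule finite_subset[of _ "{i. f i \<noteq> 0}"]) (use that in auto)
  show ?thesis
    unfolding d.subspace_def
    using assms(2)
    by (auto simp: dsum_carrier_def subspace_0 subspace_add subspace_scale fin)
       (auto simp: dsum_scale_def subspace_scale fin2)
qed

lemma dsum_inj_in:
  assumes "vector_space s" "\<forall>i. module.subspace s (topspace (X i))" "x \<in> topspace (X i)"
  shows "dsum_inj i x \<in> dsum_carrier X"
proof -
  interpret vector_space s by fact
  have "finite {j. dsum_inj i x j \<noteq> 0}"
    by (rule finite_subset[of _ "{i}"]) (auto simp: dsum_inj_def)
  then show ?thesis using assms(2,3)
    by (auto simp: dsum_carrier_def dsum_inj_def subspace_0)
qed

lemma dsum_nontrivial:
  assumes "vector_space s" "\<forall>i. module.subspace s (topspace (X i))" "topspace (X i) \<noteq> {0}"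
  shows "dsum_carrier X \<noteq> {0}"
proof -
  interpret vector_space s by fact
  obtain x where x: "x \<in> topspace (X i)" "x \<noteq> 0"
    using assms(2,3) subspace_0 by blast
  have "dsum_inj i x \<in> dsum_carrier X" "dsum_inj i x i \<noteq> 0"
    using dsum_inj_in[OF assms(1,2) x(1)] x by (auto simp: dsum_inj_def)
  then show ?thesis by (metis singletonD zero_fun_def)
qed

lemma embedding_by_coordinate:
  assumes "continuous_map (X i) D (dsum_inj i)" "continuous_map D (X i) (\<lambda>f. f i)"
  shows "embedding_map (X i) D (dsum_inj i)"
  unfolding embedding_map_def homeomorphic_map_maps
proof
  show "homeomorphic_maps (X i) (subtopology D (dsum_inj i ` topspace (X i))) (dsum_inj i) (\<lambda>f. f i)"
    using assms unfolding homeomorphic_maps_def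
    by (auto simp: continuous_map_in_subtopology continuous_map_from_subtopology dsum_inj_def)
qed

lemma product_admissible:
  fixes s :: "'k::real_normed_field \<Rightarrow> 'v::ab_group_add \<Rightarrow> 'v" and X :: "'i \<Rightarrow> 'v topology"
  assumes X: "\<And>i. locally_convex s (X i)"
  shows "dsum_admissible s X (subtopology (product_topology X UNIV) (dsum_carrier X))" (is "dsum_admissible s X ?P")
proof -
  have vs: "vector_space s" and ss: "\<And>i. module.subspace s (topspace (X i))"
    and nt: "\<And>i. topspace (X i) \<noteq> {0}" and haus: "\<And>i. Hausdorff_space (X i)"
    and add: "\<And>i. continuous_map (prod_topology (X i) (X i)) (X i) (\<lambda>(x, y). x + y)"
    and scl: "\<And>i. continuous_map (prod_topology euclidean (X i)) (X i) (\<lambda>(c, x). s c x)"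
    and cvx: "\<And>i U. openin (X i) U \<Longrightarrow> 0 \<in> U \<Longrightarrow> \<exists>V. openin (X i) V \<and> 0 \<in> V \<and> V \<subseteq> U \<and> convex_wrt s V"
    using X unfolding locally_convex_def tvs_def by auto
  from ss have ss': "\<forall>i. module.subspace s (topspace (X i))" by blast
  interpret vector_space s by fact
  interpret d: vector_space "dsum_scale s" using vector_space_dsum_scale[OF vs] .
  note sd = subspace_dsum_carrier[OF vs ss']
  have top: "topspace ?P = dsum_carrier X" by (auto simp: dsum_carrier_def)
  have coord: "continuous_map ?P (X i) (\<lambda>f. f i)" for i
    by (intro continuous_map_from_subtopology) auto
  have into: "continuous_map Z ?P g" if "\<And>i. continuous_map Z (X i) (\<lambda>z. g z i)" "g \<in> topspace Z \<rightarrow> dsum_carrier X"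
    for Z :: "'z topology" and g
    using that by (auto simp: continuous_map_in_subtopology continuous_map_componentwise_UNIV)
  have 1: "continuous_map (prod_topology ?P ?P) ?P (\<lambda>(x, y). x + y)"
  proof (rule into)
    fix i
    have "continuous_map (prod_topology ?P ?P) (prod_topology (X i) (X i)) (\<lambda>z. (fst z i, snd z i))"
      using continuous_map_compose[OF continuous_map_fst coord[of i], of ?P]
        continuous_map_compose[OF continuous_map_snd coord[of i], of ?P]
      by (simp add: continuous_map_paired o_def)
    from continuous_map_compose[OF this add[of i]]
    show "continuous_map (prod_topology ?P ?P) (X i) (\<lambda>z. (case z of (x, y) \<Rightarrow> x + y) i)"
      by (simp add: o_def case_prod_unfold)
  next
    show "(\<lambda>(x, y). x + y) \<in> topspace (prod_topology ?P ?P) \<rightarrow> dsum_carrier X"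
      unfolding topspace_prod_topology top using d.subspace_add[OF sd] by auto
  qed
  have 2: "continuous_map (prod_topology euclidean ?P) ?P (\<lambda>(c, x). dsum_scale s c x)"
  proof (rule into)
    fix i
    have "continuous_map (prod_topology euclidean ?P) (prod_topology euclidean (X i)) (\<lambda>z. (fst z, snd z i))"
      using continuous_map_compose[OF continuous_map_snd coord[of i], of euclidean]
      by (simp add: continuous_map_paired o_def continuous_map_fst)
    from continuous_map_compose[OF this scl[of i]]
    show "continuous_map (prod_topology euclidean ?P) (X i) (\<lambda>z. (case z of (c, x) \<Rightarrow> dsum_scale s c x) i)"
      by (simp add: o_def case_prod_unfold dsum_scale_def)
  next
    show "(\<lambda>(c, x). dsum_scale s c x) \<in> topspace (prod_topology euclidean ?P) \<rightarrow> dsum_carrier X"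
      unfolding topspace_prod_topology top using d.subspace_scale[OF sd] by auto
  qed
  have 3: "Hausdorff_space ?P"
    using haus by (intro Hausdorff_space_subtopology) (auto simp: Hausdorff_space_product_topology)
  have 4: "\<exists>V. openin ?P V \<and> 0 \<in> V \<and> V \<subseteq> U \<and> convex_wrt (dsum_scale s) V" if U: "openin ?P U" "0 \<in> U" for U
  proof -
    obtain W where W: "openin (product_topology X UNIV) W" "U = W \<inter> dsum_carrier X"
      using U by (auto simp: openin_subtopology)
    then obtain B where B: "finite {i. B i \<noteq> topspace (X i)}" "\<And>i. openin (X i) (B i)"
       "0 \<in> Pi\<^sub>E UNIV B" "Pi\<^sub>E UNIV B \<subseteq> W"
      using U(2) unfolding openin_product_topology_alt by auto
    have "\<forall>i. \<exists>V. openin (X i) V \<and> 0 \<in> V \<and> V \<subseteq> B i \<and> convex_wrt s V"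
      using cvx[OF B(2)] B(3) by (metis PiE_mem UNIV_I zero_fun_apply)
    then obtain V where V: "\<And>i. openin (X i) (V i)" "\<And>i. 0 \<in> V i" "\<And>i. V i \<subseteq> B i" "\<And>i. convex_wrt s (V i)"
      by metis
    define V' where "V' i = (if B i = topspace (X i) then topspace (X i) else V i)" for i
    have cv: "convex_wrt s (topspace (X i))" for i
      unfolding convex_wrt_def using ss[of i] by (auto intro!: subspace_add subspace_scale)
    have V': "openin (X i) (V' i)" "0 \<in> V' i" "V' i \<subseteq> B i" "convex_wrt s (V' i)" for i
      using V[of i] cv[of i] subspace_0[OF ss[of i]] by (auto simp: V'_def)
    have "finite {i. V' i \<noteq> topspace (X i)}"
      by (rule finite_subset[OF _ B(1)]) (auto simp: V'_def)
    then have o: "openin (product_topology X UNIV) (Pi\<^sub>E UNIV V')"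
      using V'(1) by (intro product_topology_basis) auto
    have cc: "convex_wrt (dsum_scale s) (Pi\<^sub>E UNIV V' \<inter> dsum_carrier X)"
      unfolding convex_wrt_def
      using V'(4)[unfolded convex_wrt_def] d.subspace_add[OF sd] d.subspace_scale[OF sd]
      by (auto simp: convex_wrt_def PiE_iff dsum_scale_def)
    have "openin ?P (Pi\<^sub>E UNIV V' \<inter> dsum_carrier X)"
      using o by (auto simp: openin_subtopology)
    moreover have "0 \<in> Pi\<^sub>E UNIV V' \<inter> dsum_carrier X"
      using V'(2) d.subspace_0[OF sd] by (auto simp: Pi_iff)
    moreover have "Pi\<^sub>E UNIV V' \<inter> dsum_carrier X \<subseteq> U"
    proof -
      have "Pi\<^sub>E UNIV V' \<subseteq> Pi\<^sub>E UNIV B" using V'(3) by (intro PiE_mono)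
      then show ?thesis using B(4) W(2) by (meson Int_mono order_refl order_trans)
    qed
    ultimately show ?thesis using cc by blast
  qed
  have 5: "embedding_map (X i) ?P (dsum_inj i)" for i
  proof (rule embedding_by_coordinate)
    show "continuous_map (X i) ?P (dsum_inj i)"
    proof (rule into)
      show "continuous_map (X i) (X j) (\<lambda>z. dsum_inj i z j)" for j
        using subspace_0[OF ss[of j]] by (cases "j = i") (auto simp: dsum_inj_def)
      show "dsum_inj i \<in> topspace (X i) \<rightarrow> dsum_carrier X"
        using dsum_inj_in[OF vs ss'] by auto
    qed
  qed (rule coord)
  show ?thesis
    unfolding dsum_admissible_def locally_convex_def tvs_def
    using 1 2 3 4 5 top sd dsum_nontrivial[OF vs ss' nt] d.vector_space_axioms by metis
qed

lemma dsum_topology_strongest: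
  fixes s :: "'k::real_normed_field \<Rightarrow> 'v::ab_group_add \<Rightarrow> 'v" and X :: "'i \<Rightarrow> 'v topology"
  assumes X: "\<And>i. locally_convex s (X i)"
  shows "dsum_admissible s X (dsum_topology s X)"
    and "dsum_admissible s X D \<Longrightarrow> openin D U \<Longrightarrow> openin (dsum_topology s X) U"
proof -
  define A where "A = Collect (dsum_admissible s X)"
  let ?P = "subtopology (product_topology X UNIV) (dsum_carrier X)"
  define S where "S = topology_generated_by {U. \<exists>D\<in>A. openin D U}"
  have P: "?P \<in> A" using product_admissible[OF X] by (simp add: A_def)
  have A: "topspace D = dsum_carrier X" "locally_convex (dsum_scale s) D" "\<And>i. embedding_map (X i) D (dsum_inj i)"
    if "D \<in> A" for D using that by (auto simp: A_def dsum_admissible_def)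
  have top: "topspace S = dsum_carrier X"
  proof -
    have "U \<subseteq> dsum_carrier X" if "D \<in> A" "openin D U" for D U
      using openin_subset[OF that(2)] A(1)[OF that(1)] by simp
    moreover have "openin ?P (dsum_carrier X)" using A(1)[OF P] by (metis openin_topspace)
    ultimately show ?thesis
      unfolding S_def topology_generated_by_topspace using P by blast
  qed
  have le: "openin S U" if "D \<in> A" "openin D U" for D U
    unfolding S_def by (rule topology_generated_by_Basis) (use that in auto)
  have id: "continuous_map S D (\<lambda>x. x)" if "D \<in> A" for D
    using continuous_map_sup[of S D] A(1)[OF that] top le[OF that] by auto
  have into: "continuous_map Z S g" if "\<And>D. D \<in> A \<Longrightarrow> continuous_map Z D g" for Z :: "'z topology" and g
    unfolding S_def 
    apply (rule continuous_map_gen[where C = "dsum_carrier X"])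
    subgoal using continuous_map_funspace[OF that[OF P]] A(1)[OF P] by simp
    subgoal using that .
    subgoal using A(1) .
    subgoal using P by blast
    done
  have D: "vector_space (dsum_scale s :: 'k \<Rightarrow> ('i \<Rightarrow> 'v) \<Rightarrow> ('i \<Rightarrow> 'v))"
    "module.subspace (dsum_scale s) (dsum_carrier X)" "dsum_carrier X \<noteq> {0}" "Hausdorff_space ?P"
    using A(2)[OF P] unfolding locally_convex_def tvs_def A(1)[OF P] by blast+
  have add: "continuous_map (prod_topology S S) S (\<lambda>(x, y). x + y)"
  proof (rule into)
    fix D assume D: "D \<in> A"
    have "continuous_map (prod_topology S S) (prod_topology D D) (\<lambda>z. (fst z, snd z))"
      using continuous_map_compose[OF continuous_map_fst id[OF D], of S]
        continuous_map_compose[OF continuous_map_snd id[OF D], of S]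
      by (simp add: continuous_map_pairwise o_def)
    moreover have "continuous_map (prod_topology D D) D (\<lambda>(x, y). x + y)"
      using A(2)[OF D] by (simp add: locally_convex_def tvs_def)
    ultimately have "continuous_map (prod_topology S S) D ((\<lambda>(x, y). x + y) \<circ> (\<lambda>z. (fst z, snd z)))"
      by (rule continuous_map_compose)
    then show "continuous_map (prod_topology S S) D (\<lambda>(x, y). x + y)" by (simp add: o_def case_prod_unfold)
  qed
  have scl: "continuous_map (prod_topology euclidean S) S (\<lambda>(c, x). dsum_scale s c x)"
  proof (rule into)
    fix D assume D: "D \<in> A"
    have "continuous_map (prod_topology euclidean S) (prod_topology euclidean D) (\<lambda>z. (fst z, snd z))"
      using continuous_map_compose[OF continuous_map_snd id[OF D], of euclidean]
      by (simp add: continuous_map_pairwise o_def continuous_map_fst)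
    moreover have "continuous_map (prod_topology euclidean D) D (\<lambda>(c, x). dsum_scale s c x)"
      using A(2)[OF D] by (simp add: locally_convex_def tvs_def)
    ultimately have "continuous_map (prod_topology euclidean S) D ((\<lambda>(c, x). dsum_scale s c x) \<circ> (\<lambda>z. (fst z, snd z)))"
      by (rule continuous_map_compose)
    then show "continuous_map (prod_topology euclidean S) D (\<lambda>(c, x). dsum_scale s c x)" by (simp add: o_def case_prod_unfold)
  qed
  have haus: "Hausdorff_space S"
    using D(4) le[OF P] A(1)[OF P] top unfolding Hausdorff_space_def by metis
  have cvx: "\<exists>V. openin S V \<and> 0 \<in> V \<and> V \<subseteq> U \<and> convex_wrt (dsum_scale s) V" if "openin S U" "0 \<in> U" for U
  proof -
    have "generate_topology_on {U. \<exists>D\<in>A. openin D U} U"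
      using that(1) unfolding S_def by (rule openin_topology_generated_by)
    then show ?thesis using that(2)
    proof (induction rule: generate_topology_on.induct)
      case (Int a b)
      then obtain V W where "openin S V" "0 \<in> V" "V \<subseteq> a" "convex_wrt (dsum_scale s) V"
        "openin S W" "0 \<in> W" "W \<subseteq> b" "convex_wrt (dsum_scale s) W" by blast
      moreover from this have "convex_wrt (dsum_scale s) (V \<inter> W)" unfolding convex_wrt_def by blast
      ultimately show ?case by (intro exI[of _ "V \<inter> W"]) blast
    next
      case (UN K)
      then show ?case by (meson UnionE Union_upper subset_trans)
    next
      case (Basis u)
      then obtain D where D: "D \<in> A" "openin D u" by auto
      then show ?case using A(2)[OF D(1)] Basis(2) le[OF D(1)] unfolding locally_convex_def by blast
    qed auto
  qed
  have emb: "embedding_map (X i) S (dsum_inj i)" for i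
  proof (rule embedding_by_coordinate)
    show "continuous_map (X i) S (dsum_inj i)"
    proof (rule into)
      fix D assume "D \<in> A"
      then have "homeomorphic_map (X i) (subtopology D (dsum_inj i ` topspace (X i))) (dsum_inj i)"
        using A(3) unfolding embedding_map_def by blast
      from homeomorphic_imp_continuous_map[OF this] show "continuous_map (X i) D (dsum_inj i)"
        by (simp add: continuous_map_in_subtopology)
    qed
    have "continuous_map ?P (X i) (\<lambda>f. f i)"
      by (intro continuous_map_from_subtopology) auto
    from continuous_map_compose[OF id[OF P] this] show "continuous_map S (X i) (\<lambda>f. f i)" by (simp add: o_def)
  qed
  have adm: "dsum_admissible s X S"
    unfolding dsum_admissible_def locally_convex_def tvs_def
    using top D add scl haus cvx emb by auto
  have "dsum_topology s X = S"
    unfolding dsum_topology_def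
    by (rule the_equality) (use adm le in \<open>auto simp: A_def topology_eq\<close>)
  then show "dsum_admissible s X (dsum_topology s X)"
    and "dsum_admissible s X D \<Longrightarrow> openin D U \<Longrightarrow> openin (dsum_topology s X) U"
    using adm le by (auto simp: A_def)
qed

end

theory Submission
  imports Defs
begin

text \<open>
  Suppose first that only finitely many summands are infinite-dimensional, and let \<open>Y\<close> be their sum. Every
  linear functional vanishing on \<open>Y\<close> is continuous, and every continuous operator maps a summand into finitely
  many coordinates. Modulo a space that contains \<open>Y\<close> with finite codimension, an orbit that is not confined
  to finitely many coordinates is therefore eventually linearly independent, and a functional that is
  constant on the tail of the orbit shows that the orbit is not dense.

  Now let infinitely many summands be infinite-dimensional. The operator is \<open>T = I + N\<close>, where \<open>N\<close> is a sum of
  weighted backward shifts along chains of vectors. Every vector of a set with dense span belongs to such a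
  chain, and far up each chain runs in one fixed summand, the root. On a Jordan chain of length \<open>2 d\<close>, \<open>T\<close> acts as the
  translation of polynomials of degree less than \<open>2 d\<close>; by two-point interpolation, a small correction in the
  upper half of the chain suffices to reach a given vector of the lower half exactly, up to a small error in the
  upper half. As both the correction and the error lie in the root, no smallness in the other
  summands is needed, and a sum of such corrections converges in the root to a hypercyclic vector.
\<close>

section \<open>Continuous seminorms\<close>

text \<open>The topology of the direct sum is known only as the strongest admissible one. It is
  accessed through a single criterion, \<open>cont_seminorm_DT_iff\<close>: a seminorm on the sum is
  continuous iff its restriction to every summand is. Nothing couples the summands, so a continuous
  seminorm may grow arbitrarily fast along them, and partial sums that do not share a finite support
  never converge. This is why all corrections to the hypercyclic vector have to stay in one root
  summand, while everything outside the root has to be hit exactly.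

  A second obstacle decides the order of the summands. If every continuous seminorm on
  \<open>E\<close> has a kernel of finite codimension and \<open>p\<close> is a continuous seminorm
  on \<open>F\<close> with a kernel of infinite codimension, then a continuous operator from
  \<open>E\<close> to \<open>F\<close> has finite-dimensional range modulo the kernel of
  \<open>p\<close>, so its range is not dense. Spaces of the second kind can only be fed by spaces
  of the second kind, and the weighted shifts need a different reason for convergence in each
  case.\<close>

definition seminorm_on :: "('k::real_normed_field \<Rightarrow> 'v::ab_group_add \<Rightarrow> 'v) \<Rightarrow> 'v set \<Rightarrow> ('v \<Rightarrow> real) \<Rightarrow> bool" where
  "seminorm_on s V q \<longleftrightarrow> (\<forall>x\<in>V. \<forall>y\<in>V. q (x + y) \<le> q x + q y) \<and> (\<forall>c. \<forall>x\<in>V. q (s c x) = norm c * q x)"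

text \<open>Continuity at 0, written as a bound by 1 near 0. Homogeneity and the triangle inequality
  turn it into openness of all balls (\<open>seminorm_ball_open\<close>). Values outside the carrier
  are arbitrary.\<close>

definition cont_seminorm :: "('k::real_normed_field \<Rightarrow> 'v::ab_group_add \<Rightarrow> 'v) \<Rightarrow> 'v topology \<Rightarrow> ('v \<Rightarrow> real) \<Rightarrow> bool" where
  "cont_seminorm s T q \<longleftrightarrow> seminorm_on s (topspace T) q \<and>
     (\<exists>U. openin T U \<and> 0 \<in> U \<and> (\<forall>x\<in>U. q x < 1))"

locale normed_scalars = vector_space s
  for s :: "'k::real_normed_field \<Rightarrow> 'v::ab_group_add \<Rightarrow> 'v" (infixr "\<odot>" 75)
begin

lemma seminorm_zero: "seminorm_on s V q \<Longrightarrow> 0 \<in> V \<Longrightarrow> q 0 = 0"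
  unfolding seminorm_on_def by (metis mult_zero_left norm_zero scale_zero_left)

lemma seminorm_minus: "seminorm_on s V q \<Longrightarrow> x \<in> V \<Longrightarrow> q (- x) = q x"
  unfolding seminorm_on_def by (metis mult_1 norm_minus_cancel norm_one scale_minus_left scale_one)

lemma seminorm_ge0:
  assumes "seminorm_on s V q" "subspace V" "x \<in> V"
  shows "0 \<le> q x"
proof -
  have "q (x + - x) \<le> q x + q (- x)"
    using assms subspace_neg unfolding seminorm_on_def by blast
  then show ?thesis
    using seminorm_zero[OF assms(1)] seminorm_minus[OF assms(1,3)] subspace_0[OF assms(2)] by simp
qed

lemma seminorm_add: "seminorm_on s V q \<Longrightarrow> x \<in> V \<Longrightarrow> y \<in> V \<Longrightarrow> q (x + y) \<le> q x + q y"
  unfolding seminorm_on_def by blast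

lemma seminorm_scale: "seminorm_on s V q \<Longrightarrow> x \<in> V \<Longrightarrow> q (c \<odot> x) = norm c * q x"
  unfolding seminorm_on_def by blast

lemma seminorm_diff: 
  assumes "seminorm_on s V q" "subspace V" "x \<in> V" "y \<in> V" shows "q (x - y) \<le> q x + q y"
  using seminorm_add[OF assms(1,3), of "- y"] subspace_neg[OF assms(2,4)] seminorm_minus[OF assms(1,4)]
  by simp

lemma seminorm_sum:
  assumes "seminorm_on s V q" "subspace V" "\<And>i. i \<in> A \<Longrightarrow> f i \<in> V"
  shows "q (\<Sum>i\<in>A. f i) \<le> (\<Sum>i\<in>A. q (f i))"
  using assms(3)
proof (induction A rule: infinite_finite_induct)
  case (insert a A)
  have "q (f a + sum f A) \<le> q (f a) + q (sum f A)"
    by (rule seminorm_add[OF assms(1)]) (use insert in \<open>auto intro: subspace_sum[OF assms(2)]\<close>)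
  then show ?case using insert by fastforce
qed (use seminorm_zero[OF assms(1)] subspace_0[OF assms(2)] in auto)

lemma seminorm_on_add: "seminorm_on s V p \<Longrightarrow> seminorm_on s V q \<Longrightarrow> seminorm_on s V (\<lambda>x. p x + q x)"
  unfolding seminorm_on_def by (simp add: distrib_left) (smt (verit))

lemma seminorm_on_mult: "seminorm_on s V p \<Longrightarrow> 0 \<le> r \<Longrightarrow> seminorm_on s V (\<lambda>x. r * p x)"
  unfolding seminorm_on_def by (auto simp: algebra_simps) (metis distrib_left mult_left_mono)

lemma seminorm_on_zero: "seminorm_on s V (\<lambda>x. 0)"
  unfolding seminorm_on_def by simp

lemma seminorm_on_subset: "seminorm_on s V p \<Longrightarrow> W \<subseteq> V \<Longrightarrow> seminorm_on s W p"
  unfolding seminorm_on_def by blast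

context
  fixes T :: "'v topology"
  assumes lc: "locally_convex s T"
begin

lemma tvs_facts:
  "subspace (topspace T)" "Hausdorff_space T" "topspace T \<noteq> {0}"
  "continuous_map (prod_topology T T) T (\<lambda>(x, y). x + y)"
  "continuous_map (prod_topology euclidean T) T (\<lambda>(c, x). c \<odot> x)"
  using lc unfolding locally_convex_def tvs_def by auto

lemma zero_in_topspace: "0 \<in> topspace T"
  by (rule subspace_0[OF tvs_facts(1)])

lemma cont_seminorm_on: "cont_seminorm s T q \<Longrightarrow> seminorm_on s (topspace T) q"
  by (simp add: cont_seminorm_def)

lemma cont_seminorm_0: "cont_seminorm s T q \<Longrightarrow> q 0 = 0"
  using seminorm_zero[OF cont_seminorm_on zero_in_topspace] by blast

lemma cont_seminorm_ge0: "cont_seminorm s T q \<Longrightarrow> x \<in> topspace T \<Longrightarrow> 0 \<le> q x"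
  using seminorm_ge0[OF cont_seminorm_on tvs_facts(1)] by blast

lemma continuous_map_translate:
  assumes "a \<in> topspace T" shows "continuous_map T T (\<lambda>x. x + a)"
proof -
  have "continuous_map T (prod_topology T T) (\<lambda>x. (x, a))"
    using assms by (simp add: continuous_map_pairedI)
  from continuous_map_compose[OF this tvs_facts(4)] show ?thesis by (simp add: o_def)
qed

lemma continuous_map_scale: "continuous_map T T (\<lambda>x. c \<odot> x)"
proof -
  have "continuous_map T (prod_topology euclidean T) (\<lambda>x. (c, x))"
    by (simp add: continuous_map_pairedI)
  from continuous_map_compose[OF this tvs_facts(5)] show ?thesis by (simp add: o_def)
qed

lemma openin_affine_preimage:
  assumes "openin T U" "a \<in> topspace T"
  shows "openin T {x \<in> topspace T. c \<odot> (x - a) \<in> U}"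
proof -
  have "continuous_map T T (\<lambda>x. c \<odot> (x + - a))"
    using continuous_map_compose[OF continuous_map_translate[of "- a"] continuous_map_scale[of c]]
      assms(2) subspace_neg[OF tvs_facts(1)] by (simp add: o_def)
  from openin_continuous_map_preimage[OF this assms(1)] show ?thesis by simp
qed

lemma seminorm_ball_open:
  assumes q: "cont_seminorm s T q" and a: "a \<in> topspace T"
  shows "openin T {x \<in> topspace T. q (x - a) < r}"
proof (subst openin_subopen, safe)
  note V = tvs_facts(1)
  have sn: "seminorm_on s (topspace T) q" using q by (simp add: cont_seminorm_def)
  fix y assume y: "y \<in> topspace T" "q (y - a) < r"
  define d where "d = r - q (y - a)"
  have d: "d > 0" using y by (simp add: d_def)
  obtain U where U: "openin T U" "0 \<in> U" "\<And>x. x \<in> U \<Longrightarrow> q x < 1"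
    using q by (auto simp: cont_seminorm_def)
  let ?W = "{x \<in> topspace T. of_real (1 / d) \<odot> (x - y) \<in> U}"
  have "?W \<subseteq> {x \<in> topspace T. q (x - a) < r}"
  proof safe
    fix x assume x: "x \<in> topspace T" "of_real (1 / d) \<odot> (x - y) \<in> U"
    have xy: "x - y \<in> topspace T" "y - a \<in> topspace T" using x y a V subspace_diff by blast+
    have "norm (of_real (1 / d) :: 'k) * q (x - y) < 1"
      using U(3)[OF x(2)] seminorm_scale[OF sn xy(1)] by metis
    then have "q (x - y) < d" using d by (simp add: norm_divide field_simps)
    moreover have "q ((x - y) + (y - a)) \<le> q (x - y) + q (y - a)"
      using seminorm_add[OF sn xy] .
    ultimately show "q (x - a) < r" by (simp add: d_def)
  qed
  then show "\<exists>W. openin T W \<and> y \<in> W \<and> W \<subseteq> {x \<in> topspace T. q (x - a) < r}"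
    using openin_affine_preimage[OF U(1) y(1), of "of_real (1 / d)"] y(1) U(2)
    by (intro exI[of _ ?W]) auto
qed

lemma cont_seminorm_dominated:
  assumes "seminorm_on s (topspace T) q" "cont_seminorm s T p" "\<And>x. x \<in> topspace T \<Longrightarrow> q x \<le> C * p x"
  shows "cont_seminorm s T q"
proof -
  note p0 = zero_in_topspace
  \<comment> \<open>Positive whatever the sign of \<open>C\<close>, so that a ball of radius
    \<open>1 / ?C\<close> is a neighbourhood of 0.\<close>
  let ?C = "\<bar>C\<bar> + 1"
  let ?U = "{x \<in> topspace T. p (x - 0) < 1 / ?C}"
  have "openin T ?U" by (rule seminorm_ball_open[OF assms(2) p0])
  moreover have "0 \<in> ?U"
    using p0 cont_seminorm_0[OF assms(2)] by simp
  moreover have "q x < 1" if "x \<in> ?U" for x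
  proof -
    have x: "x \<in> topspace T" "p x < 1 / ?C" using that by auto
    have "0 \<le> p x" by (rule cont_seminorm_ge0[OF assms(2) x(1)])
    then have "C * p x \<le> ?C * p x" by (intro mult_right_mono) auto
    also have "\<dots> < 1" using x(2) by (simp add: field_simps)
    finally show ?thesis using assms(3)[OF x(1)] by linarith
  qed
  ultimately show ?thesis using assms(1) unfolding cont_seminorm_def by blast
qed

lemma cont_seminorm_mult: 
  assumes "cont_seminorm s T p" "0 \<le> r" shows "cont_seminorm s T (\<lambda>x. r * p x)"
  by (rule cont_seminorm_dominated[of _ p r])
     (use assms in \<open>auto simp: cont_seminorm_def seminorm_on_mult\<close>)

lemma cont_seminorm_zero: "cont_seminorm s T (\<lambda>x. 0)"
  unfolding cont_seminorm_def using seminorm_on_zero zero_in_topspace openin_topspace by fastforce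

lemma cont_seminorm_add:
  assumes "cont_seminorm s T p" "cont_seminorm s T q"
  shows "cont_seminorm s T (\<lambda>x. p x + q x)"
proof -
  note 0 = zero_in_topspace
  have p: "cont_seminorm s T (\<lambda>x. 2 * p x)" "cont_seminorm s T (\<lambda>x. 2 * q x)"
    using assms cont_seminorm_mult by auto
  then obtain U W where "openin T U" "0 \<in> U" "\<forall>x\<in>U. 2 * p x < 1" "openin T W" "0 \<in> W" "\<forall>x\<in>W. 2 * q x < 1"
    unfolding cont_seminorm_def by blast
  then have "openin T (U \<inter> W)" "0 \<in> U \<inter> W" "\<forall>x\<in>U \<inter> W. p x + q x < 1" by force+
  then show ?thesis using assms seminorm_on_add unfolding cont_seminorm_def by blast
qed

lemma cont_seminorm_sum:
  "(\<And>i. i \<in> A \<Longrightarrow> cont_seminorm s T (p i)) \<Longrightarrow> cont_seminorm s T (\<lambda>x. \<Sum>i\<in>A. p i x)"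
  by (induction A rule: infinite_finite_induct) (simp_all add: cont_seminorm_add cont_seminorm_zero)

text \<open>The gauge of the largest balanced subset of a convex open neighbourhood.\<close>

lemma open_contains_seminorm_ball:
  assumes U: "openin T U" "0 \<in> U"
  shows "\<exists>q. cont_seminorm s T q \<and> (\<forall>x\<in>topspace T. q x < 1 \<longrightarrow> x \<in> U)"
proof -
  note V = tvs_facts(1)
  note V0 = zero_in_topspace
  obtain W where W: "openin T W" "0 \<in> W" "W \<subseteq> U" "convex_wrt s W"
    using lc U unfolding locally_convex_def by metis
  define C where "C = {x \<in> topspace T. \<forall>c. norm c \<le> 1 \<longrightarrow> c \<odot> x \<in> W}"
  have C0: "0 \<in> C" using V0 W(2) by (simp add: C_def)
  have CV: "C \<subseteq> topspace T" by (auto simp: C_def)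
  have CW: "C \<subseteq> W" unfolding C_def by (auto dest: spec[of _ 1])
  have bal: "c \<odot> x \<in> C" if "x \<in> C" "norm c \<le> 1" for c x
    using that V unfolding C_def by (auto simp: subspace_scale norm_mult mult_le_one)
  have conv: "of_real (1 - t) \<odot> x + of_real t \<odot> y \<in> C" if "x \<in> C" "y \<in> C" "0 \<le> t" "t \<le> 1" for x y and t :: real
  proof -
    have "c \<odot> (of_real (1 - t) \<odot> x + of_real t \<odot> y) \<in> W" if c: "norm c \<le> 1" for c
    proof -
      have "of_real (1 - t) \<odot> (c \<odot> x) + of_real t \<odot> (c \<odot> y) \<in> W"
        using W(4) \<open>x \<in> C\<close> \<open>y \<in> C\<close> c \<open>0 \<le> t\<close> \<open>t \<le> 1\<close> unfolding convex_wrt_def C_def by blast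
      then show ?thesis by (simp add: scale_right_distrib mult.commute del: of_real_diff)
    qed
    then show ?thesis using that CV V unfolding C_def
      by (auto intro!: subspace_add subspace_scale)
  qed
  \<comment> \<open>Joint continuity of scalar multiplication at \<open>(0, 0)\<close> gives a ball
    of scalars of radius \<open>d\<close> and a neighbourhood \<open>B\<close> whose product lies in
    \<open>W\<close>. Rescaling \<open>B\<close> by \<open>d / 2\<close> turns the ball of scalars
    into the closed unit ball.\<close>
  have "\<exists>N. openin T N \<and> 0 \<in> N \<and> N \<subseteq> C"
  proof -
    define Z where "Z = {z \<in> topspace (prod_topology euclidean T). (case z of (c, x) \<Rightarrow> c \<odot> x) \<in> W}"
    have "openin (prod_topology euclidean T) Z"
      unfolding Z_def by (rule openin_continuous_map_preimage[OF tvs_facts(5) W(1)])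
    moreover have "(0, 0) \<in> Z"
      using V0 W(2) by (simp add: Z_def)
    ultimately have "\<exists>A B. openin euclidean A \<and> openin T B \<and> 0 \<in> A \<and> 0 \<in> B \<and> A \<times> B \<subseteq> Z"
      by (simp only: openin_prod_topology_alt)
    then obtain A B where AB: "openin euclidean A" "openin T B" "0 \<in> A" "0 \<in> B" "A \<times> B \<subseteq> Z"
      by blast
    obtain d where d: "d > 0" "ball (0::'k) d \<subseteq> A" using AB(1,3) open_contains_ball by (metis open_openin)
    let ?N = "{x \<in> topspace T. of_real (2 / d) \<odot> (x - 0) \<in> B}"
    have "openin T ?N" by (rule openin_affine_preimage[OF AB(2) V0])
    moreover have "0 \<in> ?N" using V0 AB(4) by simp
    moreover have "x \<in> C" if "x \<in> ?N" for x
    proof -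
      have x: "x \<in> topspace T" "of_real (2 / d) \<odot> x \<in> B" using that by auto
      have "c \<odot> x \<in> W" if "norm c \<le> 1" for c
      proof -
        have "norm (c * of_real (d / 2)) < d"
          using d(1) that mult_right_mono[OF that, of "d/2"] by (simp add: norm_mult norm_divide)
        then have "c * of_real (d / 2) \<in> A" using d(2) by auto
        then have "(c * of_real (d / 2)) \<odot> (of_real (2 / d) \<odot> x) \<in> W" using AB(5) x(2) by (auto simp: Z_def)
        moreover have "c * of_real (d / 2) * of_real (2 / d) = c"
          using d(1) by simp
        ultimately show ?thesis by (simp only: scale_scale)
      qed
      then show ?thesis using x by (simp add: C_def)
    qed
    ultimately show ?thesis by blast
  qed
  then obtain N where N: "openin T N" "0 \<in> N" "N \<subseteq> C" by blast
  define S where "S x = {r. r > 0 \<and> of_real (1 / r) \<odot> x \<in> C}" for x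
  define q where "q x = Inf (S x)" for x
  have bdd: "bdd_below (S x)" for x by (rule bdd_belowI[of _ 0]) (auto simp: S_def)
  have S_up: "r' \<in> S x" if "r \<in> S x" "r \<le> r'" for r r' x
  proof -
    have "of_real (r / r') \<odot> (of_real (1 / r) \<odot> x) \<in> C"
      by (rule bal) (use that in \<open>auto simp: S_def norm_divide\<close>)
    moreover have "r / r' * (1 / r) = 1 / r'"
      using that by (simp add: S_def)
    then have "of_real (r / r') * of_real (1 / r) = (of_real (1 / r') :: 'k)"
      by (metis of_real_mult)
    ultimately show ?thesis using that by (auto simp: S_def)
  qed
  have S_ne: "S x \<noteq> {}" if x: "x \<in> topspace T" for x
  proof -
    have "continuous_map euclidean T (\<lambda>c. c \<odot> x)"
    proof -
      have "continuous_map euclidean (prod_topology euclidean T) (\<lambda>c::'k. (c, x))"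
        using x by (simp add: continuous_map_pairedI)
      from continuous_map_compose[OF this tvs_facts(5)] show ?thesis by (simp add: o_def)
    qed
    from openin_continuous_map_preimage[OF this N(1)] have "open {c. c \<odot> x \<in> N}" by simp
    moreover have "0 \<in> {c. c \<odot> x \<in> N}" using N(2) by simp
    ultimately obtain d where d: "d > 0" "ball (0::'k) d \<subseteq> {c. c \<odot> x \<in> N}"
      by (meson open_contains_ball)
    then have "of_real (d / 2) \<in> ball (0::'k) d" by (simp add: norm_divide)
    then have "of_real (d / 2) \<odot> x \<in> C" using d(2) N(3) by blast
    then have "2 / d \<in> S x" using d(1) by (simp add: S_def)
    then show ?thesis by blast
  qed
  have q_less: "q x < r \<Longrightarrow> r \<in> S x" if "x \<in> topspace T" for x r
    unfolding q_def using cInf_lessD[OF S_ne[OF that]] S_up by (metis less_imp_le)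
  have q_le: "q x \<le> r" if "r \<in> S x" for x r
    unfolding q_def using bdd that by (rule cInf_lower[rotated])
  have q_ge0: "0 \<le> q x" if "x \<in> topspace T" for x
    unfolding q_def by (rule cInf_greatest[OF S_ne[OF that]]) (auto simp: S_def)
  have add: "q (x + y) \<le> q x + q y" if x: "x \<in> topspace T" and y: "y \<in> topspace T" for x y
  proof (rule field_le_epsilon)
    fix e :: real assume e: "e > 0"
    define a b where "a = q x + e / 2" and "b = q y + e / 2"
    have a: "a \<in> S x" and b: "b \<in> S y" using q_less x y e by (auto simp: a_def b_def)
    then have ab: "a > 0" "b > 0" by (auto simp: S_def)
    \<comment> \<open>The weights \<open>a / (a + b)\<close> and \<open>b / (a + b)\<close> cancel
      the factors \<open>1 / a\<close> and \<open>1 / b\<close>, which leaves \<open>x + y\<close>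
      scaled by \<open>1 / (a + b)\<close>.\<close>
    have "of_real (1 - b / (a + b)) \<odot> (of_real (1 / a) \<odot> x) + of_real (b / (a + b)) \<odot> (of_real (1 / b) \<odot> y) \<in> C"
      by (rule conv) (use a b ab in \<open>auto simp: S_def\<close>)
    moreover have "of_real (1 - b / (a + b)) * of_real (1 / a) = (of_real (1 / (a + b)) :: 'k)"
      "of_real (b / (a + b)) * of_real (1 / b) = (of_real (1 / (a + b)) :: 'k)"
      using ab by (simp_all add: field_simps flip: of_real_mult)
    ultimately have "of_real (1 / (a + b)) \<odot> (x + y) \<in> C"
      by (simp only: scale_scale scale_right_distrib)
    then have "a + b \<in> S (x + y)" using ab by (simp add: S_def)
    from q_le[OF this] show "q (x + y) \<le> q x + q y + e" by (simp add: a_def b_def)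
  qed
  have le: "q (c \<odot> x) \<le> norm c * q x" if x: "x \<in> topspace T" for c x
  proof (cases "c = 0")
    case True
    have "q 0 \<le> r" if "r > 0" for r by (rule q_le) (use that C0 in \<open>simp add: S_def\<close>)
    then have "q 0 \<le> 0" by (meson dense not_le)
    then show ?thesis using True by simp
  next
    case False
    show ?thesis
    proof (rule field_le_epsilon)
      fix e :: real assume e: "e > 0"
      define r where "r = q x + e / norm c"
      have r: "r \<in> S x" using q_less[OF x] e False by (simp add: r_def)
      then have r0: "r > 0" by (simp add: S_def)
      have "(c / of_real (norm c)) \<odot> (of_real (1 / r) \<odot> x) \<in> C"
        by (rule bal) (use r in \<open>auto simp: S_def norm_divide\<close>)
      moreover have "c / of_real (norm c) * of_real (1 / r) = of_real (1 / (norm c * r)) * c"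
        by (simp add: field_simps)
      ultimately have "of_real (1 / (norm c * r)) \<odot> (c \<odot> x) \<in> C" by (simp only: scale_scale)
      then have "norm c * r \<in> S (c \<odot> x)" using r0 False by (simp add: S_def)
      moreover have "norm c * r = norm c * q x + e" using False by (simp add: r_def distrib_left)
      ultimately show "q (c \<odot> x) \<le> norm c * q x + e" using q_le by metis
    qed
  qed
  have scl: "q (c \<odot> x) = norm c * q x" if x: "x \<in> topspace T" for c x
  proof (cases "c = 0")
    case True then show ?thesis using le[OF x, of 0] q_ge0[OF V0] by simp
  next
    case False
    have "q (inverse c \<odot> (c \<odot> x)) \<le> norm (inverse c) * q (c \<odot> x)"
      by (rule le) (use x V subspace_scale in blast)
    then have "norm c * q x \<le> q (c \<odot> x)" using False by (simp add: norm_divide field_simps)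
    then show ?thesis using le[OF x, of c] by linarith
  qed
  have sn: "seminorm_on s (topspace T) q" unfolding seminorm_on_def using add scl by blast
  have "cont_seminorm s T q"
    unfolding cont_seminorm_def
  proof (intro conjI sn exI ballI)
    let ?U = "{x \<in> topspace T. of_real 2 \<odot> (x - 0) \<in> N}"
    show "openin T ?U" by (rule openin_affine_preimage[OF N(1) V0])
    show "0 \<in> ?U" using N(2) V0 by simp
    fix x assume "x \<in> ?U"
    then have "of_real (1 / (1/2)) \<odot> x \<in> C" using N(3) by auto
    then have "1/2 \<in> S x" unfolding S_def by auto
    from q_le[OF this] show "q x < 1" by simp
  qed
  moreover have "x \<in> U" if "x \<in> topspace T" "q x < 1" for x
    using q_less[OF that] CW W(3) by (auto simp: S_def)
  ultimately show ?thesis by blast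
qed

text \<open>Balls of radius 1 suffice, since positive multiples of continuous seminorms are
  continuous.\<close>

lemma openin_iff_seminorm_balls:
  "openin T U \<longleftrightarrow> U \<subseteq> topspace T \<and>
     (\<forall>x\<in>U. \<exists>q. cont_seminorm s T q \<and> {y \<in> topspace T. q (y - x) < 1} \<subseteq> U)" (is "?L \<longleftrightarrow> ?R")
proof
  assume L: ?L
  show ?R
  proof (intro conjI ballI)
    show "U \<subseteq> topspace T" by (rule openin_subset[OF L])
    fix x assume x: "x \<in> U"
    then have xT: "x \<in> topspace T" "- x \<in> topspace T" using \<open>U \<subseteq> topspace T\<close> subspace_neg tvs_facts(1) by blast+
    have "openin T {y \<in> topspace T. 1 \<odot> (y - - x) \<in> U}"
      by (rule openin_affine_preimage[OF L xT(2)])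
    moreover have "0 \<in> {y \<in> topspace T. 1 \<odot> (y - - x) \<in> U}"
      using x subspace_0 tvs_facts(1) by simp
    ultimately obtain q where q: "cont_seminorm s T q" 
      "\<And>z. z \<in> topspace T \<Longrightarrow> q z < 1 \<Longrightarrow> z \<in> {y \<in> topspace T. 1 \<odot> (y - - x) \<in> U}"
      using open_contains_seminorm_ball by blast
    have "y \<in> U" if "y \<in> topspace T" "q (y - x) < 1" for y
      using q(2)[of "y - x"] that subspace_diff[OF tvs_facts(1) that(1) xT(1)] by simp
    then show "\<exists>q. cont_seminorm s T q \<and> {y \<in> topspace T. q (y - x) < 1} \<subseteq> U" using q(1) by blast
  qed
next
  assume R: ?R
  show ?L
  proof (subst openin_subopen, safe)
    fix x assume x: "x \<in> U"
    then obtain q where q: "cont_seminorm s T q" "{y \<in> topspace T. q (y - x) < 1} \<subseteq> U" using R by blast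
    have xT: "x \<in> topspace T" using R x by blast
    have "x \<in> {y \<in> topspace T. q (y - x) < 1}"
      using xT cont_seminorm_0[OF q(1)] by simp
    then show "\<exists>S. openin T S \<and> x \<in> S \<and> S \<subseteq> U" using seminorm_ball_open[OF q(1) xT, of 1] q(2) by blast
  qed
qed

lemma seminorms_separate:
  assumes "x \<in> topspace T" "x \<noteq> 0"
  shows "\<exists>q. cont_seminorm s T q \<and> q x > 0"
proof -
  note 0 = zero_in_topspace
  obtain U where U: "openin T U" "0 \<in> U" "x \<notin> U"
    using tvs_facts(2) assms 0 unfolding Hausdorff_space_def by (metis disjnt_iff)
  obtain q where q: "cont_seminorm s T q" "\<forall>x\<in>topspace T. q x < 1 \<longrightarrow> x \<in> U"
    using open_contains_seminorm_ball[OF U(1,2)] by blast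
  then have "q x \<ge> 1" using assms U(3) by force
  then show ?thesis using q(1) by (intro exI[of _ q]) auto
qed

lemma dense_iff_seminorms:
  assumes "S \<subseteq> topspace T"
  shows "T closure_of S = topspace T \<longleftrightarrow>
    (\<forall>y\<in>topspace T. \<forall>q. cont_seminorm s T q \<longrightarrow> (\<exists>x\<in>S. q (x - y) < 1))" (is "?L \<longleftrightarrow> ?R")
proof
  assume L: ?L
  show ?R
  proof (intro ballI allI impI)
    fix y q assume y: "y \<in> topspace T" and q: "cont_seminorm s T q"
    have "y \<in> T closure_of S" using L y by simp
    then have "y \<in> W \<and> openin T W \<Longrightarrow> \<exists>x. x \<in> S \<and> x \<in> W" for W
      by (simp add: in_closure_of)
    from this[of "{x \<in> topspace T. q (x - y) < 1}"] show "\<exists>x\<in>S. q (x - y) < 1"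
      using y cont_seminorm_0[OF q] seminorm_ball_open[OF q y, of 1] by auto
  qed
next
  assume R: ?R
  have "y \<in> T closure_of S" if y: "y \<in> topspace T" for y
    unfolding in_closure_of
  proof (intro conjI y allI impI, elim conjE)
    fix U assume U: "y \<in> U" "openin T U"
    obtain q where q: "cont_seminorm s T q" "{z \<in> topspace T. q (z - y) < 1} \<subseteq> U"
      using openin_iff_seminorm_balls[THEN iffD1, OF U(2)] U(1) by blast
    obtain x where "x \<in> S" "q (x - y) < 1" using R[rule_format, OF y q(1)] by blast
    then show "\<exists>x. x \<in> S \<and> x \<in> U" using q(2) subsetD[OF assms] by (auto intro!: exI[of _ x])
  qed
  then show ?L using closure_of_subset_topspace[of T S] by (intro equalityI subsetI) auto
qed

end

end

section \<open>Locally convex topologies generated by a family of seminorms\<close>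

context normed_scalars
begin

text \<open>For families closed under sums and positive multiples, one seminorm and the radius 1
  replace finite intersections of balls of all radii.\<close>

definition seminorm_topology :: "'v set \<Rightarrow> ('v \<Rightarrow> real) set \<Rightarrow> 'v topology" where
  "seminorm_topology V Q = topology (\<lambda>U. U \<subseteq> V \<and> (\<forall>x\<in>U. \<exists>q\<in>Q. {y \<in> V. q (y - x) < 1} \<subseteq> U))"

context
  fixes V :: "'v set" and Q :: "('v \<Rightarrow> real) set"
  assumes V: "subspace V" "V \<noteq> {0}"
    and Q: "\<And>q. q \<in> Q \<Longrightarrow> seminorm_on s V q"
    and Q_add: "\<And>p q. p \<in> Q \<Longrightarrow> q \<in> Q \<Longrightarrow> (\<lambda>x. p x + q x) \<in> Q"
    and Q_mult: "\<And>p r. p \<in> Q \<Longrightarrow> 0 < r \<Longrightarrow> (\<lambda>x. r * p x) \<in> Q"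
    and Q_ne: "Q \<noteq> {}"
    and Q_sep: "\<And>x. x \<in> V \<Longrightarrow> x \<noteq> 0 \<Longrightarrow> \<exists>q\<in>Q. q x > 0"
begin

lemma openin_seminorm_topology:
  "openin (seminorm_topology V Q) U \<longleftrightarrow> U \<subseteq> V \<and> (\<forall>x\<in>U. \<exists>q\<in>Q. {y \<in> V. q (y - x) < 1} \<subseteq> U)"
proof -
  have "istopology (\<lambda>U. U \<subseteq> V \<and> (\<forall>x\<in>U. \<exists>q\<in>Q. {y \<in> V. q (y - x) < 1} \<subseteq> U))"
    unfolding istopology_def
  proof (intro conjI allI impI ballI)
    fix S T x 
    assume S: "S \<subseteq> V \<and> (\<forall>x\<in>S. \<exists>q\<in>Q. {y \<in> V. q (y - x) < 1} \<subseteq> S)"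
      and T: "T \<subseteq> V \<and> (\<forall>x\<in>T. \<exists>q\<in>Q. {y \<in> V. q (y - x) < 1} \<subseteq> T)" and x: "x \<in> S \<inter> T"
    obtain p where p: "p \<in> Q" "{y \<in> V. p (y - x) < 1} \<subseteq> S" using S x by blast
    obtain q where q: "q \<in> Q" "{y \<in> V. q (y - x) < 1} \<subseteq> T" using T x by blast
    have xV: "x \<in> V" using x S by blast
    have "p (y - x) \<ge> 0" "q (y - x) \<ge> 0" if "y \<in> V" for y
      using seminorm_ge0[OF Q[OF p(1)] V(1)] seminorm_ge0[OF Q[OF q(1)] V(1)]
        subspace_diff[OF V(1) that xV] by simp_all
    then have "{y \<in> V. p (y - x) + q (y - x) < 1} \<subseteq> S \<inter> T" using p(2) q(2) by fastforce
    then show "\<exists>r\<in>Q. {y \<in> V. r (y - x) < 1} \<subseteq> S \<inter> T" by (rule bexI[OF _ Q_add[OF p(1) q(1)]])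
  next
    fix K
    assume K: "\<forall>U\<in>K. U \<subseteq> V \<and> (\<forall>x\<in>U. \<exists>q\<in>Q. {y \<in> V. q (y - x) < 1} \<subseteq> U)"
    show "\<Union> K \<subseteq> V" using K by blast
    fix x assume "x \<in> \<Union> K"
    then obtain U where U: "U \<in> K" "x \<in> U" by blast
    then obtain q where "q \<in> Q" "{y \<in> V. q (y - x) < 1} \<subseteq> U" using K[rule_format, OF U(1)] by blast
    then show "\<exists>q\<in>Q. {y \<in> V. q (y - x) < 1} \<subseteq> \<Union> K" using U(1) by (intro bexI[of _ q]) auto
  qed blast
  then show ?thesis unfolding seminorm_topology_def by (simp add: topology_inverse')
qed

lemma topspace_seminorm_topology: "topspace (seminorm_topology V Q) = V"
proof -
  have "openin (seminorm_topology V Q) V" using Q_ne by (auto simp: openin_seminorm_topology)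
  then show ?thesis
    using openin_subset openin_topspace openin_seminorm_topology by (metis subset_antisym)
qed

lemma seminorm_topology_ball:
  assumes "q \<in> Q" "a \<in> V" "r > 0"
  shows "\<exists>U. openin (seminorm_topology V Q) U \<and> a \<in> U \<and> (\<forall>x\<in>U. q (x - a) < r)"
proof (intro exI conjI)
  let ?U = "{x \<in> V. q (x - a) < r}"
  show "openin (seminorm_topology V Q) ?U"
    unfolding openin_seminorm_topology
  proof (intro conjI ballI)
    fix x assume x: "x \<in> ?U"
    define d where "d = r - q (x - a)"
    have d: "d > 0" using x by (simp add: d_def)
    have "{y \<in> V. 1 / d * q (y - x) < 1} \<subseteq> ?U"
    proof safe
      fix y assume y: "y \<in> V" "1 / d * q (y - x) < 1"
      have "q ((y - x) + (x - a)) \<le> q (y - x) + q (x - a)"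
        by (rule seminorm_add[OF Q[OF assms(1)]]) (use x y assms(2) subspace_diff[OF V(1)] in auto)
      then show "q (y - a) < r" using y(2) d by (simp add: d_def field_simps)
    qed
    moreover have "(\<lambda>x. 1 / d * q x) \<in> Q" by (rule Q_mult) (use assms(1) d in auto)
    ultimately show "\<exists>q\<in>Q. {y \<in> V. q (y - x) < 1} \<subseteq> ?U" by (rule bexI)
  qed auto
  show "a \<in> ?U" using assms seminorm_zero[OF Q[OF assms(1)] subspace_0[OF V(1)]] by simp
  show "\<forall>x\<in>?U. q (x - a) < r" by simp
qed

lemma cont_seminorm_seminorm_topology: "q \<in> Q \<Longrightarrow> cont_seminorm s (seminorm_topology V Q) q"
  unfolding cont_seminorm_def topspace_seminorm_topology
  using Q seminorm_topology_ball[of q 0 1] subspace_0[OF V(1)] by auto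

lemma locally_convex_seminorm_topology: "locally_convex s (seminorm_topology V Q)" (is "locally_convex s ?T")
  unfolding locally_convex_def tvs_def topspace_seminorm_topology
proof (intro conjI V allI impI)
  note op = openin_seminorm_topology and tp = topspace_seminorm_topology
  show "vector_space s" by (rule vector_space_axioms)
  have open_ball: "\<exists>U. openin ?T U \<and> a \<in> U \<and> U \<subseteq> V \<and> (\<forall>x\<in>U. q (x - a) < r)" 
    if "q \<in> Q" "a \<in> V" "r > 0" for q a r
    using seminorm_topology_ball[OF that] openin_subset tp by metis
  show "Hausdorff_space ?T"
    unfolding Hausdorff_space_def tp
  proof (intro allI impI)
    fix x y assume xy: "x \<in> V \<and> y \<in> V \<and> x \<noteq> y"
    then obtain q where q: "q \<in> Q" "q (x - y) > 0"
      using Q_sep[of "x - y"] subspace_diff[OF V(1)] by auto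
    obtain A where A: "openin ?T A" "x \<in> A" "A \<subseteq> V" "\<forall>z\<in>A. q (z - x) < q (x - y) / 2"
      using open_ball[of q x "q (x - y) / 2"] q xy by auto
    obtain B where B: "openin ?T B" "y \<in> B" "B \<subseteq> V" "\<forall>z\<in>B. q (z - y) < q (x - y) / 2"
      using open_ball[of q y "q (x - y) / 2"] q xy by auto
    have False if "z \<in> A" "z \<in> B" for z
    proof -
      have "q ((z - y) - (z - x)) \<le> q (z - y) + q (z - x)"
        by (rule seminorm_diff[OF Q[OF q(1)] V(1)]) (use that A(3) xy subspace_diff[OF V(1)] in auto)
      then have "q (x - y) \<le> q (z - y) + q (z - x)" by simp
      then show False using A(4)[rule_format, OF that(1)] B(4)[rule_format, OF that(2)] by linarith
    qed
    then show "\<exists>U W. openin ?T U \<and> openin ?T W \<and> x \<in> U \<and> y \<in> W \<and> disjnt U W"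
      using A(1,2) B(1,2) unfolding disjnt_iff by blast
  qed
  show "continuous_map (prod_topology ?T ?T) ?T (\<lambda>(x, y). x + y)"
    unfolding continuous_map_def
  proof (intro conjI allI impI)
    show "(\<lambda>(x, y). x + y) \<in> topspace (prod_topology ?T ?T) \<rightarrow> topspace ?T"
      using subspace_add[OF V(1)] by (auto simp: tp)
    fix U assume U: "openin ?T U"
    show "openin (prod_topology ?T ?T) {z \<in> topspace (prod_topology ?T ?T). (case z of (x, y) \<Rightarrow> x + y) \<in> U}"
      unfolding openin_prod_topology_alt
    proof (intro allI impI)
      fix x y assume "(x, y) \<in> {z \<in> topspace (prod_topology ?T ?T). (case z of (x, y) \<Rightarrow> x + y) \<in> U}"
      then have xy: "x \<in> V" "y \<in> V" "x + y \<in> U" by (auto simp: tp)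
      then obtain q where q: "q \<in> Q" "{z \<in> V. q (z - (x + y)) < 1} \<subseteq> U" using U unfolding op by blast
      obtain A where A: "openin ?T A" "x \<in> A" "A \<subseteq> V" "\<forall>z\<in>A. q (z - x) < 1 / 2"
        using open_ball[of q x "1 / 2"] q xy by auto
      obtain B where B: "openin ?T B" "y \<in> B" "B \<subseteq> V" "\<forall>z\<in>B. q (z - y) < 1 / 2"
        using open_ball[of q y "1 / 2"] q xy by auto
      have "a + b \<in> U" if ab: "a \<in> A" "b \<in> B" for a b
      proof -
        have "q ((a - x) + (b - y)) \<le> q (a - x) + q (b - y)"
          by (rule seminorm_add[OF Q[OF q(1)]]) (use ab A(3) B(3) xy subspace_diff[OF V(1)] in auto)
        also have "\<dots> < 1" using A(4)[rule_format, OF ab(1)] B(4)[rule_format, OF ab(2)] by linarith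
        finally have "q ((a + b) - (x + y)) < 1" by (simp add: algebra_simps)
        moreover have "a + b \<in> V" using ab A(3) B(3) subspace_add[OF V(1)] by blast
        ultimately show ?thesis using q(2) by blast
      qed
      then have "A \<times> B \<subseteq> {z \<in> topspace (prod_topology ?T ?T). (case z of (x, y) \<Rightarrow> x + y) \<in> U}"
        using A(3) B(3) by (auto simp: tp)
      then show "\<exists>A B. openin ?T A \<and> openin ?T B \<and> x \<in> A \<and> y \<in> B \<and>
          A \<times> B \<subseteq> {z \<in> topspace (prod_topology ?T ?T). (case z of (x, y) \<Rightarrow> x + y) \<in> U}"
        using A(1,2) B(1,2) by blast
    qed
  qed
  show "continuous_map (prod_topology euclidean ?T) ?T (\<lambda>(c, x). c \<odot> x)"
    unfolding continuous_map_def
  proof (intro conjI allI impI)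
    show "(\<lambda>(c, x). c \<odot> x) \<in> topspace (prod_topology euclidean ?T) \<rightarrow> topspace ?T"
      using subspace_scale[OF V(1)] by (auto simp: tp)
    fix U assume U: "openin ?T U"
    show "openin (prod_topology euclidean ?T) {z \<in> topspace (prod_topology euclidean ?T). (case z of (c, x) \<Rightarrow> c \<odot> x) \<in> U}"
      unfolding openin_prod_topology_alt
    proof (intro allI impI)
      fix c x assume "(c, x) \<in> {z \<in> topspace (prod_topology euclidean ?T). (case z of (c, x) \<Rightarrow> c \<odot> x) \<in> U}"
      then have cx: "x \<in> V" "c \<odot> x \<in> U" by (auto simp: tp)
      then obtain q where q: "q \<in> Q" "{z \<in> V. q (z - c \<odot> x) < 1} \<subseteq> U" using U unfolding op by blast
      have qx: "q x \<ge> 0" using seminorm_ge0[OF Q[OF q(1)] V(1) cx(1)] .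
      \<comment> \<open>In \<open>b \<odot> a - c \<odot> x = b \<odot> (a - x) + (b - c) \<odot>
        x\<close> each term is to contribute at most 1/2. The \<open>min 1\<close> gives
        \<open>norm b \<le> norm c + 1\<close>, and the summands 1 in the denominators avoid
        division by zero.\<close>
      define d where "d = min 1 (1 / (2 * (q x + 1)))"
      define e where "e = 1 / (2 * (norm c + 1))"
      have de: "d > 0" "e > 0" using qx by (auto simp: d_def e_def add_pos_nonneg add_nonneg_pos)
      obtain A where A: "openin ?T A" "x \<in> A" "A \<subseteq> V" "\<forall>z\<in>A. q (z - x) < e"
        using open_ball[of q x e] q cx de by auto
      have "b \<odot> a \<in> U" if ab: "a \<in> A" "b \<in> ball c d" for a b
      proof -
        have V': "b \<odot> (a - x) \<in> V" "(b - c) \<odot> x \<in> V" "a - x \<in> V"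
          using ab A(3) cx subspace_diff[OF V(1)] subspace_scale[OF V(1)] by auto
        have bc: "norm (b - c) < d" using ab(2) by (simp add: dist_norm norm_minus_commute)
        then have "norm b \<le> norm c + 1" using norm_triangle_ineq2[of b c] by (simp add: d_def)
        then have "norm b * q (a - x) \<le> (norm c + 1) * q (a - x)"
          using seminorm_ge0[OF Q[OF q(1)] V(1) V'(3)] by (intro mult_right_mono) auto
        also have "\<dots> < (norm c + 1) * e" 
          using A(4)[rule_format, OF ab(1)] by (intro mult_strict_left_mono) (auto simp: add_nonneg_pos)
        also have "\<dots> = 1 / 2"
        proof -
          have "norm c + 1 \<noteq> 0" using norm_ge_zero[of c] by linarith
          then show ?thesis by (simp add: e_def)
        qed
        finally have 1: "norm b * q (a - x) < 1 / 2" .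
        have "norm (b - c) * q x \<le> d * (q x + 1)"
          using bc qx de by (intro mult_mono) auto
        also have "\<dots> \<le> 1 / (2 * (q x + 1)) * (q x + 1)"
          using qx by (intro mult_right_mono) (auto simp: d_def)
        also have "\<dots> = 1 / 2" using qx by (simp add: add_nonneg_eq_0_iff)
        finally have 2: "norm (b - c) * q x \<le> 1 / 2" .
        have "q (b \<odot> (a - x) + (b - c) \<odot> x) \<le> q (b \<odot> (a - x)) + q ((b - c) \<odot> x)"
          by (rule seminorm_add[OF Q[OF q(1)] V'(1,2)])
        also have "\<dots> = norm b * q (a - x) + norm (b - c) * q x"
          using seminorm_scale[OF Q[OF q(1)]] V'(3) cx(1) by simp
        also have "\<dots> < 1" using 1 2 by linarith
        finally have "q (b \<odot> a - c \<odot> x) < 1" by (simp add: algebra_simps)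
        moreover have "b \<odot> a \<in> V" using ab A(3) subspace_scale[OF V(1)] by blast
        ultimately show ?thesis using q(2) by blast
      qed
      then have "ball c d \<times> A \<subseteq> {z \<in> topspace (prod_topology euclidean ?T). (case z of (c, x) \<Rightarrow> c \<odot> x) \<in> U}"
        using A(3) by (auto simp: tp)
      moreover have "openin euclidean (ball c d)" "c \<in> ball c d" using de by auto
      ultimately show "\<exists>A B. openin euclidean A \<and> openin ?T B \<and> c \<in> A \<and> x \<in> B \<and>
          A \<times> B \<subseteq> {z \<in> topspace (prod_topology euclidean ?T). (case z of (c, x) \<Rightarrow> c \<odot> x) \<in> U}"
        using A(1,2) by blast
    qed
  qed
  fix U assume U: "openin ?T U \<and> 0 \<in> U"
  then obtain q where q: "q \<in> Q" "{y \<in> V. q (y - 0) < 1} \<subseteq> U" unfolding op by blast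
  have sq: "seminorm_on s V q" using Q q(1) .
  let ?B = "{y \<in> V. q y < 1}"
  have "openin ?T ?B"
  proof (subst openin_subopen, safe)
    fix x assume x: "x \<in> V" "q x < 1"
    obtain A where A: "openin ?T A" "x \<in> A" "A \<subseteq> V" "\<forall>z\<in>A. q (z - x) < 1 - q x"
      using open_ball[of q x "1 - q x"] q x by auto
    have "z \<in> ?B" if "z \<in> A" for z
    proof -
      have "q ((z - x) + x) \<le> q (z - x) + q x"
        by (rule seminorm_add[OF sq]) (use that A(3) x subspace_diff[OF V(1)] in auto)
      moreover have "q (z - x) < 1 - q x" using A(4) that by blast
      ultimately show ?thesis using that A(3) by auto
    qed
    then show "\<exists>W. openin ?T W \<and> x \<in> W \<and> W \<subseteq> ?B" using A(1,2) by blast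
  qed
  moreover have "0 \<in> ?B" using seminorm_zero[OF sq] subspace_0[OF V(1)] by simp
  moreover have "convex_wrt s ?B"
    unfolding convex_wrt_def
  proof (intro ballI allI impI)
    fix x y and t :: real assume x: "x \<in> ?B" and y: "y \<in> ?B" and t: "0 \<le> t \<and> t \<le> 1"
    have xy: "of_real (1 - t) \<odot> x \<in> V" "of_real t \<odot> y \<in> V"
      using x y subspace_scale[OF V(1)] by auto
    have "q (of_real (1 - t) \<odot> x + of_real t \<odot> y) \<le> (1 - t) * q x + t * q y"
      using seminorm_add[OF sq xy] x y t seminorm_scale[OF sq] by (simp del: of_real_diff)
    also have "\<dots> \<le> (1 - t) * max (q x) (q y) + t * max (q x) (q y)"
      using t by (intro add_mono mult_left_mono) auto
    also have "\<dots> < 1" using x y by (simp add: algebra_simps)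
    finally show "of_real (1 - t) \<odot> x + of_real t \<odot> y \<in> ?B" using xy subspace_add[OF V(1)] by auto
  qed
  ultimately show "\<exists>W. openin ?T W \<and> 0 \<in> W \<and> W \<subseteq> U \<and> convex_wrt s W" using q(2) by (intro exI[of _ ?B]) auto
qed

end

end

lemma locally_convex_normed_scalars: "locally_convex s T \<Longrightarrow> normed_scalars s"
  unfolding locally_convex_def tvs_def normed_scalars_def by blast

text \<open>By linearity continuity is only a matter of neighbourhoods of 0, and these are described
  by seminorms. From here on continuity of operators is checked on seminorms.\<close>

lemma continuous_linear_iff_seminorms:
  fixes s :: "'k::real_normed_field \<Rightarrow> 'v::ab_group_add \<Rightarrow> 'v" and s' :: "'k \<Rightarrow> 'w::ab_group_add \<Rightarrow> 'w"
  assumes T: "locally_convex s T" and T': "locally_convex s' T'"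
    and f: "f \<in> topspace T \<rightarrow> topspace T'"
    and add: "\<And>x y. x \<in> topspace T \<Longrightarrow> y \<in> topspace T \<Longrightarrow> f (x + y) = f x + f y"
    and scl: "\<And>c x. x \<in> topspace T \<Longrightarrow> f (s c x) = s' c (f x)"
  shows "continuous_map T T' f \<longleftrightarrow> (\<forall>q. cont_seminorm s' T' q \<longrightarrow> cont_seminorm s T (\<lambda>x. q (f x)))"
proof -
  interpret a: normed_scalars s by (rule locally_convex_normed_scalars[OF T])
  interpret b: normed_scalars s' by (rule locally_convex_normed_scalars[OF T'])
  note V = a.tvs_facts(1)[OF T] and V' = b.tvs_facts(1)[OF T']
  have f0: "f 0 = 0" using add[OF a.zero_in_topspace[OF T] a.zero_in_topspace[OF T]] by simp
  have diff: "f (x - y) = f x - f y" if "x \<in> topspace T" "y \<in> topspace T" for x y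
    using add[of "x - y" y] that a.subspace_diff[OF V] by simp
  have sn: "seminorm_on s (topspace T) (\<lambda>x. q (f x))" if "cont_seminorm s' T' q" for q
    using b.cont_seminorm_on[OF T' that] f add scl unfolding seminorm_on_def by (simp add: Pi_iff)
  show ?thesis
  proof safe
    fix q assume c: "continuous_map T T' f" and q: "cont_seminorm s' T' q"
    have "openin T' {y \<in> topspace T'. q (y - 0) < 1}"
      by (rule b.seminorm_ball_open[OF T' q b.zero_in_topspace[OF T']])
    from openin_continuous_map_preimage[OF c this]
    have "openin T {x \<in> topspace T. f x \<in> {y \<in> topspace T'. q (y - 0) < 1}}" .
    moreover have "0 \<in> {x \<in> topspace T. f x \<in> {y \<in> topspace T'. q (y - 0) < 1}}"
      using a.zero_in_topspace[OF T] b.zero_in_topspace[OF T'] f0 b.cont_seminorm_0[OF T' q] by simp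
    ultimately show "cont_seminorm s T (\<lambda>x. q (f x))"
      unfolding cont_seminorm_def using sn[OF q] by fastforce
  next
    assume R: "\<forall>q. cont_seminorm s' T' q \<longrightarrow> cont_seminorm s T (\<lambda>x. q (f x))"
    show "continuous_map T T' f"
      unfolding continuous_map_def
    proof (intro conjI f allI impI)
      fix U assume U: "openin T' U"
      show "openin T {x \<in> topspace T. f x \<in> U}"
        unfolding a.openin_iff_seminorm_balls[OF T]
      proof (intro conjI ballI)
        fix x assume x: "x \<in> {x \<in> topspace T. f x \<in> U}"
        then obtain q where q: "cont_seminorm s' T' q" "{y \<in> topspace T'. q (y - f x) < 1} \<subseteq> U"
          using U b.openin_iff_seminorm_balls[OF T', THEN iffD1, OF U] by blast
        have "{y \<in> topspace T. q (f (y - x)) < 1} \<subseteq> {x \<in> topspace T. f x \<in> U}"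
          using q(2) x f diff by auto
        then show "\<exists>q. cont_seminorm s T q \<and> {y \<in> topspace T. q (y - x) < 1} \<subseteq> {x \<in> topspace T. f x \<in> U}"
          using R q(1) by (intro exI[of _ "\<lambda>x. q (f x)"]) auto
      qed auto
    qed
  qed
qed

section \<open>The locally convex direct sum\<close>

lemma dsum_inj_add: "dsum_inj i (x + y) = dsum_inj i x + dsum_inj i y"
  by (auto simp: dsum_inj_def fun_eq_iff)

lemma dsum_inj_zero [simp]: "dsum_inj i 0 = 0"
  by (auto simp: dsum_inj_def fun_eq_iff)

lemma dsum_inj_same [simp]: "dsum_inj i x i = x"
  by (simp add: dsum_inj_def)

lemma dsum_inj_other: "j \<noteq> i \<Longrightarrow> dsum_inj i x j = 0"
  by (simp add: dsum_inj_def)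

lemma dsum_decompose:
  assumes "finite A" "\<And>i. i \<notin> A \<Longrightarrow> f i = 0"
  shows "f = (\<Sum>i\<in>A. dsum_inj i (f i))"
proof
  fix j
  have "(\<Sum>i\<in>A. dsum_inj i (f i)) j = (\<Sum>i\<in>A. dsum_inj i (f i) j)"
    using assms(1) by (induction A rule: finite_induct) auto
  also have "\<dots> = (\<Sum>i\<in>A. if i = j then f j else 0)"
    by (rule sum.cong) (auto simp: dsum_inj_def)
  also have "\<dots> = f j" using assms by simp
  finally show "f j = (\<Sum>i\<in>A. dsum_inj i (f i)) j" by simp
qed

locale lc_family = normed_scalars s for s :: "'k::real_normed_field \<Rightarrow> 'v::ab_group_add \<Rightarrow> 'v" (infixr "\<odot>" 75) +
  fixes X :: "'i \<Rightarrow> 'v topology"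
  assumes lc: "\<And>i. locally_convex s (X i)"
begin

sublocale d: normed_scalars "dsum_scale s"
  by (intro normed_scalars.intro vector_space_dsum_scale vector_space_axioms)

abbreviation "C \<equiv> dsum_carrier X"
abbreviation "DT \<equiv> dsum_topology s X"

lemma subspace_X: "subspace (topspace (X i))"
  using tvs_facts(1)[OF lc] .

lemma subspace_C: "d.subspace C"
  by (rule subspace_dsum_carrier[OF vector_space_axioms]) (simp add: subspace_X)

lemma inj_in_C: "x \<in> topspace (X i) \<Longrightarrow> dsum_inj i x \<in> C"
  by (rule dsum_inj_in[OF vector_space_axioms]) (simp_all add: subspace_X)

lemma inj_scale: "dsum_inj i (c \<odot> x) = dsum_scale s c (dsum_inj i x)"
  by (auto simp: dsum_inj_def dsum_scale_def fun_eq_iff)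

lemma coord_in_X: "f \<in> C \<Longrightarrow> f i \<in> topspace (X i)"
  by (simp add: dsum_carrier_def)

lemma seminorm_on_coord: "seminorm_on s (topspace (X i)) q \<Longrightarrow> seminorm_on (dsum_scale s) C (\<lambda>f. q (f i))"
  using coord_in_X unfolding seminorm_on_def dsum_scale_def by auto

definition dsum_seminorms :: "(('i \<Rightarrow> 'v) \<Rightarrow> real) set" where
  "dsum_seminorms = {q. seminorm_on (dsum_scale s) C q \<and> (\<forall>i. cont_seminorm s (X i) (\<lambda>x. q (dsum_inj i x)))}"

lemma coord_seminorm:
  assumes "cont_seminorm s (X i) q" shows "(\<lambda>f. q (f i)) \<in> dsum_seminorms"
  unfolding dsum_seminorms_def
proof (safe intro!: seminorm_on_coord cont_seminorm_on[OF lc] assms)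
  fix j show "cont_seminorm s (X j) (\<lambda>x. q (dsum_inj j x i))"
    using assms cont_seminorm_zero[OF lc] cont_seminorm_0[OF lc assms] by (cases "i = j") (auto simp: dsum_inj_other)
qed

text \<open>The seminorms that are continuous on every summand generate an admissible topology. The
  strongest admissible topology is finer than it, and so all of them become continuous there. The
  coordinate seminorms belong to the family; they separate points and make the coordinate maps
  continuous.\<close>

lemma dsum_admissible_seminorm_topology:
  "dsum_admissible s X (d.seminorm_topology C dsum_seminorms)"
  "q \<in> dsum_seminorms \<Longrightarrow> cont_seminorm (dsum_scale s) (d.seminorm_topology C dsum_seminorms) q"
proof -
  let ?T = "d.seminorm_topology C dsum_seminorms"
  let ?Q = dsum_seminorms
  have nt: "C \<noteq> {0}" 
    by (rule dsum_nontrivial[OF vector_space_axioms, of X undefined]) (simp_all add: subspace_X tvs_facts(3)[OF lc])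
  have Q: "\<And>q. q \<in> ?Q \<Longrightarrow> seminorm_on (dsum_scale s) C q" by (simp add: dsum_seminorms_def)
  have Q_add: "\<And>p q. p \<in> ?Q \<Longrightarrow> q \<in> ?Q \<Longrightarrow> (\<lambda>x. p x + q x) \<in> ?Q"
    by (auto simp: dsum_seminorms_def intro: d.seminorm_on_add cont_seminorm_add[OF lc])
  have Q_mult: "\<And>p r. p \<in> ?Q \<Longrightarrow> 0 < r \<Longrightarrow> (\<lambda>x. r * p x) \<in> ?Q"
    by (auto simp: dsum_seminorms_def intro!: d.seminorm_on_mult cont_seminorm_mult[OF lc])
  have Q_sep: "\<exists>q\<in>?Q. q x > 0" if x: "x \<in> C" "x \<noteq> 0" for x
  proof -
    obtain i where "x i \<noteq> 0" using x(2) by (auto simp: fun_eq_iff)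
    then obtain q where "cont_seminorm s (X i) q" "q (x i) > 0"
      using seminorms_separate[OF lc coord_in_X[OF x(1)]] by blast
    then show ?thesis using coord_seminorm by force
  qed
  have "(\<lambda>x. 0) \<in> ?Q" by (simp add: dsum_seminorms_def d.seminorm_on_zero cont_seminorm_zero[OF lc])
  then have Q_ne: "?Q \<noteq> {}" by blast
  note assms = subspace_C nt Q Q_add Q_mult Q_ne Q_sep
  have top: "topspace ?T = C" by (rule d.topspace_seminorm_topology[OF assms])
  have lcT: "locally_convex (dsum_scale s) ?T" by (rule d.locally_convex_seminorm_topology[OF assms])
  show cont: "cont_seminorm (dsum_scale s) ?T q" if "q \<in> ?Q" for q
    by (rule d.cont_seminorm_seminorm_topology[OF assms that])
  have opn: "openin ?T U \<longleftrightarrow> U \<subseteq> C \<and> (\<forall>x\<in>U. \<exists>q\<in>?Q. {y \<in> C. q (y - x) < 1} \<subseteq> U)" for U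
    by (rule d.openin_seminorm_topology[OF assms])
  have "embedding_map (X i) ?T (dsum_inj i)" for i
  proof (rule embedding_by_coordinate)
    show "continuous_map (X i) ?T (dsum_inj i)"
      unfolding continuous_map_def
    proof (intro conjI allI impI)
      show "dsum_inj i \<in> topspace (X i) \<rightarrow> topspace ?T" using inj_in_C top by auto
      fix U assume U: "openin ?T U"
      show "openin (X i) {x \<in> topspace (X i). dsum_inj i x \<in> U}"
        unfolding openin_iff_seminorm_balls[OF lc]
      proof (intro conjI ballI)
        fix x assume x: "x \<in> {x \<in> topspace (X i). dsum_inj i x \<in> U}"
        then obtain q where q: "q \<in> ?Q" "{y \<in> C. q (y - dsum_inj i x) < 1} \<subseteq> U"
          using U unfolding opn by blast
        have "dsum_inj i y - dsum_inj i x = dsum_inj i (y - x)" for y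
          by (auto simp: dsum_inj_def fun_eq_iff)
        then have "{y \<in> topspace (X i). q (dsum_inj i (y - x)) < 1} \<subseteq> {x \<in> topspace (X i). dsum_inj i x \<in> U}"
          using q(2) inj_in_C by auto
        moreover have "cont_seminorm s (X i) (\<lambda>x. q (dsum_inj i x))"
          using q(1) by (simp add: dsum_seminorms_def)
        ultimately show "\<exists>q. cont_seminorm s (X i) q \<and> {y \<in> topspace (X i). q (y - x) < 1}
            \<subseteq> {x \<in> topspace (X i). dsum_inj i x \<in> U}" by (intro exI[of _ "\<lambda>x. q (dsum_inj i x)"]) simp
      qed auto
    qed
    show "continuous_map ?T (X i) (\<lambda>f. f i)"
    proof (subst continuous_linear_iff_seminorms[OF lcT lc])
      show "(\<lambda>f. f i) \<in> topspace ?T \<rightarrow> topspace (X i)" using coord_in_X top by auto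
    qed (auto simp: dsum_scale_def coord_seminorm cont)
  qed
  then show "dsum_admissible s X ?T"
    unfolding dsum_admissible_def using lcT top by blast
qed

lemma lc_DT: "locally_convex (dsum_scale s) DT"
  and topspace_DT: "topspace DT = C"
  and inj_continuous: "continuous_map (X i) DT (dsum_inj i)"
proof -
  have adm: "dsum_admissible s X DT" by (rule dsum_topology_strongest(1)[OF lc])
  then show "locally_convex (dsum_scale s) DT" "topspace DT = C" by (auto simp: dsum_admissible_def)
  have "homeomorphic_map (X i) (subtopology DT (dsum_inj i ` topspace (X i))) (dsum_inj i)"
    using adm unfolding dsum_admissible_def embedding_map_def by blast
  from homeomorphic_imp_continuous_map[OF this] show "continuous_map (X i) DT (dsum_inj i)"
    by (simp add: continuous_map_in_subtopology)
qed

text \<open>From left to right by continuity of the injections, from right to left by maximality of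
  \<open>dsum_topology\<close>.\<close>

lemma cont_seminorm_DT_iff:
  "cont_seminorm (dsum_scale s) DT q \<longleftrightarrow>
     seminorm_on (dsum_scale s) C q \<and> (\<forall>i. cont_seminorm s (X i) (\<lambda>x. q (dsum_inj i x)))" (is "?L \<longleftrightarrow> ?R")
proof
  assume L: ?L
  have "cont_seminorm s (X i) (\<lambda>x. q (dsum_inj i x))" for i
    using continuous_linear_iff_seminorms[OF lc lc_DT, of "dsum_inj i" i] inj_continuous L
    by (auto simp: topspace_DT inj_in_C dsum_inj_add inj_scale)
  then show ?R using d.cont_seminorm_on[OF lc_DT L] by (simp add: topspace_DT)
next
  assume ?R
  then have q: "q \<in> dsum_seminorms" by (simp add: dsum_seminorms_def)
  obtain U where "openin (d.seminorm_topology C dsum_seminorms) U" "0 \<in> U" "\<forall>x\<in>U. q x < 1"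
    using dsum_admissible_seminorm_topology(2)[OF q] unfolding cont_seminorm_def by blast
  moreover from this(1) have "openin DT U"
    by (rule dsum_topology_strongest(2)[OF lc dsum_admissible_seminorm_topology(1)])
  ultimately show ?L using \<open>?R\<close> unfolding cont_seminorm_def topspace_DT by blast
qed

lemma cont_seminorm_coord: "cont_seminorm s (X i) q \<Longrightarrow> cont_seminorm (dsum_scale s) DT (\<lambda>f. q (f i))"
  using coord_seminorm unfolding cont_seminorm_DT_iff dsum_seminorms_def by blast

end

section \<open>The Hahn--Banach theorem\<close>

definition linear_functional :: "('k::real_normed_field \<Rightarrow> 'v::ab_group_add \<Rightarrow> 'v) \<Rightarrow> ('v \<Rightarrow> 'k) \<Rightarrow> bool" where
  "linear_functional s f \<longleftrightarrow> (\<forall>x y. f (x + y) = f x + f y) \<and> (\<forall>c x. f (s c x) = c * f x)"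

lemma linear_functionalD:
  assumes "linear_functional s f"
  shows "f (x + y) = f x + f y" "f (s c x) = c * f x" "f 0 = 0" "f (- x) = - f x" "f (x - y) = f x - f y"
proof -
  show add: "f (x + y) = f x + f y" for x y using assms unfolding linear_functional_def by auto
  show "f (s c x) = c * f x" using assms unfolding linear_functional_def by auto
  show zero: "f 0 = 0" using add[of 0 0] by simp
  show minus: "f (- x) = - f x" for x using add[of x "- x"] zero by (simp add: add_eq_0_iff)
  show "f (x - y) = f x - f y" using add[of x "- y"] minus[of y] by simp
qed

lemma linear_functional_sum: "linear_functional s f \<Longrightarrow> f (\<Sum>i\<in>A. g i) = (\<Sum>i\<in>A. f (g i))"
  by (induction A rule: infinite_finite_induct) (simp_all add: linear_functionalD)

definition sublinear :: "(real \<Rightarrow> 'v::ab_group_add \<Rightarrow> 'v) \<Rightarrow> ('v \<Rightarrow> real) \<Rightarrow> bool" where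
  "sublinear s q \<longleftrightarrow> (\<forall>x y. q (x + y) \<le> q x + q y) \<and> (\<forall>r\<ge>0. \<forall>x. q (s r x) = r * q x)"

text \<open>A property of the scalar multiplication, so that the development is carried out once for
  a general normed field and only this property is proved separately for real and complex scalars.
  The number \<open>d\<close> bounds the \<open>p\<close>-distance of \<open>b\<close> from
  \<open>F\<close> from below.\<close>

definition hahn_banach :: "('k::real_normed_field \<Rightarrow> 'v::ab_group_add \<Rightarrow> 'v) \<Rightarrow> bool" where
  "hahn_banach s \<longleftrightarrow> (\<forall>p F b d. seminorm_on s UNIV p \<longrightarrow> module.subspace s F \<longrightarrow> 0 < d \<longrightarrow> (\<forall>y\<in>F. d \<le> p (b - y)) \<longrightarrow>
     (\<exists>f. linear_functional s f \<and> f b = 1 \<and> (\<forall>y\<in>F. f y = 0) \<and> (\<forall>x. norm (f x) \<le> p x / d)))"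

context
  fixes s :: "real \<Rightarrow> 'v::ab_group_add \<Rightarrow> 'v" (infixr "*r" 75)
  assumes vs: "vector_space s"
begin

interpretation vector_space s by (rule vs)

lemma sublinear_zero: "sublinear s q \<Longrightarrow> q 0 = 0"
  unfolding sublinear_def by (metis mult_zero_left order_refl scale_zero_left)

lemma sublinear_neg: 
  assumes "sublinear s q" shows "- q (- x) \<le> q x"
proof -
  have "q (x + - x) \<le> q x + q (- x)" using assms unfolding sublinear_def by blast
  then show ?thesis using sublinear_zero[OF assms] by simp
qed

lemma sublinearD:
  assumes "sublinear s q"
  shows "q (x + y) \<le> q x + q y" "r \<ge> 0 \<Longrightarrow> q (r *r x) = r * q x"
  using assms unfolding sublinear_def by auto

text \<open>The witness is \<open>q' x = inf (q (x + t *r y) - t * q y)\<close> over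
  \<open>t \<ge> 0\<close>: \<open>t = 0\<close> gives \<open>q' \<le> q\<close>, and
  \<open>t = 1\<close> at \<open>- y\<close> gives the last claim. Consequently a minimal sublinear
  functional is odd, hence linear.\<close>

lemma sublinear_reduce:
  assumes q: "sublinear s q"
  shows "\<exists>q'. sublinear s q' \<and> (\<forall>x. q' x \<le> q x) \<and> q' (- y) \<le> - q y"
proof -
  define S where "S x = (\<lambda>t. q (x + t *r y) - t * q y) ` {0..}" for x
  define q' where "q' x = Inf (S x)" for x
  have lb: "- q (- x) \<le> q (x + t *r y) - t * q y" if "t \<ge> 0" for x t
  proof -
    have "q ((x + t *r y) + (- x)) \<le> q (x + t *r y) + q (- x)" by (rule sublinearD(1)[OF q])
    then show ?thesis using sublinearD(2)[OF q that, of y] by simp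
  qed
  have bdd: "bdd_below (S x)" for x
    unfolding S_def using lb by (intro bdd_belowI2[of _ "- q (- x)"]) auto
  have ne: "S x \<noteq> {}" for x by (auto simp: S_def)
  have le: "q' x \<le> q (x + t *r y) - t * q y" if "t \<ge> 0" for x t
    unfolding q'_def using bdd that by (intro cInf_lower) (auto simp: S_def)
  have ex: "\<exists>t\<ge>0. q (x + t *r y) - t * q y < q' x + e" if "e > 0" for x e
  proof -
    have "\<exists>z\<in>S x. z < q' x + e"
      using cInf_lessD[OF ne, of x "q' x + e"] that unfolding q'_def by auto
    then show ?thesis by (auto simp: S_def)
  qed
  have le_q: "q' x \<le> q x" for x using le[of 0 x] by simp
  have add: "q' (x + z) \<le> q' x + q' z" for x z
  proof (rule field_le_epsilon)
    fix e :: real assume "e > 0"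
    then obtain t u where t: "t \<ge> 0" "q (x + t *r y) - t * q y < q' x + e / 2"
      and u: "u \<ge> 0" "q (z + u *r y) - u * q y < q' z + e / 2" using ex[of "e / 2"] by (metis half_gt_zero)
    have "q' (x + z) \<le> q ((x + z) + (t + u) *r y) - (t + u) * q y" using le t(1) u(1) by auto
    also have "(x + z) + (t + u) *r y = (x + t *r y) + (z + u *r y)" by (simp add: scale_left_distrib)
    also have "q \<dots> \<le> q (x + t *r y) + q (z + u *r y)" by (rule sublinearD(1)[OF q])
    finally show "q' (x + z) \<le> q' x + q' z + e" using t(2) u(2) by (simp add: algebra_simps)
  qed
  have scl_le: "q' (r *r x) \<le> r * q' x" if r: "r > 0" for r x
  proof (rule field_le_epsilon)
    fix e :: real assume "e > 0"
    then obtain t where t: "t \<ge> 0" "q (x + t *r y) - t * q y < q' x + e / r" using ex r by (metis divide_pos_pos)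
    have "q' (r *r x) \<le> q (r *r x + (r * t) *r y) - (r * t) * q y" using le t(1) r by auto
    also have "r *r x + (r * t) *r y = r *r (x + t *r y)" by (simp add: scale_right_distrib)
    also have "q \<dots> = r * q (x + t *r y)" using sublinearD(2)[OF q] r by auto
    also have "\<dots> - r * t * q y = r * (q (x + t *r y) - t * q y)" by (simp add: algebra_simps)
    also have "\<dots> \<le> r * (q' x + e / r)" using t(2) r by (intro mult_left_mono) auto
    finally show "q' (r *r x) \<le> r * q' x + e" using r by (simp add: distrib_left)
  qed
  have q'0: "q' 0 = 0"
  proof (rule antisym)
    show "q' 0 \<le> 0" using le_q[of 0] sublinear_zero[OF q] by simp
    show "0 \<le> q' 0" unfolding q'_def
      by (rule cInf_greatest[OF ne]) (use sublinearD(2)[OF q] in \<open>auto simp: S_def\<close>)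
  qed
  have scl: "q' (r *r x) = r * q' x" if r: "r \<ge> 0" for r x
  proof (cases "r = 0")
    case True then show ?thesis using q'0 by simp
  next
    case False
    then have r: "r > 0" using r by simp
    have "q' (inverse r *r (r *r x)) \<le> inverse r * q' (r *r x)" by (rule scl_le) (use r in simp)
    then have "q' x \<le> q' (r *r x) / r" using r by (simp add: field_simps)
    then have "r * q' x \<le> q' (r *r x)" using r by (simp add: field_simps)
    then show ?thesis using scl_le[OF r, of x] by linarith
  qed
  have "q' (- y) \<le> - q y" using le[of 1 "- y"] sublinear_zero[OF q] by simp
  moreover have "sublinear s q'" unfolding sublinear_def using add scl by blast
  ultimately show ?thesis using le_q by blast
qed

lemma minimal_sublinear_is_linear:
  assumes q: "sublinear s q" and min: "\<And>q'. sublinear s q' \<Longrightarrow> (\<forall>x. q' x \<le> q x) \<Longrightarrow> q' = q"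
  shows "linear_functional s q"
proof -
  have neg: "q (- y) = - q y" for y
  proof -
    obtain q' where "sublinear s q'" "\<forall>x. q' x \<le> q x" "q' (- y) \<le> - q y"
      using sublinear_reduce[OF q] by blast
    then have "q (- y) \<le> - q y" using min by blast
    then show ?thesis using sublinear_neg[OF q, of y] by linarith
  qed
  have "q (x + y) = q x + q y" for x y
  proof (rule antisym[OF sublinearD(1)[OF q]])
    have "q (- x + - y) \<le> q (- x) + q (- y)" by (rule sublinearD(1)[OF q])
    moreover have "- x + - y = - (x + y)" by simp
    ultimately show "q x + q y \<le> q (x + y)" by (simp only: neg)
  qed
  moreover have "q (r *r x) = r * q x" for r x
  proof (cases "r \<ge> 0")
    case False
    then have "q ((- r) *r x) = - r * q x" by (intro sublinearD(2)[OF q]) simp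
    moreover have "(- r) *r x = - (r *r x)" by simp
    ultimately show ?thesis using neg[of "r *r x"] by simp
  qed (use sublinearD(2)[OF q] in auto)
  ultimately show ?thesis unfolding linear_functional_def by blast
qed

text \<open>Zorn's lemma provides a minimal sublinear functional below \<open>p\<close>. The
  pointwise infimum of a chain is finite because of the common lower bound \<open>- p (- x)\<close>,
  and it is subadditive because of any two members of the chain one lies below the other.\<close>

lemma exists_linear_below_sublinear:
  assumes p: "sublinear s p"
  shows "\<exists>f. linear_functional s f \<and> (\<forall>x. f x \<le> p x)"
proof -
  define A where "A = {q. sublinear s q \<and> (\<forall>x. q x \<le> p x)}"
  \<comment> \<open>The reversed pointwise order, as \<open>predicate_Zorn\<close> yields maximal
    elements.\<close>
  define P :: "('v \<Rightarrow> real) \<Rightarrow> ('v \<Rightarrow> real) \<Rightarrow> bool" where "P q q' \<longleftrightarrow> (\<forall>x. q' x \<le> q x)" for q q'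
  have "\<exists>m\<in>A. \<forall>a\<in>A. P m a \<longrightarrow> a = m"
  proof (rule predicate_Zorn)
    show "partial_order_on A (relation_of P A)"
      by (rule partial_order_on_relation_ofI) (auto simp: P_def fun_eq_iff intro: order_trans antisym)
    fix Ch assume Ch: "Ch \<in> Chains (relation_of P A)"
    then have sub: "Ch \<subseteq> A" by (auto simp: Chains_def relation_of_def)
    have tot: "P q q' \<or> P q' q" if "q \<in> Ch" "q' \<in> Ch" for q q'
      using Ch that by (auto simp: Chains_def relation_of_def)
    show "\<exists>u\<in>A. \<forall>a\<in>Ch. P a u"
    proof (cases "Ch = {}")
      case True then show ?thesis using p by (auto simp: A_def)
    next
      case False
      define u where "u x = (INF q\<in>Ch. q x)" for x
      have sl: "sublinear s q" if "q \<in> Ch" for q using that sub by (auto simp: A_def)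
      have "- p (- x) \<le> q x" if "q \<in> Ch" for q x
      proof -
        have "q (- x) \<le> p (- x)" using that sub by (auto simp: A_def)
        then show ?thesis using sublinear_neg[OF sl[OF that], of x] by linarith
      qed
      then have bdd: "bdd_below ((\<lambda>q. q x) ` Ch)" for x by (intro bdd_belowI2[of _ "- p (- x)"]) auto
      have le: "u x \<le> q x" if "q \<in> Ch" for q x unfolding u_def by (rule cINF_lower[OF bdd that])
      have ex: "\<exists>q\<in>Ch. q x < u x + e" if "e > 0" for x e
        using cINF_less_iff[OF False bdd, of x "u x + e"] that by (auto simp: u_def)
      have add: "u (x + y) \<le> u x + u y" for x y
      proof (rule field_le_epsilon)
        fix e :: real assume "e > 0"
        then obtain q q' where q: "q \<in> Ch" "q x < u x + e / 2" "q' \<in> Ch" "q' y < u y + e / 2"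
          using ex[of "e / 2"] by (metis half_gt_zero)
        obtain r where r: "r \<in> Ch" "r x \<le> q x" "r y \<le> q' y"
          using tot[OF q(1,3)] q(1,3) unfolding P_def by blast
        have "u (x + y) \<le> r x + r y" using le[OF r(1), of "x + y"] sublinearD(1)[OF sl[OF r(1)], of x y] by linarith
        then show "u (x + y) \<le> u x + u y + e" using q r by linarith
      qed
      have "u (c *r x) = c * u x" if c: "c \<ge> 0" for c x
      proof -
        have "(\<lambda>q. q (c *r x)) ` Ch = (\<lambda>q. c * q x) ` Ch"
          by (rule image_cong) (use sublinearD(2)[OF sl c] in auto)
        then have u: "u (c *r x) = (INF q\<in>Ch. c * q x)" unfolding u_def by simp
        show ?thesis
        proof (cases "c = 0")
          case True then show ?thesis using u False by simp
        next
          case c0: False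
          then have c: "c > 0" using c by simp
          have bddc: "bdd_below ((\<lambda>q. c * q x) ` Ch)"
            using le c by (intro bdd_belowI2[of _ "c * u x"]) (auto intro!: mult_left_mono)
          show ?thesis unfolding u
          proof (rule antisym)
            show "c * u x \<le> (INF q\<in>Ch. c * q x)"
              by (rule cINF_greatest[OF False]) (use le c in \<open>auto intro!: mult_left_mono\<close>)
            show "(INF q\<in>Ch. c * q x) \<le> c * u x"
            proof (rule field_le_epsilon)
              fix e :: real assume "e > 0"
              then obtain q where q: "q \<in> Ch" "q x < u x + e / c" using ex c by (metis divide_pos_pos)
              have "(INF q\<in>Ch. c * q x) \<le> c * q x" by (rule cINF_lower[OF bddc q(1)])
              also have "\<dots> \<le> c * (u x + e / c)" using q(2) c by (intro mult_left_mono) auto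
              finally show "(INF q\<in>Ch. c * q x) \<le> c * u x + e" using c by (simp add: distrib_left)
            qed
          qed
        qed
      qed
      then have "sublinear s u" unfolding sublinear_def using add by blast
      moreover have "u x \<le> p x" for x
      proof -
        obtain q where "q \<in> Ch" using False by blast
        then show ?thesis using le[of q x] sub by (auto simp: A_def intro: order_trans)
      qed
      ultimately show ?thesis using le by (auto simp: A_def P_def intro!: bexI[of _ u])
    qed
  qed
  then obtain m where m: "m \<in> A" "\<And>a. a \<in> A \<Longrightarrow> P m a \<Longrightarrow> a = m" by blast
  have "linear_functional s m"
  proof (rule minimal_sublinear_is_linear)
    show "sublinear s m" using m(1) by (simp add: A_def)
    fix q' assume "sublinear s q'" "\<forall>x. q' x \<le> m x"
    then show "q' = m" using m by (intro m(2)) (auto simp: A_def P_def intro: order_trans)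
  qed
  then show ?thesis using m(1) by (auto simp: A_def)
qed

text \<open>Reducing \<open>p\<close> in the direction \<open>b\<close> before the linear functional
  is chosen forces \<open>f (- b) \<le> - p b\<close>, hence equality at \<open>b\<close>.\<close>

lemma exists_norming_functional:
  assumes p: "sublinear s p" shows "\<exists>f. linear_functional s f \<and> (\<forall>x. f x \<le> p x) \<and> f b = p b"
proof -
  obtain q where q: "sublinear s q" "\<forall>x. q x \<le> p x" "q (- b) \<le> - p b" using sublinear_reduce[OF p] by blast
  obtain f where f: "linear_functional s f" "\<forall>x. f x \<le> q x" using exists_linear_below_sublinear[OF q(1)] by blast
  have "f (- b) = - f b" using linear_functionalD(4)[OF f(1)] by blast
  then have "p b \<le> f b" using f(2) q(3) by (metis neg_le_iff_le order_trans)
  moreover have "f x \<le> p x" for x using f(2) q(2) by (meson order_trans)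
  ultimately show ?thesis using f(1) by (intro exI[of _ f]) (simp add: antisym)
qed

end

text \<open>The quotient seminorm modulo \<open>F\<close>, lifted to the space. A functional bounded
  by it vanishes on \<open>F\<close>.\<close>

definition dist_seminorm :: "('v::ab_group_add \<Rightarrow> real) \<Rightarrow> 'v set \<Rightarrow> 'v \<Rightarrow> real" where
  "dist_seminorm p F x = (INF y\<in>F. p (x - y))"

context normed_scalars
begin

lemma dist_seminorm:
  assumes p: "seminorm_on s UNIV p" and F: "subspace F"
  shows "seminorm_on s UNIV (dist_seminorm p F)" "dist_seminorm p F x \<le> p x" 
    "y \<in> F \<Longrightarrow> dist_seminorm p F y = 0" "(\<And>y. y \<in> F \<Longrightarrow> d \<le> p (x - y)) \<Longrightarrow> d \<le> dist_seminorm p F x"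
proof -
  let ?q = "dist_seminorm p F"
  have p0: "p x \<ge> 0" for x by (rule seminorm_ge0[OF p]) auto
  have ne: "F \<noteq> {}" using subspace_0[OF F] by blast
  have bdd: "bdd_below ((\<lambda>y. p (x - y)) ` F)" for x using p0 by (intro bdd_belowI2[of _ 0]) auto
  have le: "?q x \<le> p (x - y)" if "y \<in> F" for x y unfolding dist_seminorm_def by (rule cINF_lower[OF bdd that])
  have ge: "d \<le> ?q x" if "\<And>y. y \<in> F \<Longrightarrow> d \<le> p (x - y)" for d x
    unfolding dist_seminorm_def by (rule cINF_greatest[OF ne that])
  show "(\<And>y. y \<in> F \<Longrightarrow> d \<le> p (x - y)) \<Longrightarrow> d \<le> dist_seminorm p F x" by (rule ge)
  have ex: "\<exists>y\<in>F. p (x - y) < ?q x + e" if "e > 0" for x e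
    using cINF_less_iff[OF ne bdd, of x "?q x + e"] that by (auto simp: dist_seminorm_def)
  show "?q x \<le> p x" using le[OF subspace_0[OF F], of x] by simp
  show "?q y = 0" if "y \<in> F"
    using le[OF that, of y] ge[of 0 y] p0 seminorm_zero[OF p] by force
  have scl_le: "?q (c \<odot> x) \<le> norm c * ?q x" if c: "c \<noteq> 0" for c x
  proof (rule field_le_epsilon)
    fix e :: real assume "e > 0"
    then obtain y where y: "y \<in> F" "p (x - y) < ?q x + e / norm c" using ex[of "e / norm c" x] c by auto
    have "?q (c \<odot> x) \<le> p (c \<odot> x - c \<odot> y)" using le subspace_scale[OF F y(1)] by blast
    also have "\<dots> = norm c * p (x - y)" using seminorm_scale[OF p, of "x - y" c] by (simp add: scale_right_diff_distrib)
    also have "\<dots> \<le> norm c * (?q x + e / norm c)" using y(2) by (intro mult_left_mono) auto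
    finally show "?q (c \<odot> x) \<le> norm c * ?q x + e" using c by (simp add: distrib_left)
  qed
  show "seminorm_on s UNIV ?q"
    unfolding seminorm_on_def
  proof (intro conjI ballI allI)
    fix x z
    show "?q (x + z) \<le> ?q x + ?q z"
    proof (rule field_le_epsilon)
      fix e :: real assume e: "e > 0"
      obtain a where a: "a \<in> F" "p (x - a) < ?q x + e / 2" using ex[of "e / 2" x] e by auto
      obtain b where b: "b \<in> F" "p (z - b) < ?q z + e / 2" using ex[of "e / 2" z] e by auto
      have "?q (x + z) \<le> p ((x + z) - (a + b))" using le subspace_add[OF F a(1) b(1)] by blast
      also have "(x + z) - (a + b) = (x - a) + (z - b)" by simp
      also have "p \<dots> \<le> p (x - a) + p (z - b)" by (rule seminorm_add[OF p]) auto
      finally show "?q (x + z) \<le> ?q x + ?q z + e" using a b by linarith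
    qed
  next
    fix c x
    show "?q (c \<odot> x) = norm c * ?q x"
    proof (cases "c = 0")
      case True 
      have "?q 0 = 0" using le[OF subspace_0[OF F], of 0] ge[of 0 0] p0 seminorm_zero[OF p] by force
      then show ?thesis using True by simp
    next
      case False
      have "?q (inverse c \<odot> (c \<odot> x)) \<le> norm (inverse c) * ?q (c \<odot> x)" by (rule scl_le) (use False in simp)
      then have "norm c * ?q x \<le> ?q (c \<odot> x)" using False by (simp add: norm_divide field_simps)
      then show ?thesis using scl_le[OF False, of x] by linarith
    qed
  qed
qed

end

lemma hahn_banach_real:
  fixes s :: "real \<Rightarrow> 'v::ab_group_add \<Rightarrow> 'v"
  assumes "vector_space s" shows "hahn_banach s"
  unfolding hahn_banach_def
proof (intro allI impI)
  interpret normed_scalars s using assms by (rule normed_scalars.intro)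
  fix p :: "'v \<Rightarrow> real" and F :: "'v set" and b and d :: real
  assume p: "seminorm_on s UNIV p" and F: "subspace F" and d: "0 < d" and b: "\<forall>y\<in>F. d \<le> p (b - y)"
  let ?q = "dist_seminorm p F"
  note q = dist_seminorm[OF p F]
  have "sublinear s ?q" using q(1) unfolding seminorm_on_def sublinear_def by auto
  then obtain f where f: "linear_functional s f" "\<forall>x. f x \<le> ?q x" "f b = ?q b"
    using exists_norming_functional[OF assms] by blast
  have neg: "f (- x) = - f x" for x using linear_functionalD(4)[OF f(1)] by blast
  have abs: "\<bar>f x\<bar> \<le> ?q x" for x
    using f(2)[rule_format, of x] f(2)[rule_format, of "- x"] neg[of x] seminorm_minus[OF q(1), of x] by simp
  have db: "d \<le> f b" using q(4)[of d b] b f(3) by simp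
  show "\<exists>f. linear_functional s f \<and> f b = 1 \<and> (\<forall>y\<in>F. f y = 0) \<and> (\<forall>x. norm (f x) \<le> p x / d)"
  proof (intro exI[of _ "\<lambda>x. f x / f b"] conjI ballI allI)
    show "linear_functional s (\<lambda>x. f x / f b)"
      using f(1) unfolding linear_functional_def by (auto simp: add_divide_distrib)
    show "f b / f b = 1" using db d by simp
    show "f y / f b = 0" if "y \<in> F" for y using abs[of y] q(3)[OF that] by simp
    show "norm (f x / f b) \<le> p x / d" for x
    proof -
      have "\<bar>f x\<bar> \<le> p x" using abs[of x] q(2)[of x] by linarith
      then show ?thesis using db d by (auto simp: abs_divide intro!: frac_le)
    qed
  qed
qed

lemma hahn_banach_complex:
  fixes s :: "complex \<Rightarrow> 'v::ab_group_add \<Rightarrow> 'v"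
  assumes "vector_space s" shows "hahn_banach s"
  unfolding hahn_banach_def
proof (intro allI impI)
  interpret normed_scalars s using assms by (rule normed_scalars.intro)
  define r where "r c x = s (of_real c) x" for c x
  have r: "vector_space r"
    by unfold_locales (auto simp: r_def scale_right_distrib scale_left_distrib)
  fix p :: "'v \<Rightarrow> real" and F :: "'v set" and b and d :: real
  assume p: "seminorm_on s UNIV p" and F: "subspace F" and d: "0 < d" and b: "\<forall>y\<in>F. d \<le> p (b - y)"
  let ?q = "dist_seminorm p F"
  note q = dist_seminorm[OF p F]
  have "sublinear r ?q" using q(1) unfolding seminorm_on_def sublinear_def r_def by auto
  then obtain g where g: "linear_functional r g" "\<forall>x. g x \<le> ?q x" "g b = ?q b"
    using exists_norming_functional[OF r] by blast
  have g_add: "g (x + y) = g x + g y" and g_scl: "g (s (of_real c) x) = c * g x" for x y c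
    using g(1) unfolding linear_functional_def r_def by auto
  \<comment> \<open>The only complex linear functional with real part \<open>g\<close>.\<close>
  define f where "f x = Complex (g x) (- g (s \<i> x))" for x
  have f_add: "f (x + y) = f x + f y" for x y by (simp add: f_def g_add scale_right_distrib complex_eq_iff)
  have f_scl: "f (s c x) = c * f x" for c x
  proof -
    have "s c x = s (of_real (Re c)) x + s (of_real (Im c)) (s \<i> x)"
      by (simp add: complex_eq mult.commute flip: scale_left_distrib)
    then have 1: "g (s c x) = Re c * g x + Im c * g (s \<i> x)" by (simp only: g_add g_scl)
    have "s \<i> (s c x) = s (of_real (- Im c)) x + s (of_real (Re c)) (s \<i> x)"
    proof -
      have "\<i> * c = of_real (- Im c) + of_real (Re c) * \<i>" by (simp add: complex_eq_iff)
      then show ?thesis by (simp only: scale_scale scale_left_distrib)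
    qed
    then have 2: "g (s \<i> (s c x)) = - Im c * g x + Re c * g (s \<i> x)" by (simp only: g_add g_scl)
    show ?thesis using 1 2 by (simp add: f_def complex_eq_iff)
  qed
  have norm_f: "norm (f x) \<le> ?q x" for x
  proof -
    \<comment> \<open>A rotation makes the value real and non-negative; there it equals its real
      part, which \<open>g\<close> controls.\<close>
    obtain c where c: "norm c = 1" "c * f x = of_real (norm (f x))"
    proof (cases "f x = 0")
      case True then show ?thesis using that[of 1] by simp
    next
      case False
      have "cnj (f x) * f x = of_real (norm (f x)) * of_real (norm (f x))"
        by (metis complex_norm_square mult.commute of_real_mult of_real_power power2_eq_square)
      then show ?thesis using that[of "cnj (f x) / of_real (norm (f x))"] False by (simp add: norm_divide)
    qed
    have "norm (f x) = Re (f (s c x))" using c(2) by (simp add: f_scl)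
    also have "\<dots> \<le> ?q (s c x)" using g(2) by (simp add: f_def)
    also have "\<dots> = ?q x" using seminorm_scale[OF q(1)] c(1) by simp
    finally show ?thesis .
  qed
  have db: "d \<le> norm (f b)" using q(4)[of d b] b g(3) abs_Re_le_cmod[of "f b"] by (simp add: f_def)
  show "\<exists>f. linear_functional s f \<and> f b = 1 \<and> (\<forall>y\<in>F. f y = 0) \<and> (\<forall>x. norm (f x) \<le> p x / d)"
  proof (intro exI[of _ "\<lambda>x. f x / f b"] conjI ballI allI)
    show "linear_functional s (\<lambda>x. f x / f b)"
      using f_add f_scl unfolding linear_functional_def by (auto simp: add_divide_distrib)
    show "f b / f b = 1" using db d by auto
    show "f y / f b = 0" if "y \<in> F" for y using norm_f[of y] q(3)[OF that] by simp
    show "norm (f x / f b) \<le> p x / d" for x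
    proof -
      have "norm (f x) \<le> p x" using norm_f[of x] q(2)[of x] by linarith
      moreover have "0 \<le> p x" using calculation norm_ge_zero order_trans by blast
      ultimately show ?thesis using db d by (auto simp: norm_divide intro!: frac_le)
    qed
  qed
qed

section \<open>Frechet spaces\<close>

context normed_scalars
begin

text \<open>Domination holds with constant 1: every non-negative multiple of \<open>p k\<close>
  already lies below some later member of the sequence.\<close>

definition fundamental_seminorms :: "'v topology \<Rightarrow> (nat \<Rightarrow> 'v \<Rightarrow> real) \<Rightarrow> bool" where
  "fundamental_seminorms T p \<longleftrightarrow> (\<forall>k. cont_seminorm s T (p k)) \<and>
     (\<forall>j k x. j \<le> k \<longrightarrow> x \<in> topspace T \<longrightarrow> p j x \<le> p k x) \<and>
     (\<forall>q. cont_seminorm s T q \<longrightarrow> (\<exists>k. \<forall>x\<in>topspace T. q x \<le> p k x))"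

lemma seminorm_le_if_ball_subset:
  assumes q: "seminorm_on s V q" and p: "seminorm_on s V p" and V: "subspace V"
    and sub: "\<And>x. x \<in> V \<Longrightarrow> p x < 1 \<Longrightarrow> q x < 1" and x: "x \<in> V"
  shows "q x \<le> p x"
proof (rule ccontr)
  assume "\<not> q x \<le> p x"
  then obtain r where r: "p x < r" "r < q x" by (meson dense not_le)
  have r0: "r > 0" using r seminorm_ge0[OF p V x] by linarith
  let ?y = "of_real (1 / r) \<odot> x"
  have y: "?y \<in> V" by (rule subspace_scale[OF V x])
  have "p ?y = p x / r" "q ?y = q x / r"
    using r0 unfolding seminorm_scale[OF p x] seminorm_scale[OF q x] by (simp_all add: norm_divide)
  moreover have "p x / r < 1" "1 < q x / r" using r r0 by simp_all
  ultimately show False using sub[OF y] by simp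
qed

lemma metrizable_fundamental_seminorms:
  assumes lc: "locally_convex s T" and m: "metrizable_space T"
  obtains p where "fundamental_seminorms T p"
proof -
  note V = tvs_facts(1)[OF lc]
  obtain \<B> where B: "countable \<B>" "\<And>U. U \<in> \<B> \<Longrightarrow> openin T U"
    "\<And>U. openin T U \<Longrightarrow> 0 \<in> U \<Longrightarrow> \<exists>W\<in>\<B>. 0 \<in> W \<and> W \<subseteq> U"
    using metrizable_imp_first_countable[OF m] zero_in_topspace[OF lc] unfolding first_countable_def by metis
  define W where "W = from_nat_into \<B>"
  have "\<B> \<noteq> {}" using B(3)[OF openin_topspace zero_in_topspace[OF lc]] by blast
  then have W: "W n \<in> \<B>" for n unfolding W_def by (rule from_nat_into)
  \<comment> \<open>Members of the base that miss 0 receive the zero seminorm.\<close>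
  have "\<exists>q. cont_seminorm s T q \<and> (0 \<in> W n \<longrightarrow> (\<forall>x\<in>topspace T. q x < 1 \<longrightarrow> x \<in> W n))" for n
    using open_contains_seminorm_ball[OF lc B(2)[OF W]] cont_seminorm_zero[OF lc] by blast
  then obtain q where q: "\<And>n. cont_seminorm s T (q n)"
    "\<And>n x. 0 \<in> W n \<Longrightarrow> x \<in> topspace T \<Longrightarrow> q n x < 1 \<Longrightarrow> x \<in> W n" by metis
  define p where "p k x = (\<Sum>n\<le>k. q n x)" for k x
  have p_mono: "p j x \<le> p k x" if "j \<le> k" "x \<in> topspace T" for j k x
    unfolding p_def by (rule sum_mono2) (use that cont_seminorm_ge0[OF lc q(1)] in auto)
  have "fundamental_seminorms T p"
    unfolding fundamental_seminorms_def
  proof (intro conjI allI impI)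
    show "cont_seminorm s T (p k)" for k
      unfolding p_def by (rule cont_seminorm_sum[OF lc q(1)])
    fix r assume r: "cont_seminorm s T r"
    obtain U where U: "U \<in> \<B>" "0 \<in> U" "U \<subseteq> {x \<in> topspace T. r (x - 0) < 1}"
      using B(3)[OF seminorm_ball_open[OF lc r zero_in_topspace[OF lc], of 1]]
        cont_seminorm_0[OF lc r] zero_in_topspace[OF lc] by auto
    obtain n where n: "U = W n" using from_nat_into_surj[OF B(1) U(1)] unfolding W_def by blast
    have "r x \<le> q n x" if x: "x \<in> topspace T" for x
    proof (rule seminorm_le_if_ball_subset[OF cont_seminorm_on[OF lc r] cont_seminorm_on[OF lc q(1)] V _ x])
      show "r y < 1" if "y \<in> topspace T" "q n y < 1" for y using q(2)[of n y] that U n by auto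
    qed
    moreover have "q n x \<le> p n x" if "x \<in> topspace T" for x
      unfolding p_def by (rule member_le_sum) (use that cont_seminorm_ge0[OF lc q(1)] in auto)
    ultimately show "\<exists>k. \<forall>x\<in>topspace T. r x \<le> p k x" by (meson order_trans)
  qed (rule p_mono)
  then show ?thesis by (rule that)
qed

lemma frechet_cauchy_converges:
  assumes fr: "frechet_space s T" and y: "\<And>n::nat. y n \<in> topspace T"
    and cauchy: "\<And>q e. cont_seminorm s T q \<Longrightarrow> e > 0 \<Longrightarrow> \<exists>N. \<forall>m\<ge>N. \<forall>n\<ge>N. q (y m - y n) < e"
  shows "\<exists>l\<in>topspace T. \<forall>q. cont_seminorm s T q \<longrightarrow> (\<lambda>n. q (y n - l)) \<longlonglongrightarrow> 0"
proof -
  have lc: "locally_convex s T" using fr by (simp add: frechet_space_def)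
  note V = tvs_facts(1)[OF lc]
  let ?F = "filtermap y sequentially"
  have "tvs_cauchy_filter T ?F"
    unfolding tvs_cauchy_filter_def
  proof (intro conjI allI impI)
    show "?F \<noteq> bot" by (simp add: filtermap_bot_iff)
    show "eventually (\<lambda>x. x \<in> topspace T) ?F" by (simp add: eventually_filtermap y)
    fix U assume U: "openin T U \<and> 0 \<in> U"
    then obtain q where q: "cont_seminorm s T q" "\<forall>x\<in>topspace T. q x < 1 \<longrightarrow> x \<in> U"
      using open_contains_seminorm_ball[OF lc] by blast
    obtain N where N: "\<forall>m\<ge>N. \<forall>n\<ge>N. q (y m - y n) < 1" using cauchy[OF q(1), of 1] by auto
    show "\<exists>A. eventually (\<lambda>x. x \<in> A) ?F \<and> (\<forall>a\<in>A. \<forall>b\<in>A. a - b \<in> U)"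
    proof (intro exI[of _ "y ` {N..}"] conjI ballI)
      show "eventually (\<lambda>x. x \<in> y ` {N..}) ?F"
        unfolding eventually_filtermap using eventually_ge_at_top[of N] by eventually_elim auto
      show "a - b \<in> U" if "a \<in> y ` {N..}" "b \<in> y ` {N..}" for a b
        using that N q(2) subspace_diff[OF V y y] by auto
    qed
  qed
  then obtain l where l: "limitin T (\<lambda>x. x) l ?F" using fr unfolding frechet_space_def tvs_complete_def by blast
  then have lT: "l \<in> topspace T" by (simp add: limitin_def)
  have "(\<lambda>n. q (y n - l)) \<longlonglongrightarrow> 0" if q: "cont_seminorm s T q" for q
  proof (rule tendstoI)
    fix e :: real assume e: "e > 0"
    have "l \<in> {x \<in> topspace T. q (x - l) < e}" using lT e cont_seminorm_0[OF lc q] by simp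
    then have "eventually (\<lambda>x. x \<in> {x \<in> topspace T. q (x - l) < e}) ?F"
      using l seminorm_ball_open[OF lc q lT, of e] unfolding limitin_def by blast
    then have "\<forall>\<^sub>F n in sequentially. q (y n - l) < e" by (simp add: eventually_filtermap y)
    then show "\<forall>\<^sub>F n in sequentially. dist (q (y n - l)) 0 < e"
      by eventually_elim (use cont_seminorm_ge0[OF lc q subspace_diff[OF V y lT]] in simp)
  qed
  then show ?thesis using lT by blast
qed

lemma frechet_series:
  assumes fr: "frechet_space s T" and a: "\<And>n::nat. a n \<in> topspace T"
    and sm: "\<And>q. cont_seminorm s T q \<Longrightarrow> summable (\<lambda>n. q (a n))"
  shows "\<exists>l\<in>topspace T. \<forall>q. cont_seminorm s T q \<longrightarrow> (\<lambda>n. q ((\<Sum>i<n. a i) - l)) \<longlonglongrightarrow> 0"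
proof (rule frechet_cauchy_converges[OF fr])
  have lc: "locally_convex s T" using fr by (simp add: frechet_space_def)
  note V = tvs_facts(1)[OF lc]
  show S: "(\<Sum>i<n. a i) \<in> topspace T" for n by (rule subspace_sum[OF V]) (rule a)
  fix q and e :: real assume q: "cont_seminorm s T q" and e: "e > 0"
  note sn = cont_seminorm_on[OF lc q]
  obtain N where N: "\<And>m n. m \<ge> N \<Longrightarrow> norm (\<Sum>i\<in>{m..<n}. q (a i)) < e"
    using sm[OF q] e unfolding summable_Cauchy by meson
  have le: "q ((\<Sum>i<n. a i) - (\<Sum>i<m. a i)) < e" if "N \<le> m" "m \<le> n" for m n
  proof -
    have "(\<Sum>i<n. a i) - (\<Sum>i<m. a i) = (\<Sum>i\<in>{m..<n}. a i)"
      using sum_diff_nat_ivl[of 0 m n a] that by (simp add: lessThan_atLeast0)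
    also have "q \<dots> \<le> (\<Sum>i\<in>{m..<n}. q (a i))" by (rule seminorm_sum[OF sn V]) (rule a)
    also have "\<dots> < e" using N[OF that(1), of n] by simp
    finally show ?thesis .
  qed
  have sym: "q (x - y) = q (y - x)" if "x \<in> topspace T" "y \<in> topspace T" for x y
    using seminorm_minus[OF sn subspace_diff[OF V that]] by simp
  show "\<exists>N. \<forall>m\<ge>N. \<forall>n\<ge>N. q ((\<Sum>i<m. a i) - (\<Sum>i<n. a i)) < e"
  proof (intro exI[of _ N] allI impI)
    fix m n assume "N \<le> m" "N \<le> n"
    then show "q ((\<Sum>i<m. a i) - (\<Sum>i<n. a i)) < e"
      using le[of m n] le[of n m] sym[OF S S, of m n] by (cases "m \<le> n") auto
  qed
qed

lemma seminorms_eq: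
  assumes lc: "locally_convex s T" and x: "x \<in> topspace T" "y \<in> topspace T"
    and q: "\<And>q. cont_seminorm s T q \<Longrightarrow> q (x - y) \<le> 0"
  shows "x = y"
  using seminorms_separate[OF lc, of "x - y"] subspace_diff[OF tvs_facts(1)[OF lc] x] q by force

text \<open>The operator \<open>x \<mapsto> \<Sum>i. f i x \<odot> u i\<close>.\<close>

lemma series_operator:
  assumes lc: "locally_convex s E" and fr: "frechet_space s T"
    and f: "\<And>i. linear_functional s (f i)" and u: "\<And>i::nat. u i \<in> topspace T"
    and dom: "\<And>q. cont_seminorm s T q \<Longrightarrow>
       \<exists>p. cont_seminorm s E p \<and> (\<forall>x\<in>topspace E. \<forall>n. (\<Sum>i<n. norm (f i x) * q (u i)) \<le> p x)"
  obtains A where "\<And>x. x \<in> topspace E \<Longrightarrow> A x \<in> topspace T"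
    "\<And>x y. x \<in> topspace E \<Longrightarrow> y \<in> topspace E \<Longrightarrow> A (x + y) = A x + A y"
    "\<And>c x. x \<in> topspace E \<Longrightarrow> A (c \<odot> x) = c \<odot> A x"
    "\<And>q. cont_seminorm s T q \<Longrightarrow> cont_seminorm s E (\<lambda>x. q (A x))"
    "\<And>x n. x \<in> topspace E \<Longrightarrow> (\<And>i. i \<ge> n \<Longrightarrow> f i x = 0) \<Longrightarrow> A x = (\<Sum>i<n. f i x \<odot> u i)"
proof -
  have lcT: "locally_convex s T" using fr by (simp add: frechet_space_def)
  note V = tvs_facts(1)[OF lcT] and VE = tvs_facts(1)[OF lc]
  define P where "P x n = (\<Sum>i<n. f i x \<odot> u i)" for x n
  have fu: "f i x \<odot> u i \<in> topspace T" for i x by (rule subspace_scale[OF V u])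
  have P_in: "P x n \<in> topspace T" for x n unfolding P_def by (rule subspace_sum[OF V fu])
  have "\<exists>l\<in>topspace T. \<forall>q. cont_seminorm s T q \<longrightarrow> (\<lambda>n. q (P x n - l)) \<longlonglongrightarrow> 0" if x: "x \<in> topspace E" for x
    unfolding P_def
  proof (rule frechet_series[OF fr fu])
    fix q assume q: "cont_seminorm s T q"
    obtain p where p: "\<forall>x\<in>topspace E. \<forall>n. (\<Sum>i<n. norm (f i x) * q (u i)) \<le> p x" using dom[OF q] by blast
    have "summable (\<lambda>i. norm (f i x) * q (u i))"
      by (rule summableI_nonneg_bounded[of _ "p x"]) (use p x cont_seminorm_ge0[OF lcT q u] in auto)
    then show "summable (\<lambda>i. q (f i x \<odot> u i))" using seminorm_scale[OF cont_seminorm_on[OF lcT q] u] by simp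
  qed
  then obtain A where A: "\<And>x. x \<in> topspace E \<Longrightarrow> A x \<in> topspace T"
    "\<And>x q. x \<in> topspace E \<Longrightarrow> cont_seminorm s T q \<Longrightarrow> (\<lambda>n. q (P x n - A x)) \<longlonglongrightarrow> 0" by metis
  \<comment> \<open>\<open>A\<close> arises from a choice of limits. Uniqueness of the limit makes
    it additive and homogeneous, and gives the finite formula when almost all terms vanish.\<close>
  have unique: "A x = l" if x: "x \<in> topspace E" and l: "l \<in> topspace T"
    and lim: "\<And>q. cont_seminorm s T q \<Longrightarrow> (\<lambda>n. q (P x n - l)) \<longlonglongrightarrow> 0" for x l
  proof (rule seminorms_eq[OF lcT A(1)[OF x] l])
    fix q assume q: "cont_seminorm s T q"
    note sn = cont_seminorm_on[OF lcT q]
    have "q ((P x n - l) - (P x n - A x)) \<le> q (P x n - l) + q (P x n - A x)" for n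
      by (rule seminorm_diff[OF sn V subspace_diff[OF V P_in l] subspace_diff[OF V P_in A(1)[OF x]]])
    then have "q (A x - l) \<le> q (P x n - l) + q (P x n - A x)" for n by simp
    moreover have "(\<lambda>n. q (P x n - l) + q (P x n - A x)) \<longlonglongrightarrow> 0 + 0"
      by (intro tendsto_add lim q A(2) x)
    ultimately show "q (A x - l) \<le> 0" by (intro LIMSEQ_le_const) auto
  qed
  have add: "A (x + y) = A x + A y" if x: "x \<in> topspace E" and y: "y \<in> topspace E" for x y
  proof (rule unique[OF subspace_add[OF VE x y] subspace_add[OF V A(1)[OF x] A(1)[OF y]]])
    fix q assume q: "cont_seminorm s T q"
    note sn = cont_seminorm_on[OF lcT q]
    have P: "P (x + y) n - (A x + A y) = (P x n - A x) + (P y n - A y)" for n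
      by (simp add: P_def linear_functionalD[OF f] scale_left_distrib sum.distrib)
    have "(\<lambda>n. q (P x n - A x) + q (P y n - A y)) \<longlonglongrightarrow> 0 + 0" by (intro tendsto_add q A(2) x y)
    then have lim: "(\<lambda>n. q (P x n - A x) + q (P y n - A y)) \<longlonglongrightarrow> 0" by simp
    have d: "P x n - A x \<in> topspace T" "P y n - A y \<in> topspace T" for n
      by (intro subspace_diff[OF V P_in A(1)] x y)+
    show "(\<lambda>n. q (P (x + y) n - (A x + A y))) \<longlonglongrightarrow> 0"
      unfolding P
      by (rule tendsto_sandwich[OF _ _ tendsto_const lim])
         (use seminorm_add[OF sn d] cont_seminorm_ge0[OF lcT q subspace_add[OF V d]] in auto)
  qed
  have scl: "A (c \<odot> x) = c \<odot> A x" if x: "x \<in> topspace E" for c x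
  proof (rule unique[OF subspace_scale[OF VE x] subspace_scale[OF V A(1)[OF x]]])
    fix q assume q: "cont_seminorm s T q"
    note sn = cont_seminorm_on[OF lcT q]
    have P: "P (c \<odot> x) n - c \<odot> A x = c \<odot> (P x n - A x)" for n
      by (simp add: P_def linear_functionalD[OF f] scale_right_diff_distrib scale_sum_right)
    have "(\<lambda>n. norm c * q (P x n - A x)) \<longlonglongrightarrow> norm c * 0" by (intro tendsto_mult_left q A(2) x)
    then show "(\<lambda>n. q (P (c \<odot> x) n - c \<odot> A x)) \<longlonglongrightarrow> 0"
      by (simp add: P seminorm_scale[OF sn subspace_diff[OF V P_in A(1)[OF x]]])
  qed
  have bound: "q (A x) \<le> p x" if x: "x \<in> topspace E" and q: "cont_seminorm s T q"
    and p: "\<forall>n. (\<Sum>i<n. norm (f i x) * q (u i)) \<le> p x" for x q p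
  proof -
    note sn = cont_seminorm_on[OF lcT q]
    have "q (A x) \<le> p x + q (P x n - A x)" for n
    proof -
      have "q (P x n - (P x n - A x)) \<le> q (P x n) + q (P x n - A x)"
        by (rule seminorm_diff[OF sn V P_in subspace_diff[OF V P_in A(1)[OF x]]])
      moreover have "q (P x n) \<le> (\<Sum>i<n. norm (f i x) * q (u i))"
        unfolding P_def using seminorm_sum[OF sn V fu] seminorm_scale[OF sn u] by simp
      ultimately show ?thesis using p[rule_format, of n] by simp
    qed
    moreover have "(\<lambda>n. p x + q (P x n - A x)) \<longlonglongrightarrow> p x + 0" by (intro tendsto_add tendsto_const A(2) q x)
    ultimately show ?thesis by (intro LIMSEQ_le_const) auto
  qed
  have cont: "cont_seminorm s E (\<lambda>x. q (A x))" if q: "cont_seminorm s T q" for q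
  proof -
    obtain p where p: "cont_seminorm s E p" "\<forall>x\<in>topspace E. \<forall>n. (\<Sum>i<n. norm (f i x) * q (u i)) \<le> p x"
      using dom[OF q] by blast
    have "seminorm_on s (topspace E) (\<lambda>x. q (A x))"
      unfolding seminorm_on_def using add scl seminorm_add[OF cont_seminorm_on[OF lcT q]]
        seminorm_scale[OF cont_seminorm_on[OF lcT q]] A(1) by simp
    then show ?thesis by (rule cont_seminorm_dominated[OF lc _ p(1), of _ 1]) (use bound[OF _ q] p(2) in auto)
  qed
  have fin: "A x = (\<Sum>i<n. f i x \<odot> u i)" if x: "x \<in> topspace E" and 0: "\<And>i. i \<ge> n \<Longrightarrow> f i x = 0" for x n
  proof (rule unique[OF x])
    show "(\<Sum>i<n. f i x \<odot> u i) \<in> topspace T" by (rule subspace_sum[OF V fu])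
    fix q assume q: "cont_seminorm s T q"
    have "P x m = (\<Sum>i<n. f i x \<odot> u i)" if "m \<ge> n" for m
      unfolding P_def by (rule sum.mono_neutral_right) (use that 0 in auto)
    then have "\<forall>\<^sub>F m in sequentially. q (P x m - (\<Sum>i<n. f i x \<odot> u i)) = 0"
      using cont_seminorm_0[OF lcT q] by (intro eventually_sequentiallyI[of n]) simp
    then show "(\<lambda>m. q (P x m - (\<Sum>i<n. f i x \<odot> u i))) \<longlonglongrightarrow> 0" by (rule tendsto_eventually)
  qed
  show ?thesis by (rule that[of A]) (fact A(1) add scl cont fin)+
qed

text \<open>Two situations in which weights make \<open>series_operator\<close> applicable: either the functionals
  are dominated by a single continuous seminorm, or the \<open>u i\<close> vanish eventually under each seminorm.\<close>

lemma dominated_weights: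
  assumes lc: "locally_convex s E" and fr: "frechet_space s T"
    and p: "cont_seminorm s E p" and dom: "\<And>i x. x \<in> topspace E \<Longrightarrow> norm (f i x :: 'k) \<le> C i * p x"
    and u: "\<And>i::nat. u i \<in> topspace T"
  obtains c :: "nat \<Rightarrow> real" where "\<And>i. c i > 0"
    "\<And>q. cont_seminorm s T q \<Longrightarrow> \<exists>r. cont_seminorm s E r \<and>
       (\<forall>x\<in>topspace E. \<forall>n. (\<Sum>i<n. norm (f i x) * q (of_real (c i) \<odot> u i)) \<le> r x)"
proof -
  have lcT: "locally_convex s T" and "metrizable_space T" using fr by (simp_all add: frechet_space_def)
  then obtain P where P: "fundamental_seminorms T P" using metrizable_fundamental_seminorms by blast
  have Pc: "cont_seminorm s T (P k)" for k using P by (simp add: fundamental_seminorms_def)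
  have P0: "P k (u i) \<ge> 0" for k i by (rule cont_seminorm_ge0[OF lcT Pc u])
  \<comment> \<open>Chosen such that
    \<open>\<bar>C i\<bar> * c i * P i (u i) \<le> (1/2) ^ i\<close>. A seminorm \<open>q\<close>
    below \<open>P k\<close> lies below \<open>P i\<close> for all \<open>i \<ge> k\<close>, so a
    tail of its series is dominated by a geometric one.\<close>
  define c where "c i = (1/2) ^ i / ((1 + \<bar>C i\<bar>) * (1 + P i (u i)))" for i
  have c0: "c i > 0" for i unfolding c_def using P0 by (intro divide_pos_pos mult_pos_pos add_pos_nonneg) auto
  have cb: "\<bar>C i\<bar> * c i * P i (u i) \<le> (1/2) ^ i" for i
  proof -
    have "\<bar>C i\<bar> * P i (u i) \<le> (1 + \<bar>C i\<bar>) * (1 + P i (u i))" using P0 by (intro mult_mono) auto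
    moreover have "(1 + \<bar>C i\<bar>) * (1 + P i (u i)) > 0" using P0 by (intro mult_pos_pos add_pos_nonneg) auto
    ultimately have "(\<bar>C i\<bar> * P i (u i)) / ((1 + \<bar>C i\<bar>) * (1 + P i (u i))) \<le> 1" by simp
    then have "(1/2) ^ i * ((\<bar>C i\<bar> * P i (u i)) / ((1 + \<bar>C i\<bar>) * (1 + P i (u i)))) \<le> (1/2) ^ i * 1"
      by (intro mult_left_mono) auto
    then show ?thesis by (simp add: c_def mult_ac)
  qed
  show ?thesis
  proof (rule that[OF c0])
    fix q assume q: "cont_seminorm s T q"
    then obtain k where k: "\<forall>x\<in>topspace T. q x \<le> P k x" using P by (auto simp: fundamental_seminorms_def)
    have q0: "q (u i) \<ge> 0" for i by (rule cont_seminorm_ge0[OF lcT q u])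
    define b where "b i = \<bar>C i\<bar> * c i * q (u i)" for i
    have b0: "b i \<ge> 0" for i unfolding b_def using c0[of i] q0[of i] by (intro mult_nonneg_nonneg) auto
    have "b i \<le> (1/2) ^ i" if "i \<ge> k" for i
    proof -
      have "q (u i) \<le> P i (u i)" using k u[of i] P that unfolding fundamental_seminorms_def by (meson order_trans)
      then have "b i \<le> \<bar>C i\<bar> * c i * P i (u i)" unfolding b_def using c0[of i] by (intro mult_left_mono) auto
      then show ?thesis using cb order_trans by blast
    qed
    then have "summable b"
      by (intro summable_comparison_test[OF _ summable_geometric[of "1/2 :: real"]] exI[of _ k]) (use b0 in auto)
    then have sb: "(\<Sum>i<n. b i) \<le> suminf b" for n by (rule sum_le_suminf) (use b0 in auto)
    have "(\<Sum>i<n. norm (f i x) * q (of_real (c i) \<odot> u i)) \<le> suminf b * p x" if x: "x \<in> topspace E" for x n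
    proof -
      have p0: "p x \<ge> 0" by (rule cont_seminorm_ge0[OF lc p x])
      have "norm (f i x) * q (of_real (c i) \<odot> u i) \<le> b i * p x" for i
      proof -
        have "norm (f i x) \<le> \<bar>C i\<bar> * p x" 
          using dom[OF x, of i] mult_right_mono[OF abs_ge_self[of "C i"] p0] by linarith
        then have "norm (f i x) * (c i * q (u i)) \<le> (\<bar>C i\<bar> * p x) * (c i * q (u i))"
          using c0[of i] q0[of i] by (intro mult_right_mono) auto
        then show ?thesis using seminorm_scale[OF cont_seminorm_on[OF lcT q] u] c0[of i] by (simp add: b_def mult_ac)
      qed
      then have "(\<Sum>i<n. norm (f i x) * q (of_real (c i) \<odot> u i)) \<le> (\<Sum>i<n. b i * p x)" by (intro sum_mono)
      also have "\<dots> = (\<Sum>i<n. b i) * p x" by (simp add: sum_distrib_right)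
      also have "\<dots> \<le> suminf b * p x" using sb p0 by (intro mult_right_mono)
      finally show ?thesis .
    qed
    moreover have "cont_seminorm s E (\<lambda>x. suminf b * p x)"
      by (rule cont_seminorm_mult[OF lc p]) (use sb[of 0] in simp)
    ultimately show "\<exists>r. cont_seminorm s E r \<and>
       (\<forall>x\<in>topspace E. \<forall>n. (\<Sum>i<n. norm (f i x) * q (of_real (c i) \<odot> u i)) \<le> r x)" by blast
  qed
qed

definition eventually_null :: "'v topology \<Rightarrow> (nat \<Rightarrow> 'v) \<Rightarrow> bool" where
  "eventually_null T u \<longleftrightarrow> (\<forall>q. cont_seminorm s T q \<longrightarrow> (\<exists>N. \<forall>i\<ge>N. q (u i) = 0))"

lemma eventually_null_bound:
  assumes lc: "locally_convex s E" and lcT: "locally_convex s T"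
    and f: "\<And>i. cont_seminorm s E (\<lambda>x. norm (f i x :: 'k))"
    and u: "\<And>i::nat. u i \<in> topspace T" "eventually_null T u" and q: "cont_seminorm s T q"
  shows "\<exists>r. cont_seminorm s E r \<and> (\<forall>x\<in>topspace E. \<forall>n. (\<Sum>i<n. norm (f i x) * q (u i)) \<le> r x)"
proof -
  obtain N where N: "\<forall>i\<ge>N. q (u i) = 0" using u(2) q by (auto simp: eventually_null_def)
  have q0: "q (u i) \<ge> 0" for i by (rule cont_seminorm_ge0[OF lcT q u(1)])
  show ?thesis
  proof (intro exI conjI ballI allI)
    have "cont_seminorm s E (\<lambda>x. q (u i) * norm (f i x))" for i by (rule cont_seminorm_mult[OF lc f q0])
    then show "cont_seminorm s E (\<lambda>x. \<Sum>i<N. q (u i) * norm (f i x))" by (rule cont_seminorm_sum[OF lc])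
    fix x n
    have "(\<Sum>i<n. norm (f i x) * q (u i)) \<le> (\<Sum>i<max n N. norm (f i x) * q (u i))"
      by (rule sum_mono2) (use q0 in auto)
    also have "\<dots> = (\<Sum>i<N. norm (f i x) * q (u i))"
      by (rule sum.mono_neutral_right) (use N in auto)
    finally show "(\<Sum>i<n. norm (f i x) * q (u i)) \<le> (\<Sum>i<N. q (u i) * norm (f i x))" by (simp add: mult.commute)
  qed
qed

section \<open>Biorthogonal systems and their extension by Hahn--Banach\<close>

definition biorthogonal :: "'i set \<Rightarrow> ('i \<Rightarrow> 'v) \<Rightarrow> ('i \<Rightarrow> 'v \<Rightarrow> 'k) \<Rightarrow> bool" where
  "biorthogonal I e f \<longleftrightarrow> (\<forall>i\<in>I. linear_functional s (f i)) \<and> (\<forall>i\<in>I. \<forall>j\<in>I. f i (e j) = (if i = j then 1 else 0))"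

lemma biorthogonal_coord_sum:
  assumes "biorthogonal I e f" "finite I" "i \<in> I"
  shows "f i (\<Sum>j\<in>I. c j \<odot> e j) = c i"
proof -
  have lf: "linear_functional s (f i)" using assms by (simp add: biorthogonal_def)
  have "f i (\<Sum>j\<in>I. c j \<odot> e j) = (\<Sum>j\<in>I. if i = j then c j else 0)"
    unfolding linear_functional_sum[OF lf] linear_functionalD(2)[OF lf]
    using assms by (intro sum.cong) (auto simp: biorthogonal_def)
  then show ?thesis using assms(2,3) by simp
qed

lemma biorthogonal_independent:
  assumes "biorthogonal I e f" "finite I"
  shows "independent (e ` I)" "inj_on e I"
proof -
  show inj: "inj_on e I"
    using assms(1) unfolding biorthogonal_def inj_on_def by (metis zero_neq_one)
  show "independent (e ` I)"
    unfolding independent_explicit_module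
  proof (intro allI impI)
    fix t u v assume t: "finite t" "t \<subseteq> e ` I" "(\<Sum>v\<in>t. u v \<odot> v) = 0" "v \<in> t"
    define c where "c i = (if e i \<in> t then u (e i) else 0)" for i
    obtain i where i: "i \<in> I" "v = e i" using t by blast
    have "(\<Sum>j\<in>I. c j \<odot> e j) = (\<Sum>w\<in>e ` I. (if w \<in> t then u w else 0) \<odot> w)"
      unfolding c_def by (subst sum.reindex[OF inj]) simp
    also have "\<dots> = (\<Sum>w\<in>t. u w \<odot> w)"
      by (rule sum.mono_neutral_cong_right) (use t assms(2) in auto)
    finally have "(\<Sum>j\<in>I. c j \<odot> e j) = 0" using t by simp
    then have "c i = f i 0" using biorthogonal_coord_sum[OF assms i(1), of c] by simp
    then show "u v = 0" using i t(4) linear_functionalD(3)[of s "f i"] assms(1) unfolding c_def biorthogonal_def by auto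
  qed
qed

lemma biorthogonal_card_le:
  assumes "biorthogonal {..<n::nat} e f" "finite B" "\<And>i. i < n \<Longrightarrow> e i \<in> span B"
  shows "n \<le> card B"
proof -
  have "card (e ` {..<n}) \<le> card B"
    using independent_span_bound[OF assms(2) biorthogonal_independent(1)[OF assms(1)]] assms(3) by auto
  then show ?thesis using card_image[OF biorthogonal_independent(2)[OF assms(1)]] by simp
qed

lemma biorthogonal_span:
  assumes b: "biorthogonal I e f" "finite I" and y: "y \<in> span (e ` I)"
  shows "y = (\<Sum>i\<in>I. f i y \<odot> e i)"
  using y
proof (induction rule: span_induct_alt)
  case base
  show ?case using b by (auto simp: biorthogonal_def linear_functionalD(3)[of s] intro!: sum.neutral[symmetric])
next
  case (step c x y)
  then obtain j where j: "j \<in> I" "x = e j" by blast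
  have "(\<Sum>i\<in>I. f i x \<odot> e i) = (\<Sum>i\<in>I. if i = j then e i else 0)"
    using b j by (intro sum.cong) (auto simp: biorthogonal_def)
  also have "\<dots> = x" using b j by simp
  finally have x: "(\<Sum>i\<in>I. f i x \<odot> e i) = x" .
  have "(\<Sum>i\<in>I. f i (c \<odot> x + y) \<odot> e i) = (\<Sum>i\<in>I. c \<odot> (f i x \<odot> e i) + f i y \<odot> e i)"
    using b by (intro sum.cong) (simp_all add: biorthogonal_def linear_functionalD(1,2)[of s] scale_left_distrib)
  also have "\<dots> = c \<odot> (\<Sum>i\<in>I. f i x \<odot> e i) + (\<Sum>i\<in>I. f i y \<odot> e i)"
    by (simp only: sum.distrib scale_sum_right)
  also have "\<dots> = c \<odot> x + y" unfolding x step.IH[symmetric] ..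
  finally show ?case by simp
qed

text \<open>A merely algebraic projection. Composition with it extends a seminorm from
  \<open>V\<close> to the whole ambient group, where \<open>hahn_banach\<close> is
  formulated.\<close>

lemma exists_projection:
  assumes "subspace V"
  shows "\<exists>P. (\<forall>x. P x \<in> V) \<and> (\<forall>x y. P (x + y) = P x + P y) \<and> (\<forall>c x. P (c \<odot> x) = c \<odot> P x) \<and> (\<forall>x\<in>V. P x = x)"
proof -
  interpret vp: vector_space_pair s s by unfold_locales
  obtain g where "g ` UNIV \<subseteq> V" "Vector_Spaces.linear s s g" "\<forall>v\<in>V. g (id v) = v"
    using vp.linear_exists_left_inverse_on[of id V] assms linear_id by (auto simp: id_def)
  then show ?thesis
    by (intro exI[of _ g]) (auto simp: Vector_Spaces.linear_iff)
qed

text \<open>The coordinate functionals themselves bound the distance of \<open>b\<close> from the span of the \<open>e i\<close> from below.\<close>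

lemma biorthogonal_extend:
  assumes hb: "hahn_banach s" and V: "subspace V" and p: "seminorm_on s V p"
    and e: "biorthogonal I e f" "finite I" "\<And>i. i \<in> I \<Longrightarrow> e i \<in> V"
    and fb: "\<And>i x. i \<in> I \<Longrightarrow> x \<in> V \<Longrightarrow> norm (f i x) \<le> C i * p x"
    and b: "b \<in> V" "p b > 0" "\<And>i. i \<in> I \<Longrightarrow> f i b = 0"
  obtains g K where "linear_functional s g" "g b = 1" "\<And>i. i \<in> I \<Longrightarrow> g (e i) = 0"
    "K \<ge> 0" "\<And>x. x \<in> V \<Longrightarrow> norm (g x) \<le> K * p x"
proof -
  obtain P where P: "\<And>x. P x \<in> V" "\<And>x y. P (x + y) = P x + P y" "\<And>c x. P (c \<odot> x) = c \<odot> P x" "\<And>x. x \<in> V \<Longrightarrow> P x = x"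
    using exists_projection[OF V] by blast
  have sp: "seminorm_on s UNIV (\<lambda>x. p (P x))"
    using p P(1) unfolding seminorm_on_def by (simp add: P(2,3))
  have pe: "p (e i) \<ge> 0" if "i \<in> I" for i by (rule seminorm_ge0[OF p V e(3)[OF that]])
  \<comment> \<open>For \<open>y\<close> in the span,
    \<open>norm (f i y) = norm (f i (b - y))\<close> is at most
    \<open>\<bar>C i\<bar> * p (b - y)\<close>. Expanding \<open>y\<close> gives
    \<open>p y \<le> (M - 1) * p (b - y)\<close>, hence
    \<open>p b \<le> M * p (b - y)\<close>.\<close>
  define M where "M = 1 + (\<Sum>i\<in>I. \<bar>C i\<bar> * p (e i))"
  have M: "M \<ge> 1" unfolding M_def using pe by (simp add: sum_nonneg)
  have sub: "span (e ` I) \<subseteq> V" using e(3) V by (intro span_minimal) auto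
  have dist: "p b / M \<le> p (P (b - y))" if y: "y \<in> span (e ` I)" for y
  proof -
    have z: "b - y \<in> V" using subspace_diff[OF V b(1)] sub y by blast
    have pz: "p (b - y) \<ge> 0" by (rule seminorm_ge0[OF p V z])
    have fy: "norm (f i y) \<le> \<bar>C i\<bar> * p (b - y)" if i: "i \<in> I" for i
    proof -
      have "f i y = - f i (b - y)" 
        using e(1) i b(3)[OF i] linear_functionalD(5)[of s "f i"] by (simp add: biorthogonal_def)
      then have "norm (f i y) \<le> C i * p (b - y)" using fb[OF i z] by simp
      then show ?thesis using mult_right_mono[OF abs_ge_self pz, of "C i"] by linarith
    qed
    have "p y = p (\<Sum>i\<in>I. f i y \<odot> e i)" using biorthogonal_span[OF e(1,2) y] by simp
    also have "\<dots> \<le> (\<Sum>i\<in>I. p (f i y \<odot> e i))"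
      by (rule seminorm_sum[OF p V]) (use e(3) subspace_scale[OF V] in blast)
    also have "\<dots> \<le> (\<Sum>i\<in>I. (\<bar>C i\<bar> * p (e i)) * p (b - y))"
    proof (rule sum_mono)
      fix i assume i: "i \<in> I"
      have "p (f i y \<odot> e i) = norm (f i y) * p (e i)" by (rule seminorm_scale[OF p e(3)[OF i]])
      also have "\<dots> \<le> (\<bar>C i\<bar> * p (b - y)) * p (e i)" using fy[OF i] pe[OF i] by (rule mult_right_mono)
      finally show "p (f i y \<odot> e i) \<le> (\<bar>C i\<bar> * p (e i)) * p (b - y)" by (simp add: mult_ac)
    qed
    finally have "p y \<le> (M - 1) * p (b - y)" by (simp add: M_def sum_distrib_right)
    moreover have "p b \<le> p (b - y) + p y" 
      using seminorm_add[OF p z, of y] sub y by auto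
    ultimately have "p b \<le> M * p (b - y)" by (simp add: algebra_simps)
    then show ?thesis unfolding P(4)[OF z] using M by (simp add: field_simps)
  qed
  obtain g where g: "linear_functional s g" "g b = 1" "\<forall>y\<in>span (e ` I). g y = 0"
    "\<forall>x. norm (g x) \<le> p (P x) / (p b / M)"
    using hb[unfolded hahn_banach_def, rule_format, of "\<lambda>x. p (P x)" "span (e ` I)" "p b / M" b]
      sp subspace_span dist b(2) M by auto
  show ?thesis
  proof (rule that[OF g(1,2)])
    show "g (e i) = 0" if "i \<in> I" for i using g(3) span_base that by blast
    show "1 / (p b / M) \<ge> 0" using b(2) M by simp
    show "norm (g x) \<le> 1 / (p b / M) * p x" if "x \<in> V" for x using g(4)[rule_format, of x] P(4)[OF that] by (simp add: mult.commute)
  qed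
qed

text \<open>A biorthogonal system with continuous functionals has at most \<open>card B\<close>
  members, so there is a longest one. Its functionals have no common zero except 0, since such a
  vector would extend the system. Every vector is then the sum of its coordinates, which bounds
  \<open>q\<close> by continuous seminorms.\<close>

lemma finite_dimensional_cont_seminorm:
  assumes hb: "hahn_banach s" and lc: "locally_convex s T" and fd: "finite_dimensional s (topspace T)"
    and q: "seminorm_on s (topspace T) q"
  shows "cont_seminorm s T q"
proof -
  note V = tvs_facts(1)[OF lc]
  obtain B where B: "finite B" "span B = topspace T" using fd by (auto simp: finite_dimensional_def)
  define S where "S n \<longleftrightarrow> (\<exists>e f. biorthogonal {..<n::nat} e f \<and> (\<forall>i<n. e i \<in> topspace T \<and> cont_seminorm s T (\<lambda>x. norm (f i x))))" for n
  have "n \<le> card B" if "S n" for n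
    using that biorthogonal_card_le[of n _ _ B] B unfolding S_def by blast
  moreover have "S 0" by (simp add: S_def biorthogonal_def)
  ultimately obtain n where n: "S n" "\<And>m. S m \<Longrightarrow> m \<le> n" 
    using Greatest_le_nat[of S _ "card B"] GreatestI_nat[of S 0 "card B"] by metis
  obtain e f where ef: "biorthogonal {..<n} e f" "\<And>i. i < n \<Longrightarrow> e i \<in> topspace T"
    "\<And>i. i < n \<Longrightarrow> cont_seminorm s T (\<lambda>x. norm (f i x))" using n(1) unfolding S_def by blast
  have lf: "linear_functional s (f i)" if "i < n" for i using ef(1) that by (simp add: biorthogonal_def)
  have zero: "b = 0" if b: "b \<in> topspace T" "\<And>i. i < n \<Longrightarrow> f i b = 0" for b
  proof (rule ccontr)
    assume "b \<noteq> 0"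
    then obtain p0 where p0: "cont_seminorm s T p0" "p0 b > 0" using seminorms_separate[OF lc b(1)] by blast
    \<comment> \<open>Adding the functionals makes \<open>p\<close> dominate each of them without
      changing its value at \<open>b\<close>.\<close>
    define p where "p x = p0 x + (\<Sum>i<n. norm (f i x))" for x
    have p: "cont_seminorm s T p" unfolding p_def
      by (intro cont_seminorm_add[OF lc] p0(1) cont_seminorm_sum[OF lc]) (use ef in auto)
    have le: "norm (f i x) \<le> 1 * p x" if "i < n" "x \<in> topspace T" for i x
    proof -
      have "norm (f i x) \<le> (\<Sum>i<n. norm (f i x))" by (rule member_le_sum) (use that in auto)
      then show ?thesis using cont_seminorm_ge0[OF lc p0(1) that(2)] by (simp add: p_def)
    qed
    have pb: "p b > 0" using p0(2) b(2) by (simp add: p_def)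
    obtain g K where g: "linear_functional s g" "g b = 1" "\<And>i. i < n \<Longrightarrow> g (e i) = 0"
      "\<And>x. x \<in> topspace T \<Longrightarrow> norm (g x) \<le> K * p x"
      by (rule biorthogonal_extend[OF hb V cont_seminorm_on[OF lc p] ef(1), of "\<lambda>_. 1" b])
         (use ef le pb b in auto)
    have "seminorm_on s (topspace T) (\<lambda>x. norm (g x))"
      unfolding seminorm_on_def by (simp add: linear_functionalD[OF g(1)] norm_mult norm_triangle_ineq)
    then have "cont_seminorm s T (\<lambda>x. norm (g x))" by (rule cont_seminorm_dominated[OF lc _ p g(4)])
    then have "S (Suc n)" unfolding S_def
      using ef g b by (intro exI[of _ "e(n := b)"] exI[of _ "f(n := g)"]) (auto simp: biorthogonal_def less_Suc_eq)
    then show False using n(2) by fastforce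
  qed
  have rep: "x = (\<Sum>i<n. f i x \<odot> e i)" if x: "x \<in> topspace T" for x
  proof -
    have s: "(\<Sum>i<n. f i x \<odot> e i) \<in> topspace T"
      by (rule subspace_sum[OF V]) (use ef(2) subspace_scale[OF V] in blast)
    have "x - (\<Sum>i<n. f i x \<odot> e i) = 0"
      using zero[OF subspace_diff[OF V x s]] biorthogonal_coord_sum[OF ef(1)] linear_functionalD(5)[OF lf] by simp
    then show ?thesis by simp
  qed
  have qe: "q (e i) \<ge> 0" if "i < n" for i by (rule seminorm_ge0[OF q V ef(2)[OF that]])
  show ?thesis
  proof (rule cont_seminorm_dominated[OF lc q, of "\<lambda>x. \<Sum>i<n. q (e i) * norm (f i x)" 1])
    show "cont_seminorm s T (\<lambda>x. \<Sum>i<n. q (e i) * norm (f i x))"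
      by (intro cont_seminorm_sum[OF lc] cont_seminorm_mult[OF lc]) (use ef qe in auto)
    fix x assume x: "x \<in> topspace T"
    have "q x = q (\<Sum>i<n. f i x \<odot> e i)" using rep[OF x] by simp
    also have "\<dots> \<le> (\<Sum>i<n. q (f i x \<odot> e i))"
      by (rule seminorm_sum[OF q V]) (use ef(2) subspace_scale[OF V] in blast)
    also have "\<dots> = (\<Sum>i<n. q (e i) * norm (f i x))"
      by (rule sum.cong) (use seminorm_scale[OF q ef(2)] in \<open>auto simp: mult.commute\<close>)
    finally show "q x \<le> 1 * (\<Sum>i<n. q (e i) * norm (f i x))" by simp
  qed
qed

end

section \<open>Biorthogonal systems whose span is dense\<close>

context normed_scalars
begin

text \<open>The kernel of \<open>p\<close> has infinite codimension in the carrier.\<close>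

definition infinite_seminorm :: "'v topology \<Rightarrow> ('v \<Rightarrow> real) \<Rightarrow> bool" where
  "infinite_seminorm T p \<longleftrightarrow> cont_seminorm s T p \<and>
     (\<forall>B. finite B \<longrightarrow> B \<subseteq> topspace T \<longrightarrow> (\<exists>x\<in>topspace T. \<forall>y\<in>span B. p (x - y) \<noteq> 0))"

lemma separable_dense_sequence:
  assumes lc: "locally_convex s T" and sep: "separable_space T"
  shows "\<exists>Y :: nat \<Rightarrow> 'v. (\<forall>n. Y n \<in> topspace T) \<and>
    (\<forall>y q. y \<in> topspace T \<longrightarrow> cont_seminorm s T q \<longrightarrow> (\<exists>n. q (Y n - y) < 1))"
proof -
  obtain C where C: "countable C" "C \<subseteq> topspace T" "T closure_of C = topspace T"
    using sep by (auto simp: separable_space_def)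
  then have dense: "\<exists>x\<in>C. q (x - y) < 1" if "y \<in> topspace T" "cont_seminorm s T q" for y q
    using dense_iff_seminorms[OF lc C(2)] that by blast
  then have "C \<noteq> {}" using zero_in_topspace[OF lc] cont_seminorm_zero[OF lc] by blast
  show ?thesis
  proof (intro exI[of _ "from_nat_into C"] conjI allI impI)
    show "from_nat_into C n \<in> topspace T" for n using from_nat_into[OF \<open>C \<noteq> {}\<close>] C(2) by blast
    show "\<exists>n. q (from_nat_into C n - y) < 1" if "y \<in> topspace T" "cont_seminorm s T q" for y q
      using dense[OF that] from_nat_into_surj[OF C(1)] by metis
  qed
qed

lemma biorthogonal_residual:
  assumes "biorthogonal {..<n::nat} e f" "i < n"
  shows "f i (x - (\<Sum>j<n. f j x \<odot> e j)) = 0"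
proof -
  have "linear_functional s (f i)" using assms by (simp add: biorthogonal_def)
  then show ?thesis
    using biorthogonal_coord_sum[OF assms(1), of i "\<lambda>j. f j x"] assms(2) by (simp add: linear_functionalD)
qed

text \<open>Each member of a dense sequence is moved slightly off \<open>span (e ` {..<n}) + ker p\<close> before it is
  orthogonalised.\<close>

lemma dominated_biorthogonal_system:
  assumes hb: "hahn_banach s" and lc: "locally_convex s T" and met: "metrizable_space T"
    and sep: "separable_space T" and p: "infinite_seminorm T p"
  obtains e f C D where "\<And>i::nat. e i \<in> topspace T" "biorthogonal UNIV e f"
    "\<And>i x. x \<in> topspace T \<Longrightarrow> norm (f i x) \<le> C i * p x"
    "\<And>k::nat. D k \<in> topspace T" "\<And>k. D k \<in> span (range e)"
    "\<And>y q. y \<in> topspace T \<Longrightarrow> cont_seminorm s T q \<Longrightarrow> \<exists>n. q (D n - y) < 1"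
proof -
  note V = tvs_facts(1)[OF lc]
  have pc: "cont_seminorm s T p" using p by (simp add: infinite_seminorm_def)
  note ps = cont_seminorm_on[OF lc pc]
  obtain P where P: "fundamental_seminorms T P" using metrizable_fundamental_seminorms[OF lc met] by blast
  then have Pc: "cont_seminorm s T (P k)" for k by (simp add: fundamental_seminorms_def)
  obtain Y :: "nat \<Rightarrow> 'v" where Y0: "\<forall>n. Y n \<in> topspace T"
    "\<forall>y q. y \<in> topspace T \<longrightarrow> cont_seminorm s T q \<longrightarrow> (\<exists>n. q (Y n - y) < 1)"
    using separable_dense_sequence[OF lc sep] by blast
  then have Y: "Y n \<in> topspace T" 
    "\<And>y q. y \<in> topspace T \<Longrightarrow> cont_seminorm s T q \<Longrightarrow> \<exists>n. q (Y n - y) < 1" for n by simp_all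
  define y where "y n = Y (fst (prod_decode n))" for n
  have yV: "y n \<in> topspace T" for n by (simp add: y_def Y)
  define Q :: "(nat \<Rightarrow> 'v \<times> ('v \<Rightarrow> 'k) \<times> real \<times> 'v) \<Rightarrow> nat \<Rightarrow> 'v \<times> ('v \<Rightarrow> 'k) \<times> real \<times> 'v \<Rightarrow> bool"
    where "Q h n r \<longleftrightarrow> (case r of (e, f, C, d) \<Rightarrow>
      e \<in> topspace T \<and> linear_functional s f \<and> f e = 1 \<and>
      (\<forall>i<n. fst (snd (h i)) e = 0 \<and> f (fst (h i)) = 0) \<and>
      (\<forall>x\<in>topspace T. norm (f x) \<le> C * p x) \<and>
      d \<in> topspace T \<and> d - e \<in> span ((\<lambda>i. fst (h i)) ` {..<n}) \<and> P n (d - y n) \<le> (1/2) ^ n)" for h n r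
  have "\<exists>h. \<forall>n. Q h n (h n)"
  proof (rule dependent_wellorder_choice)
    fix r n and h h' :: "nat \<Rightarrow> 'v \<times> ('v \<Rightarrow> 'k) \<times> real \<times> 'v"
    assume eq: "\<And>i. i < n \<Longrightarrow> h i = h' i"
    then have "(\<lambda>i. fst (h i)) ` {..<n} = (\<lambda>i. fst (h' i)) ` {..<n}" by (intro image_cong) auto
    then show "Q h n r = Q h' n r" using eq by (auto simp: Q_def)
  next
    fix n and h :: "nat \<Rightarrow> 'v \<times> ('v \<Rightarrow> 'k) \<times> real \<times> 'v"
    assume "\<And>i. i < n \<Longrightarrow> Q h i (h i)"
    then have h: "i < n \<Longrightarrow> Q h i (fst (h i), fst (snd (h i)), fst (snd (snd (h i))), snd (snd (snd (h i))))" for i by simp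
    define e where "e i = fst (h i)" for i
    define f where "f i = fst (snd (h i))" for i
    define C where "C i = fst (snd (snd (h i)))" for i
    have e: "e i \<in> topspace T" and f: "linear_functional s (f i)" and fe: "f i (e i) = 1"
      and C: "\<And>x. x \<in> topspace T \<Longrightarrow> norm (f i x) \<le> C i * p x" 
      and ef: "\<And>j. j < i \<Longrightarrow> f j (e i) = 0 \<and> f i (e j) = 0" if "i < n" for i
      using h[OF that] by (auto simp: Q_def e_def f_def C_def)
    have bi: "biorthogonal {..<n} e f"
      unfolding biorthogonal_def
    proof (intro conjI ballI)
      fix i j assume "i \<in> {..<n}" "j \<in> {..<n}"
      then show "f i (e j) = (if i = j then 1 else 0)"
        using fe ef[of i j] ef[of j i] by (cases i j rule: linorder_cases) auto
    qed (use f in auto)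
    define F where "F = span (e ` {..<n})"
    have FV: "F \<subseteq> topspace T" unfolding F_def using e V by (intro span_minimal) auto
    have "\<exists>d\<in>topspace T. P n (d - y n) \<le> (1/2) ^ n \<and> (\<forall>w\<in>F. p (d - w) \<noteq> 0)"
    proof (cases "\<forall>w\<in>F. p (y n - w) \<noteq> 0")
      case True
      then show ?thesis using yV cont_seminorm_0[OF lc Pc] by (intro bexI[of _ "y n"]) auto
    next
      case False
      then obtain w0 where w0: "w0 \<in> F" "p (y n - w0) = 0" by blast
      obtain z where z: "z \<in> topspace T" "\<forall>w\<in>F. p (z - w) \<noteq> 0"
        using p e unfolding infinite_seminorm_def F_def by (metis finite_imageI finite_lessThan image_subsetI lessThan_iff)
      have Pz: "P n z \<ge> 0" by (rule cont_seminorm_ge0[OF lc Pc z(1)])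
      \<comment> \<open>\<open>y n\<close> lies in \<open>F\<close> plus the kernel of
        \<open>p\<close> and \<open>z\<close> does not; hence no \<open>y n + t z\<close> with
        non-zero scalar \<open>t\<close> does. This \<open>t\<close> keeps the perturbation within
        \<open>(1/2) ^ n\<close> for \<open>P n\<close>.\<close>
      define t where "t = (1/2) ^ n / (1 + P n z)"
      have t: "t > 0" unfolding t_def using Pz by (intro divide_pos_pos add_pos_nonneg) auto
      let ?d = "y n + of_real t \<odot> z"
      have tz: "of_real t \<odot> z \<in> topspace T" by (rule subspace_scale[OF V z(1)])
      have d: "?d \<in> topspace T" by (rule subspace_add[OF V yV tz])
      have "P n (?d - y n) = t * P n z" using seminorm_scale[OF cont_seminorm_on[OF lc Pc] z(1)] t by simp
      also have "\<dots> \<le> t * (1 + P n z)" using t by (intro mult_left_mono) auto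
      also have "\<dots> = (1/2) ^ n" using Pz by (simp add: t_def add_nonneg_eq_0_iff)
      finally have "P n (?d - y n) \<le> (1/2) ^ n" .
      moreover have "p (?d - w) \<noteq> 0" if w: "w \<in> F" for w
      proof
        assume 0: "p (?d - w) = 0"
        have wV: "w \<in> topspace T" "w0 \<in> topspace T" using w w0 FV by auto
        let ?w = "of_real (1 / t) \<odot> (w - w0)"
        have wF: "?w \<in> F" unfolding F_def
          by (intro subspace_scale[OF subspace_span] subspace_diff[OF subspace_span]) (use w w0 in \<open>auto simp: F_def\<close>)
        have "p ((?d - w) - (y n - w0)) \<le> p (?d - w) + p (y n - w0)"
          by (rule seminorm_diff[OF ps V subspace_diff[OF V d wV(1)] subspace_diff[OF V yV wV(2)]])
        moreover have "(?d - w) - (y n - w0) = of_real t \<odot> (z - ?w)"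
          using t by (simp add: algebra_simps scale_right_diff_distrib)
        moreover have zw: "z - ?w \<in> topspace T" using subspace_diff[OF V z(1)] wF FV by blast
        ultimately have "t * p (z - ?w) \<le> 0" using 0 w0(2) t seminorm_scale[OF ps zw] by simp
        then have "p (z - ?w) \<le> 0" using t by (simp add: mult_le_0_iff)
        then show False using z(2) wF seminorm_ge0[OF ps V zw] by force
      qed
      ultimately show ?thesis using d by blast
    qed
    then obtain d where d: "d \<in> topspace T" "P n (d - y n) \<le> (1/2) ^ n" "\<And>w. w \<in> F \<Longrightarrow> p (d - w) \<noteq> 0" by blast
    define w where "w = (\<Sum>j<n. f j d \<odot> e j)"
    have w: "w \<in> F" unfolding w_def F_def
      by (rule subspace_sum[OF subspace_span]) (auto intro: span_scale span_base)
    have b: "d - w \<in> topspace T" using subspace_diff[OF V d(1)] w FV by blast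
    have pb: "p (d - w) > 0" using d(3)[OF w] seminorm_ge0[OF ps V b] by linarith
    have fb: "f i (d - w) = 0" if "i < n" for i unfolding w_def by (rule biorthogonal_residual[OF bi that])
    obtain g K where g: "linear_functional s g" "g (d - w) = 1" "\<And>i. i \<in> {..<n} \<Longrightarrow> g (e i) = 0"
      "\<And>x. x \<in> topspace T \<Longrightarrow> norm (g x) \<le> K * p x"
      by (rule biorthogonal_extend[OF hb V ps bi, of C "d - w"]) (use e C b pb fb in auto)
    have "Q h n (d - w, g, K, d)"
      using b g fb d w unfolding Q_def F_def e_def f_def by simp
    then show "\<exists>r. Q h n r" by blast
  qed
  then obtain h where h: "\<And>n. Q h n (h n)" by blast
  define e where "e i = fst (h i)" for i
  define f where "f i = fst (snd (h i))" for i
  define C where "C i = fst (snd (snd (h i)))" for i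
  define D where "D i = snd (snd (snd (h i)))" for i
  have h': "Q h n (e n, f n, C n, D n)" for n using h[of n] by (simp add: e_def f_def C_def D_def)
  have e: "e i \<in> topspace T" and f: "linear_functional s (f i)" and fe: "f i (e i) = 1"
    and C: "\<And>x. x \<in> topspace T \<Longrightarrow> norm (f i x) \<le> C i * p x" 
    and ef: "\<And>j. j < i \<Longrightarrow> f j (e i) = 0 \<and> f i (e j) = 0" 
    and D: "D i \<in> topspace T" "D i - e i \<in> span (e ` {..<i})" "P i (D i - y i) \<le> (1/2) ^ i" for i
    using h'[of i] unfolding Q_def by (auto simp: e_def f_def)
  show ?thesis
  proof (rule that[of e f C D])
    show "biorthogonal UNIV e f"
      unfolding biorthogonal_def
    proof (intro conjI ballI)
      show "f i (e j) = (if i = j then 1 else 0)" for i j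
        using fe ef[of i j] ef[of j i] by (cases i j rule: linorder_cases) auto
    qed (rule f)
    show "D k \<in> span (range e)" for k
    proof -
      have "D k - e k \<in> span (range e)" using D(2) span_mono[of "e ` {..<k}" "range e"] by blast
      then have "(D k - e k) + e k \<in> span (range e)" by (rule span_add[OF _ span_base]) simp
      then show ?thesis by simp
    qed
    fix x q assume x: "x \<in> topspace T" and q: "cont_seminorm s T q"
    note qs = cont_seminorm_on[OF lc q]
    obtain k where k: "\<forall>x\<in>topspace T. q x \<le> P k x" using P q by (auto simp: fundamental_seminorms_def)
    obtain j where j: "2 * q (Y j - x) < 1" using Y(2)[OF x cont_seminorm_mult[OF lc q, of 2]] by auto
    \<comment> \<open>\<open>Suc k\<close> instead of \<open>k\<close> ensures
      \<open>n \<ge> 1\<close>, so that the perturbation is at most 1/2.\<close>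
    define n where "n = prod_encode (j, Suc k)"
    have n: "y n = Y j" "n \<ge> Suc k" by (simp_all add: n_def y_def le_prod_encode_2)
    have dy: "D n - y n \<in> topspace T" "y n - x \<in> topspace T" by (intro subspace_diff[OF V] D(1) yV x)+
    have "q (D n - y n) \<le> P n (D n - y n)"
      using k dy(1) P n(2) unfolding fundamental_seminorms_def by (meson Suc_leD order_trans)
    also have "\<dots> \<le> (1/2) ^ n" by (rule D(3))
    also have "\<dots> \<le> (1/2) ^ 1" using n(2) by (intro power_decreasing) auto
    finally have "q (D n - y n) \<le> 1/2" by simp
    moreover have "q ((D n - y n) + (y n - x)) \<le> q (D n - y n) + q (y n - x)" by (rule seminorm_add[OF qs dy])
    ultimately have "q (D n - x) < 1" using j n(1) by simp
    then show "\<exists>n. q (D n - x) < 1" by blast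
  qed (fact e C D(1))+
qed

text \<open>Each new functional is bounded by the first \<open>P m\<close> that does not vanish on
  the common kernel of the earlier functionals. These indices are unbounded, so every continuous
  seminorm vanishes on the common kernel of finitely many functionals, and in particular on almost
  all \<open>e i\<close>.\<close>

lemma eventually_null_biorthogonal_system:
  assumes hb: "hahn_banach s" and lc: "locally_convex s T" and met: "metrizable_space T"
    and sep: "separable_space T" and p: "\<And>p. \<not> infinite_seminorm T p"
    and inf: "\<not> finite_dimensional s (topspace T)"
  obtains e f D where "\<And>i::nat. e i \<in> topspace T" "biorthogonal UNIV e f"
    "\<And>i. cont_seminorm s T (\<lambda>x. norm (f i x))" "eventually_null T e"
    "\<And>k::nat. D k \<in> topspace T" "\<And>k. D k \<in> span (range e)"
    "\<And>y q. y \<in> topspace T \<Longrightarrow> cont_seminorm s T q \<Longrightarrow> \<exists>n. q (D n - y) < 1"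
proof -
  note V = tvs_facts(1)[OF lc]
  obtain P where P: "fundamental_seminorms T P" using metrizable_fundamental_seminorms[OF lc met] by blast
  then have Pc: "cont_seminorm s T (P k)" for k by (simp add: fundamental_seminorms_def)
  have P_mono: "P j x \<le> P k x" if "j \<le> k" "x \<in> topspace T" for j k x
    using P that by (simp add: fundamental_seminorms_def)
  note Ps = cont_seminorm_on[OF lc Pc]
  define Q :: "(nat \<Rightarrow> 'v \<times> ('v \<Rightarrow> 'k) \<times> real \<times> nat) \<Rightarrow> nat \<Rightarrow> 'v \<times> ('v \<Rightarrow> 'k) \<times> real \<times> nat \<Rightarrow> bool"
    where "Q h n r \<longleftrightarrow> (case r of (e, f, C, k) \<Rightarrow>
      e \<in> topspace T \<and> linear_functional s f \<and> f e = 1 \<and>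
      (\<forall>i<n. fst (snd (h i)) e = 0 \<and> f (fst (h i)) = 0) \<and>
      C \<ge> 0 \<and> (\<forall>x\<in>topspace T. norm (f x) \<le> C * P k x) \<and>
      (\<forall>j<k. \<forall>x\<in>topspace T. (\<forall>i<n. fst (snd (h i)) x = 0) \<longrightarrow> P j x = 0))" for h n r
  have "\<exists>h. \<forall>n. Q h n (h n)"
  proof (rule dependent_wellorder_choice)
    fix r n and h h' :: "nat \<Rightarrow> 'v \<times> ('v \<Rightarrow> 'k) \<times> real \<times> nat"
    assume eq: "\<And>i. i < n \<Longrightarrow> h i = h' i"
    then show "Q h n r = Q h' n r" by (auto simp: Q_def)
  next
    fix n and h :: "nat \<Rightarrow> 'v \<times> ('v \<Rightarrow> 'k) \<times> real \<times> nat"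
    assume "\<And>i. i < n \<Longrightarrow> Q h i (h i)"
    then have h: "i < n \<Longrightarrow> Q h i (fst (h i), fst (snd (h i)), fst (snd (snd (h i))), snd (snd (snd (h i))))" for i by simp
    define e where "e i = fst (h i)" for i
    define f where "f i = fst (snd (h i))" for i
    define C where "C i = fst (snd (snd (h i)))" for i
    define k where "k i = snd (snd (snd (h i)))" for i
    have e: "e i \<in> topspace T" and f: "linear_functional s (f i)" and fe: "f i (e i) = 1"
      and C: "C i \<ge> 0" "\<And>x. x \<in> topspace T \<Longrightarrow> norm (f i x) \<le> C i * P (k i) x" 
      and ef: "\<And>j. j < i \<Longrightarrow> f j (e i) = 0 \<and> f i (e j) = 0" 
      and k: "\<And>j x. j < k i \<Longrightarrow> x \<in> topspace T \<Longrightarrow> (\<And>l. l < i \<Longrightarrow> f l x = 0) \<Longrightarrow> P j x = 0" if "i < n" for i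
      using h[OF that] by (auto simp: Q_def e_def f_def C_def k_def)
    have bi: "biorthogonal {..<n} e f"
      unfolding biorthogonal_def
    proof (intro conjI ballI)
      fix i j assume "i \<in> {..<n}" "j \<in> {..<n}"
      then show "f i (e j) = (if i = j then 1 else 0)"
        using fe ef[of i j] ef[of j i] by (cases i j rule: linorder_cases) auto
    qed (use f in auto)
    define R where "R = {x \<in> topspace T. \<forall>i<n. f i x = 0}"
    have "\<exists>j x. x \<in> R \<and> P j x > 0"
    proof -
      have "\<not> topspace T \<subseteq> span (e ` {..<n})"
      proof
        assume "topspace T \<subseteq> span (e ` {..<n})"
        moreover have "span (e ` {..<n}) \<subseteq> topspace T" using e V by (intro span_minimal) auto
        ultimately show False using inf unfolding finite_dimensional_def by (metis equalityI finite_imageI finite_lessThan)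
      qed
      then obtain x where x: "x \<in> topspace T" "x \<notin> span (e ` {..<n})" by blast
      define w where "w = (\<Sum>j<n. f j x \<odot> e j)"
      have w: "w \<in> span (e ` {..<n})" unfolding w_def
        by (rule subspace_sum[OF subspace_span]) (auto intro: span_scale span_base)
      have wV: "w \<in> topspace T" unfolding w_def
        by (rule subspace_sum[OF V]) (use e subspace_scale[OF V] in blast)
      have "x - w \<in> R" using biorthogonal_residual[OF bi] subspace_diff[OF V x(1) wV] by (simp add: R_def w_def)
      moreover have "x - w \<noteq> 0" using w x(2) by auto
      ultimately obtain q where q: "cont_seminorm s T q" "q (x - w) > 0" "x - w \<in> R"
        using seminorms_separate[OF lc, of "x - w"] by (auto simp: R_def)
      then obtain j where "\<forall>x\<in>topspace T. q x \<le> P j x" using P by (auto simp: fundamental_seminorms_def)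
      then have "P j (x - w) > 0" using q by (force simp: R_def)
      then show ?thesis using q(3) by blast
    qed
    \<comment> \<open>Minimality of \<open>m\<close> has two effects: \<open>P j\<close> vanishes on
      \<open>R\<close> for \<open>j < m\<close>, which is recorded for later steps, and the earlier
      indices are at most \<open>m\<close>, so that \<open>P m\<close> dominates the earlier
      functionals as \<open>biorthogonal_extend\<close> requires.\<close>
    then obtain m where m: "\<exists>x. x \<in> R \<and> P m x > 0" "\<And>j. j < m \<Longrightarrow> \<not> (\<exists>x. x \<in> R \<and> P j x > 0)"
      using exists_least_iff[of "\<lambda>j. \<exists>x. x \<in> R \<and> P j x > 0"] by blast
    obtain b where b: "b \<in> topspace T" "P m b > 0" "\<And>i. i < n \<Longrightarrow> f i b = 0" using m(1) by (auto simp: R_def)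
    have km: "k i \<le> m" if "i < n" for i
    proof (rule ccontr)
      assume "\<not> k i \<le> m"
      then have "P m b = 0" by (intro k[OF that]) (use b that in auto)
      then show False using b(2) by simp
    qed
    have fb: "norm (f i x) \<le> C i * P m x" if "i < n" "x \<in> topspace T" for i x
      using C(2)[OF that] mult_left_mono[OF P_mono[OF km[OF that(1)] that(2)] C(1)[OF that(1)]] by linarith
    obtain g K where g: "linear_functional s g" "g b = 1" "\<And>i. i \<in> {..<n} \<Longrightarrow> g (e i) = 0"
      "K \<ge> 0" "\<And>x. x \<in> topspace T \<Longrightarrow> norm (g x) \<le> K * P m x"
      by (rule biorthogonal_extend[OF hb V Ps[of m] bi, of C b]) (use e fb b in auto)
    have "P j x = 0" if "j < m" "x \<in> topspace T" "\<forall>i<n. f i x = 0" for j x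
      using m(2)[OF that(1)] that cont_seminorm_ge0[OF lc Pc that(2), of j] by (force simp: R_def)
    then have "Q h n (b, g, K, m)" using b g unfolding Q_def by (simp add: e_def f_def)
    then show "\<exists>r. Q h n r" by blast
  qed
  then obtain h where h: "\<And>n. Q h n (h n)" by blast
  define e where "e i = fst (h i)" for i
  define f where "f i = fst (snd (h i))" for i
  define C where "C i = fst (snd (snd (h i)))" for i
  define k where "k i = snd (snd (snd (h i)))" for i
  have h': "Q h n (e n, f n, C n, k n)" for n using h[of n] by (simp add: e_def f_def C_def k_def)
  have e: "e i \<in> topspace T" and f: "linear_functional s (f i)" and fe: "f i (e i) = 1"
    and C: "C i \<ge> 0" "\<And>x. x \<in> topspace T \<Longrightarrow> norm (f i x) \<le> C i * P (k i) x" 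
    and ef: "\<And>j. j < i \<Longrightarrow> f j (e i) = 0 \<and> f i (e j) = 0" 
    and k: "\<And>j x. j < k i \<Longrightarrow> x \<in> topspace T \<Longrightarrow> (\<And>l. l < i \<Longrightarrow> f l x = 0) \<Longrightarrow> P j x = 0" for i
    using h'[of i] unfolding Q_def by (auto simp: e_def f_def)
  have bi: "biorthogonal I e f" for I
    unfolding biorthogonal_def
  proof (intro conjI ballI)
    show "f i (e j) = (if i = j then 1 else 0)" for i j
      using fe ef[of i j] ef[of j i] by (cases i j rule: linorder_cases) auto
  qed (rule f)
  \<comment> \<open>Otherwise all functionals factor through the quotient by the kernel of one
    \<open>P m\<close>. That quotient is finite-dimensional: replacing every \<open>e j\<close> by a
    vector of \<open>span B\<close> modulo the kernel preserves biorthogonality and contradicts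
    \<open>card B\<close>.\<close>
  have k_unbounded: "\<exists>n. k n > m" for m
  proof (rule ccontr)
    assume "\<not> (\<exists>n. k n > m)"
    then have km: "k n \<le> m" for n by (simp add: not_less)
    have "\<exists>B. finite B \<and> B \<subseteq> topspace T \<and> (\<forall>x\<in>topspace T. \<exists>y\<in>span B. P m (x - y) = 0)"
      using p[of "P m"] Pc[of m] by (simp add: infinite_seminorm_def)
    then obtain B where B: "finite B" "B \<subseteq> topspace T" "\<forall>x\<in>topspace T. \<exists>y\<in>span B. P m (x - y) = 0"
      by blast
    have "\<forall>i. \<exists>y. y \<in> span B \<and> P m (e i - y) = 0" using B(3) e by blast
    then obtain y where y: "\<And>i. y i \<in> span B" "\<And>i. P m (e i - y i) = 0" by metis
    have yV: "y i \<in> topspace T" for i using y(1) span_minimal[OF B(2) V] by blast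
    have "f i (e j - y j) = 0" for i j
    proof -
      have d: "e j - y j \<in> topspace T" by (rule subspace_diff[OF V e yV])
      have "norm (f i (e j - y j)) \<le> C i * P m (e j - y j)"
        using C(2)[OF d] mult_left_mono[OF P_mono[OF km d] C(1)] order_trans by blast
      then show ?thesis using y(2) by simp
    qed
    then have "biorthogonal {..<Suc (card B)} y f"
      using bi[of UNIV] f unfolding biorthogonal_def by (simp add: linear_functionalD(5)[OF f])
    then show False using biorthogonal_card_le[OF _ B(1)] y(1) by fastforce
  qed
  have null: "\<exists>N. \<forall>x\<in>topspace T. (\<forall>i<N. f i x = 0) \<longrightarrow> q x = 0" if q: "cont_seminorm s T q" for q
  proof -
    obtain m where m: "\<forall>x\<in>topspace T. q x \<le> P m x" using P q by (auto simp: fundamental_seminorms_def)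
    obtain N where N: "k N > m" using k_unbounded by blast
    have "q x = 0" if "x \<in> topspace T" "\<forall>i<N. f i x = 0" for x
      using k[OF N that(1)] that m cont_seminorm_ge0[OF lc q that(1)] by force
    then show ?thesis by blast
  qed
  obtain Y :: "nat \<Rightarrow> 'v" where Y0: "\<forall>n. Y n \<in> topspace T"
    "\<forall>y q. y \<in> topspace T \<longrightarrow> cont_seminorm s T q \<longrightarrow> (\<exists>n. q (Y n - y) < 1)"
    using separable_dense_sequence[OF lc sep] by blast
  then have Y: "Y n \<in> topspace T" 
    "\<And>y q. y \<in> topspace T \<Longrightarrow> cont_seminorm s T q \<Longrightarrow> \<exists>n. q (Y n - y) < 1" for n by simp_all
  \<comment> \<open>All partial expansions of the dense sequence. A given seminorm does not see the
    remainder of a sufficiently long one.\<close>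
  define D where "D r = (case prod_decode r of (j, n) \<Rightarrow> \<Sum>i<n. f i (Y j) \<odot> e i)" for r
  show ?thesis
  proof (rule that[of e f D])
    show "cont_seminorm s T (\<lambda>x. norm (f i x))" for i
    proof (rule cont_seminorm_dominated[OF lc _ Pc C(2)])
      show "seminorm_on s (topspace T) (\<lambda>x. norm (f i x))"
        unfolding seminorm_on_def by (simp add: linear_functionalD[OF f] norm_mult norm_triangle_ineq)
    qed
    show "eventually_null T e"
      unfolding eventually_null_def
    proof (intro allI impI)
      fix q assume "cont_seminorm s T q"
      then obtain N where "\<forall>x\<in>topspace T. (\<forall>i<N. f i x = 0) \<longrightarrow> q x = 0" using null by blast
      then have "\<forall>i\<ge>N. q (e i) = 0" using e ef by auto
      then show "\<exists>N. \<forall>i\<ge>N. q (e i) = 0" ..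
    qed
    show "D r \<in> topspace T" for r
      unfolding D_def by (auto split: prod.split intro!: subspace_sum[OF V] subspace_scale[OF V] e)
    show "D r \<in> span (range e)" for r
    proof -
      have "f i (Y j) \<odot> e i \<in> span (range e)" for i j by (rule span_scale[OF span_base]) simp
      then show ?thesis unfolding D_def by (auto split: prod.split intro!: span_sum)
    qed
    fix x q assume x: "x \<in> topspace T" and q: "cont_seminorm s T q"
    note qs = cont_seminorm_on[OF lc q]
    obtain N where N: "\<forall>x\<in>topspace T. (\<forall>i<N. f i x = 0) \<longrightarrow> q x = 0" using null[OF q] by blast
    obtain j where j: "q (Y j - x) < 1" using Y(2)[OF x q] by blast
    define w where "w = (\<Sum>i<N. f i (Y j) \<odot> e i)"
    have w: "w \<in> topspace T" unfolding w_def by (auto intro!: subspace_sum[OF V] subspace_scale[OF V] e)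
    have d: "Y j - w \<in> topspace T" "Y j - x \<in> topspace T" by (intro subspace_diff[OF V] Y(1) w x)+
    have "q (Y j - w) = 0" using N d(1) biorthogonal_residual[OF bi] by (simp add: w_def)
    moreover have "q ((Y j - x) - (Y j - w)) \<le> q (Y j - x) + q (Y j - w)" by (rule seminorm_diff[OF qs V d(2,1)])
    ultimately have "q (w - x) < 1" using j by simp
    then show "\<exists>n. q (D n - x) < 1" by (intro exI[of _ "prod_encode (j, N)"]) (simp add: D_def w_def)
  qed (fact e bi)+
qed

text \<open>If no continuous seminorm has a kernel of infinite codimension, then the space is finite-dimensional
  or isomorphic to a countable power of the scalar field.\<close>

definition space_data :: "'v topology \<Rightarrow> (nat \<Rightarrow> 'v) \<Rightarrow> (nat \<Rightarrow> 'v \<Rightarrow> 'k) \<Rightarrow> (nat \<Rightarrow> 'v) \<Rightarrow> bool" where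
  "space_data T v f D \<longleftrightarrow> (\<forall>i. v i \<in> topspace T) \<and> (\<forall>k. D k \<in> topspace T \<and> D k \<in> span (range v)) \<and>
     (\<forall>y q. y \<in> topspace T \<longrightarrow> cont_seminorm s T q \<longrightarrow> (\<exists>n. q (D n - y) < 1)) \<and>
     (\<not> finite_dimensional s (topspace T) \<longrightarrow> biorthogonal UNIV v f \<and> (\<forall>i. cont_seminorm s T (\<lambda>x. norm (f i x)))) \<and>
     (if \<exists>p. infinite_seminorm T p
      then \<exists>p C. cont_seminorm s T p \<and> (\<forall>i. \<forall>x\<in>topspace T. norm (f i x) \<le> C i * p x)
      else eventually_null T v)"

lemma exists_space_data:
  assumes hb: "hahn_banach s" and lc: "locally_convex s T" and met: "metrizable_space T"
    and sep: "separable_space T"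
  shows "\<exists>v f D. space_data T v f D"
proof -
  note V = tvs_facts(1)[OF lc]
  consider p where "infinite_seminorm T p" | "\<not> (\<exists>p. infinite_seminorm T p)" "\<not> finite_dimensional s (topspace T)"
    | "\<not> (\<exists>p. infinite_seminorm T p)" "finite_dimensional s (topspace T)" by blast
  then show ?thesis
  proof cases
    case 1
    then have pc: "cont_seminorm s T p" by (simp add: infinite_seminorm_def)
    obtain e f C D where efCD: "\<And>i::nat. e i \<in> topspace T" "biorthogonal UNIV e f"
      "\<And>i x. x \<in> topspace T \<Longrightarrow> norm (f i x) \<le> C i * p x"
      "\<And>k::nat. D k \<in> topspace T" "\<And>k. D k \<in> span (range e)"
      "\<And>y q. y \<in> topspace T \<Longrightarrow> cont_seminorm s T q \<Longrightarrow> \<exists>n. q (D n - y) < 1"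
      by (rule dominated_biorthogonal_system[OF hb lc met sep 1]) (rule that)
    have lf: "linear_functional s (f i)" for i using efCD(2) by (simp add: biorthogonal_def)
    have "cont_seminorm s T (\<lambda>x. norm (f i x))" for i
    proof (rule cont_seminorm_dominated[OF lc _ pc efCD(3)])
      show "seminorm_on s (topspace T) (\<lambda>x. norm (f i x))"
        unfolding seminorm_on_def by (simp add: linear_functionalD[OF lf] norm_mult norm_triangle_ineq)
    qed
    then have "biorthogonal UNIV e f \<and> (\<forall>i. cont_seminorm s T (\<lambda>x. norm (f i x)))" using efCD(2) by blast
    moreover have "\<exists>p C. cont_seminorm s T p \<and> (\<forall>i. \<forall>x\<in>topspace T. norm (f i x) \<le> C i * p x)"
      using pc efCD(3) by blast
    moreover have "\<exists>p. infinite_seminorm T p" using 1 by blast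
    ultimately have "space_data T e f D" unfolding space_data_def using efCD(1,4,5,6) by simp
    then show ?thesis by blast
  next
    case 2
    have np: "\<not> infinite_seminorm T p" for p using 2(1) by blast
    obtain e f D where "\<And>i::nat. e i \<in> topspace T" "biorthogonal UNIV e f"
      "\<And>i. cont_seminorm s T (\<lambda>x. norm (f i x))" "eventually_null T e"
      "\<And>k::nat. D k \<in> topspace T" "\<And>k. D k \<in> span (range e)"
      "\<And>y q. y \<in> topspace T \<Longrightarrow> cont_seminorm s T q \<Longrightarrow> \<exists>n. q (D n - y) < 1"
      by (rule eventually_null_biorthogonal_system[OF hb lc met sep np 2(2)]) (rule that)
    then have "space_data T e f D" unfolding space_data_def by (auto simp: np)
    then show ?thesis by blast
  next
    case 3
    obtain B where B: "finite B" "span B = topspace T" using 3(2) by (auto simp: finite_dimensional_def)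
    obtain xs where xs: "set xs = B" using finite_list[OF B(1)] by blast
    \<comment> \<open>A finite spanning list, padded by zeros and therefore eventually null.\<close>
    define v where "v i = (if i < length xs then xs ! i else 0)" for i
    have v: "v i \<in> topspace T" for i
      using xs B(2) span_base[of _ B] zero_in_topspace[OF lc] nth_mem unfolding v_def by auto
    have "B \<subseteq> range v"
    proof
      fix b assume "b \<in> B"
      then obtain i where "i < length xs" "xs ! i = b" using xs by (metis in_set_conv_nth)
      then show "b \<in> range v" by (auto simp: v_def image_iff intro!: exI[of _ i])
    qed
    then have sp: "topspace T \<subseteq> span (range v)" using span_mono B(2) by blast
    have null: "eventually_null T v"
      unfolding eventually_null_def v_def using cont_seminorm_0[OF lc] by (auto intro!: exI[of _ "length xs"])
    obtain Y :: "nat \<Rightarrow> 'v" where "\<forall>n. Y n \<in> topspace T"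
      "\<forall>y q. y \<in> topspace T \<longrightarrow> cont_seminorm s T q \<longrightarrow> (\<exists>n. q (Y n - y) < 1)"
      using separable_dense_sequence[OF lc sep] by blast
    then have "space_data T v (\<lambda>_ _. 0) Y" unfolding space_data_def using 3 v sp null by auto
    then show ?thesis by blast
  qed
qed

end

section \<open>Steering along a Jordan chain\<close>

definition fdiff :: "(nat \<Rightarrow> 'k::ab_group_add) \<Rightarrow> nat \<Rightarrow> 'k" where
  "fdiff f z = f (Suc z) - f z"

abbreviation fdiffs :: "nat \<Rightarrow> (nat \<Rightarrow> 'k::ab_group_add) \<Rightarrow> nat \<Rightarrow> 'k" where
  "fdiffs n f \<equiv> (fdiff ^^ n) f"

lemma fdiffs_Suc: "fdiffs (Suc n) f z = fdiffs n f (Suc z) - fdiffs n f z"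
  by (simp add: fdiff_def)

lemma fdiffs_Suc': "fdiffs (Suc n) f = fdiffs n (fdiff f)"
  by (simp only: funpow_Suc_right o_apply)

lemma fdiffs_add: "fdiffs n (\<lambda>z. f z + g z) z = fdiffs n f z + fdiffs n g z"
  by (induction n arbitrary: z) (simp_all add: fdiff_def)

lemma fdiffs_mult: "fdiffs n (\<lambda>z. c * f z) z = c * fdiffs n f z" for c :: "'k::ring"
  by (induction n arbitrary: z) (simp_all add: fdiff_def right_diff_distrib)

lemma fdiffs_zero [simp]: "fdiffs n (\<lambda>z. 0) z = 0"
  by (induction n arbitrary: z) (simp_all add: fdiff_def)

lemma fdiffs_shift: "fdiffs n (\<lambda>z. f (k + z)) z = fdiffs n f (k + z)"
  by (induction n arbitrary: z) (simp_all add: fdiff_def)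

lemma fdiffs_cong: "(\<And>m. m \<le> n \<Longrightarrow> f (z + m) = g (z + m)) \<Longrightarrow> fdiffs n f z = fdiffs n g z"
proof (induction n arbitrary: z)
  case 0 from 0[of 0] show ?case by simp
next
  case (Suc n)
  have "fdiffs n f (Suc z) = fdiffs n g (Suc z)" by (rule Suc.IH) (use Suc.prems[of "Suc _"] in simp)
  moreover have "fdiffs n f z = fdiffs n g z" by (rule Suc.IH) (use Suc.prems in simp)
  ultimately show ?case unfolding fdiffs_Suc by simp
qed

lemma tendsto_fdiffs:
  fixes f :: "'a \<Rightarrow> nat \<Rightarrow> 'k::real_normed_vector"
  assumes "\<And>z. ((\<lambda>K. f K z) \<longlongrightarrow> g z) F"
  shows "((\<lambda>K. fdiffs n (f K) z) \<longlongrightarrow> fdiffs n g z) F"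
  by (induction n arbitrary: z) (auto simp: fdiff_def intro!: assms tendsto_diff)

text \<open>Induction on \<open>m\<close> by Pascal's rule, expanding at \<open>Suc z\<close>. Terms
  with \<open>j > m\<close> vanish, so every \<open>n > m\<close> serves.\<close>

lemma newton_forward:
  fixes f :: "nat \<Rightarrow> 'k::comm_ring_1"
  assumes "m < n" shows "f (z + m) = (\<Sum>j<n. of_nat (m choose j) * fdiffs j f z)"
  using assms
proof (induction m arbitrary: z)
  case 0
  have z: "0 choose i = 0" if "i \<noteq> 0" for i using that by (simp add: binomial_eq_0)
  have "(\<Sum>j<n. of_nat (0 choose j) * fdiffs j f z) = (\<Sum>j\<in>{0}. of_nat (0 choose j) * fdiffs j f z)"
    by (rule sum.mono_neutral_right) (use 0 z in \<open>auto, metis mult_zero_left of_nat_0\<close>)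
  then show ?case by simp
next
  case (Suc m)
  then obtain n' where n': "n = Suc n'" by (cases n) auto
  have "f (z + Suc m) = (\<Sum>j<n. of_nat (m choose j) * fdiffs j f (Suc z))"
    using Suc.IH[of "Suc z"] Suc.prems by simp
  also have "\<dots> = (\<Sum>j<n. of_nat (m choose j) * fdiffs j f z) + (\<Sum>j<n. of_nat (m choose j) * fdiffs (Suc j) f z)"
    by (simp add: fdiff_def algebra_simps flip: sum.distrib)
  also have "(\<Sum>j<n. of_nat (m choose j) * fdiffs (Suc j) f z) = (\<Sum>j<n'. of_nat (m choose j) * fdiffs (Suc j) f z)"
    unfolding n' using Suc.prems n' by (simp add: binomial_eq_0)
  also have "(\<Sum>j<n. of_nat (m choose j) * fdiffs j f z)
     = fdiffs 0 f z + (\<Sum>j<n'. of_nat (m choose Suc j) * fdiffs (Suc j) f z)"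
    unfolding n' by (subst sum.lessThan_Suc_shift) simp
  also have "fdiffs 0 f z + (\<Sum>j<n'. of_nat (m choose Suc j) * fdiffs (Suc j) f z) + (\<Sum>j<n'. of_nat (m choose j) * fdiffs (Suc j) f z)
     = fdiffs 0 f z + (\<Sum>j<n'. of_nat (Suc m choose Suc j) * fdiffs (Suc j) f z)"
    by (simp add: algebra_simps del: funpow.simps flip: sum.distrib)
  also have "\<dots> = (\<Sum>j<n. of_nat (Suc m choose j) * fdiffs j f z)"
    unfolding n' by (subst sum.lessThan_Suc_shift) simp
  finally show ?case .
qed

text \<open>Vanishing \<open>n\<close>-th differences stand for degree less than \<open>n\<close>.
  The induction uses the product rule: the difference of \<open>(z - c) * f z\<close> is
  \<open>(z - c) * fdiff f z + f (z + 1)\<close>.\<close>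

lemma fdiffs_linear_factor:
  fixes f :: "nat \<Rightarrow> 'k::comm_ring_1"
  assumes "\<And>z. fdiffs n f z = 0"
  shows "fdiffs (Suc n) (\<lambda>z. (of_nat z - c) * f z) z = 0"
  using assms
proof (induction n arbitrary: f c z)
  case 0
  then show ?case by (simp add: fdiff_def)
next
  case (Suc n)
  have "fdiff (\<lambda>z. (of_nat z - c) * f z) = (\<lambda>z. (of_nat z - c) * fdiff f z + f (1 + z))"
    by (simp add: fdiff_def fun_eq_iff algebra_simps)
  then have "fdiffs (Suc (Suc n)) (\<lambda>z. (of_nat z - c) * f z) z
     = fdiffs (Suc n) (\<lambda>z. (of_nat z - c) * fdiff f z) z + fdiffs (Suc n) (\<lambda>z. f (1 + z)) z"
    unfolding fdiffs_Suc'[of "Suc n"] by (simp only: fdiffs_add)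
  also have "fdiffs (Suc n) (\<lambda>z. (of_nat z - c) * fdiff f z) z = 0"
    by (rule Suc.IH) (use Suc.prems in \<open>simp only: fdiffs_Suc'\<close>)
  also have "fdiffs (Suc n) (\<lambda>z. f (1 + z)) z = 0"
    unfolding fdiffs_shift by (rule Suc.prems)
  finally show ?case by simp
qed

lemma fdiffs_mono:
  fixes f :: "nat \<Rightarrow> 'k::comm_ring_1"
  assumes "\<And>z. fdiffs n f z = 0" "n \<le> m" shows "fdiffs m f z = 0"
  using assms(2)
proof (induction m arbitrary: z rule: dec_induct)
  case base show ?case by (rule assms(1))
next
  case (step m) then show ?case by (simp add: fdiff_def)
qed

lemma fdiffs_prod_linear:
  fixes c :: "'i \<Rightarrow> 'k::comm_ring_1"
  assumes "finite A"
  shows "fdiffs (Suc (card A)) (\<lambda>z. \<Prod>i\<in>A. (of_nat z - c i)) z = 0"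
  using assms
proof (induction A arbitrary: z rule: finite_induct)
  case (insert a A)
  have "fdiffs (Suc (Suc (card A))) (\<lambda>z. (of_nat z - c a) * (\<Prod>i\<in>A. (of_nat z - c i))) z = 0"
    by (rule fdiffs_linear_factor) (rule insert.IH)
  then show ?case using insert.hyps by simp
qed (simp add: fdiff_def)

lemma fdiffs_sum_zero:
  "(\<And>i. i \<in> A \<Longrightarrow> fdiffs n (f i) z = 0) \<Longrightarrow> fdiffs n (\<lambda>z. \<Sum>i\<in>A. f i z) z = 0"
  by (induction A rule: infinite_finite_induct) (simp_all add: fdiffs_add)

text \<open>The polynomial of degree less than \<open>2 d\<close> that vanishes at \<open>b, ..., b + d - 1\<close> and takes the
  values \<open>w i\<close> at \<open>a + i\<close>, where \<open>a - b = 1 / r\<close>. As \<open>r\<close> tends to \<open>0\<close>, it tends near \<open>a\<close> to the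
  Newton interpolation of \<open>w\<close>, and near \<open>b\<close> to zero.\<close>

definition hermite_coeff :: "nat \<Rightarrow> (nat \<Rightarrow> 'k) \<Rightarrow> 'k::real_normed_field \<Rightarrow> nat \<Rightarrow> 'k" where
  "hermite_coeff d w r j = fdiffs j (\<lambda>i. w i / (\<Prod>k<d. 1 + (of_nat i - of_nat k) * r)) 0"

text \<open>The first product creates the zeros at \<open>b + k\<close>; the factors
  \<open>r\<close> normalise it so that it tends to 1 near \<open>a\<close>. The sum is the Newton
  form at \<open>a\<close> of the interpolation of \<open>w\<close> divided by this product.\<close>

definition two_point :: "nat \<Rightarrow> (nat \<Rightarrow> 'k) \<Rightarrow> 'k \<Rightarrow> 'k \<Rightarrow> 'k::real_normed_field \<Rightarrow> 'k \<Rightarrow> 'k" where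
  "two_point d w a b r z = (\<Prod>k<d. (z - b - of_nat k) * r) *
     (\<Sum>j<d. hermite_coeff d w r j * ((\<Prod>l<j. z - a - of_nat l) / fact j))"

lemma two_point_fdiffs: "fdiffs (2 * d) (\<lambda>z. two_point d w a b r (of_nat z)) z = 0"
proof -
  have "fdiffs (2 * d) (\<lambda>z. r ^ d * hermite_coeff d w r j / fact j *
      ((\<Prod>k<d. of_nat z - (b + of_nat k)) * (\<Prod>l<j. of_nat z - (a + of_nat l)))) z = 0" if "j < d" for j
  proof -
    \<comment> \<open>The roots of both products as one family over a disjoint union:
      \<open>d + j\<close> linear factors with \<open>j < d\<close>, thus degree less than
      \<open>2 * d\<close>.\<close>
    define c where "c = case_sum (\<lambda>k::nat. b + of_nat k) (\<lambda>l::nat. a + of_nat l)"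
    have "(\<Prod>k<d. of_nat z - (b + of_nat k)) * (\<Prod>l<j. of_nat z - (a + of_nat l))
        = (\<Prod>i\<in>{..<d} <+> {..<j}. of_nat z - c i)" for z
      by (simp add: prod.Plus c_def)
    moreover have "fdiffs (2 * d) (\<lambda>z. \<Prod>i\<in>{..<d} <+> {..<j}. of_nat z - c i) z = 0"
      by (rule fdiffs_mono[OF fdiffs_prod_linear]) (use that in \<open>simp_all add: card_Plus\<close>)
    ultimately show ?thesis by (simp only: fdiffs_mult mult_zero_right)
  qed
  then have "fdiffs (2 * d) (\<lambda>z. \<Sum>j<d. r ^ d * hermite_coeff d w r j / fact j *
      ((\<Prod>k<d. of_nat z - (b + of_nat k)) * (\<Prod>l<j. of_nat z - (a + of_nat l)))) z = 0"
    by (intro fdiffs_sum_zero) auto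
  moreover have "two_point d w a b r (of_nat z) = (\<Sum>j<d. r ^ d * hermite_coeff d w r j / fact j *
      ((\<Prod>k<d. of_nat z - (b + of_nat k)) * (\<Prod>l<j. of_nat z - (a + of_nat l))))" for z
    unfolding two_point_def prod.distrib sum_distrib_left
    by (intro sum.cong) (simp_all add: algebra_simps)
  ultimately show ?thesis by simp
qed

lemma prod_falling_eq: "(\<Prod>l<j. of_nat m - of_nat l) / fact j = (of_nat (m choose j) :: 'k::field_char_0)"
  by (simp add: binomial_gbinomial gbinomial_prod_rev atLeast0LessThan)

lemma two_point_near:
  assumes "a - b = 1 / r" "r \<noteq> 0"
  shows "two_point d w a b r (a + of_nat m) = 
    (\<Prod>k<d. 1 + (of_nat m - of_nat k) * r) * (\<Sum>j<d. hermite_coeff d w r j * of_nat (m choose j))"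
proof -
  have "(a + of_nat m - b - of_nat k) * r = 1 + (of_nat m - of_nat k) * r" for k
  proof -
    have "a + of_nat m - b - of_nat k = (a - b) + (of_nat m - of_nat k)" by simp
    then show ?thesis unfolding assms(1) using assms(2) by (simp add: field_simps)
  qed
  then show ?thesis unfolding two_point_def by (simp add: prod_falling_eq)
qed

lemma two_point_near_exact:
  assumes "a - b = 1 / r" "r \<noteq> 0" "m < d" "\<And>k. k < d \<Longrightarrow> 1 + (of_nat m - of_nat k) * r \<noteq> 0"
  shows "two_point d w a b r (a + of_nat m) = w m"
proof -
  let ?f = "\<lambda>i. w i / (\<Prod>k<d. 1 + (of_nat i - of_nat k) * r)"
  have "(\<Sum>j<d. hermite_coeff d w r j * of_nat (m choose j)) = ?f m"
    using newton_forward[OF assms(3), of ?f 0] by (simp add: hermite_coeff_def mult.commute)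
  then show ?thesis unfolding two_point_near[OF assms(1,2)] using assms(4) by simp
qed

lemma tendsto_hermite_coeff: "(r \<longlongrightarrow> 0) F \<Longrightarrow> ((\<lambda>K. hermite_coeff d w (r K) j) \<longlongrightarrow> fdiffs j w 0) F"
proof -
  assume r: "(r \<longlongrightarrow> 0) F"
  have "((\<lambda>K. w i / (\<Prod>k<d. 1 + (of_nat i - of_nat k) * r K)) \<longlongrightarrow> w i / (\<Prod>k<d. 1 + (of_nat i - of_nat k) * 0)) F" for i
    by (intro tendsto_intros r) simp
  then show ?thesis unfolding hermite_coeff_def by (intro tendsto_fdiffs) simp
qed

lemma tendsto_two_point_near:
  assumes "\<And>K. a K - b K = 1 / r K" "\<And>K. r K \<noteq> 0" "(r \<longlongrightarrow> 0) F"
  shows "((\<lambda>K. two_point d w (a K) (b K) (r K) (a K + of_nat m)) \<longlongrightarrow> (\<Sum>j<d. fdiffs j w 0 * of_nat (m choose j))) F"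
proof -
  have "((\<lambda>K. (\<Prod>k<d. 1 + (of_nat m - of_nat k) * r K) * (\<Sum>j<d. hermite_coeff d w (r K) j * of_nat (m choose j)))
    \<longlongrightarrow> (\<Prod>k<d. 1 + (of_nat m - of_nat k) * 0) * (\<Sum>j<d. fdiffs j w 0 * of_nat (m choose j))) F"
    by (intro tendsto_intros tendsto_hermite_coeff assms(3))
  then show ?thesis by (simp add: two_point_near[OF assms(1,2)])
qed

text \<open>Near \<open>b\<close> the Newton product with \<open>j\<close> factors is of order
  \<open>1 / r ^ j\<close>, while the outer product contributes \<open>r ^ d\<close>. As
  \<open>j < d\<close>, a positive power \<open>r ^ (d - j)\<close> survives and drives the value to
  0.\<close>

lemma two_point_far:
  assumes "a - b = 1 / r" "r \<noteq> 0"
  shows "two_point d w a b r (b + of_nat m) = 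
    (\<Sum>j<d. hermite_coeff d w r j * ((\<Prod>k<d. of_nat m - of_nat k) * r ^ (d - j) * (\<Prod>l<j. (of_nat m - of_nat l) * r - 1) / fact j))"
proof -
  have "(\<Prod>l<j. b + of_nat m - a - of_nat l) * r ^ j = (\<Prod>l<j. (of_nat m - of_nat l) * r - 1)" for j
  proof -
    have "(b + of_nat m - a - of_nat l) * r = (of_nat m - of_nat l) * r - 1" for l
    proof -
      have "b + of_nat m - a - of_nat l = (of_nat m - of_nat l) - (a - b)" by simp
      then show ?thesis unfolding assms(1) using assms(2) by (simp add: field_simps)
    qed
    then have "(\<Prod>l<j. (b + of_nat m - a - of_nat l) * r) = (\<Prod>l<j. (of_nat m - of_nat l) * r - 1)" by simp
    then show ?thesis by (simp add: prod.distrib)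
  qed
  then have *: "(\<Prod>l<j. b + of_nat m - a - of_nat l) = (\<Prod>l<j. (of_nat m - of_nat l) * r - 1) / r ^ j" for j
    using assms(2) by (simp add: field_simps)
  have **: "r ^ d / r ^ j = r ^ (d - j)" if "j < d" for j using that assms(2) by (simp add: power_diff)
  have "two_point d w a b r (b + of_nat m) = 
    (\<Sum>j<d. hermite_coeff d w r j * ((\<Prod>k<d. of_nat m - of_nat k) * (r ^ d / r ^ j) * (\<Prod>l<j. (of_nat m - of_nat l) * r - 1) / fact j))"
    unfolding two_point_def * sum_distrib_left by (intro sum.cong) (simp_all add: prod.distrib)
  then show ?thesis using ** by simp
qed

lemma two_point_far_exact: "m < d \<Longrightarrow> two_point d w a b r (b + of_nat m) = 0"
  unfolding two_point_def by auto

lemma tendsto_two_point_far: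
  assumes "\<And>K. a K - b K = 1 / r K" "\<And>K. r K \<noteq> 0" "(r \<longlongrightarrow> 0) F"
  shows "((\<lambda>K. two_point d w (a K) (b K) (r K) (b K + of_nat m)) \<longlongrightarrow> 0) F"
proof -
  have "((\<lambda>K. \<Sum>j<d. hermite_coeff d w (r K) j * ((\<Prod>k<d. of_nat m - of_nat k) * r K ^ (d - j) * (\<Prod>l<j. (of_nat m - of_nat l) * r K - 1) / fact j))
    \<longlongrightarrow> (\<Sum>j<d. fdiffs j w 0 * ((\<Prod>k<d. of_nat m - of_nat k) * 0 ^ (d - j) * (\<Prod>l<j. (of_nat m - of_nat l) * 0 - 1) / fact j))) F"
    by (intro tendsto_intros tendsto_hermite_coeff assms(3)) auto
  moreover have "(\<Sum>j<d. fdiffs j w 0 * ((\<Prod>k<d. of_nat m - of_nat k) * 0 ^ (d - j) * (\<Prod>l<j. (of_nat m - of_nat l) * 0 - 1) / fact j)) = 0"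
    by (rule sum.neutral) auto
  ultimately show ?thesis by (simp add: two_point_far[OF assms(1,2)])
qed

text \<open>The sum of two polynomials: one takes the values \<open>X\<close> near 0 and is
  negligible near \<open>K\<close>, the other takes the values \<open>Y\<close> near
  \<open>K\<close> and is negligible near 0.\<close>

lemma interpolating_sequence:
  fixes X Y :: "nat \<Rightarrow> 'k::real_normed_field"
  shows "\<exists>q :: nat \<Rightarrow> nat \<Rightarrow> 'k. (\<forall>K z. fdiffs (2 * d) (q K) z = 0) \<and>
    (\<forall>K m. K > d \<longrightarrow> m < d \<longrightarrow> q K m = X m \<and> q K (K + m) = Y m) \<and>
    (\<forall>m. (\<lambda>K. q K m) \<longlonglongrightarrow> (\<Sum>j<d. fdiffs j X 0 * of_nat (m choose j))) \<and>
    (\<forall>m. (\<lambda>K. q K (K + m)) \<longlonglongrightarrow> (\<Sum>j<d. fdiffs j Y 0 * of_nat (m choose j)))"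
proof -
  \<comment> \<open>Equal to \<open>K\<close> except at \<open>K = 0\<close>, where
    \<open>max\<close> keeps the reciprocal non-zero.\<close>
  define h where "h K = (of_nat (max K 1) :: 'k)" for K
  define r where "r K = 1 / h K" for K
  have h0: "h K \<noteq> 0" for K unfolding h_def by (cases K) (auto simp: max_def simp del: of_nat_Suc)
  then have r0: "r K \<noteq> 0" "- r K \<noteq> 0" for K by (auto simp: r_def)
  have ev: "\<forall>\<^sub>F K in sequentially. h K = of_nat K" 
    using eventually_ge_at_top[of 1] by eventually_elim (simp add: h_def max_def)
  have "(\<lambda>K. 1 / of_nat K :: 'k) \<longlonglongrightarrow> 0" by (rule lim_1_over_n)
  then have r: "r \<longlonglongrightarrow> 0"
    by (rule Lim_transform_eventually) (use ev in \<open>eventually_elim, simp add: r_def\<close>)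
  then have r': "(\<lambda>K. - r K) \<longlonglongrightarrow> 0" using tendsto_minus[of r 0] by simp
  \<comment> \<open>In \<open>A\<close> the prescribed cluster is at 0 and the zeros are at
    \<open>h K\<close>; in \<open>B\<close> it is the other way round. Hence the opposite signs of
    \<open>r\<close>.\<close>
  define A where "A K z = two_point d X 0 (h K) (- r K) z" for K z
  define B where "B K z = two_point d Y (h K) 0 (r K) z" for K z
  have A: "0 - h K = 1 / (- r K)" and B: "h K - 0 = 1 / r K" for K using h0 by (simp_all add: r_def)
  have hK: "h K = of_nat K" if "K > d" for K using that by (auto simp: h_def max_def)
  \<comment> \<open>For \<open>K > d\<close> the two clusters of nodes are disjoint:
    \<open>K + m\<close> differs from \<open>k\<close>, and \<open>K + k\<close> from
    \<open>m\<close>.\<close>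
  have hz: "(1::'k) + (of_nat m - of_nat k) * r K \<noteq> 0" "(1::'k) + (of_nat m - of_nat k) * (- r K) \<noteq> 0"
    if "K > d" "m < d" "k < d" for K m k
  proof -
    have "(of_nat K :: 'k) + (of_nat m - of_nat k) \<noteq> 0"
      using that of_nat_eq_iff[where 'a = 'k, of "K + m" k] by (auto simp: algebra_simps simp del: of_nat_eq_iff)
    moreover have "(of_nat K :: 'k) - (of_nat m - of_nat k) \<noteq> 0"
      using that of_nat_eq_iff[where 'a = 'k, of "K + k" m] by (auto simp: algebra_simps simp del: of_nat_eq_iff)
    ultimately show "(1::'k) + (of_nat m - of_nat k) * r K \<noteq> 0" "(1::'k) + (of_nat m - of_nat k) * (- r K) \<noteq> 0"
      using hK[OF that(1)] h0[of K] by (auto simp: r_def field_simps)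
  qed
  define q where "q K z = A K (of_nat z) + B K (of_nat z)" for K z
  show ?thesis
  proof (intro exI[of _ q] conjI allI impI)
    show "fdiffs (2 * d) (q K) z = 0" for K z
      using fdiffs_add[of "2 * d" "\<lambda>z. A K (of_nat z)" "\<lambda>z. B K (of_nat z)" z]
      unfolding A_def B_def two_point_fdiffs q_def by simp
    show "q K m = X m" if "K > d" "m < d" for K m
    proof -
      have "two_point d X 0 (h K) (- r K) (0 + of_nat m) = X m"
        by (rule two_point_near_exact[OF A r0(2) that(2) hz(2)[OF that]])
      moreover have "two_point d Y (h K) 0 (r K) (0 + of_nat m) = 0" by (rule two_point_far_exact[OF that(2)])
      ultimately show ?thesis by (simp add: q_def A_def B_def)
    qed
    show "q K (K + m) = Y m" if "K > d" "m < d" for K m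
    proof -
      have "two_point d Y (h K) 0 (r K) (h K + of_nat m) = Y m"
        by (rule two_point_near_exact[OF B r0(1) that(2) hz(1)[OF that]])
      moreover have "two_point d X 0 (h K) (- r K) (h K + of_nat m) = 0" by (rule two_point_far_exact[OF that(2)])
      ultimately show ?thesis by (simp add: q_def A_def B_def hK[OF that(1)])
    qed
    have "(\<lambda>K. A K (0 + of_nat m) + B K (0 + of_nat m)) \<longlonglongrightarrow> (\<Sum>j<d. fdiffs j X 0 * of_nat (m choose j)) + 0" for m
      unfolding A_def B_def by (intro tendsto_add tendsto_two_point_near tendsto_two_point_far A B r0 r r')
    then show "(\<lambda>K. q K m) \<longlonglongrightarrow> (\<Sum>j<d. fdiffs j X 0 * of_nat (m choose j))" for m by (simp add: q_def)
    have "(\<lambda>K. A K (h K + of_nat m) + B K (h K + of_nat m)) \<longlonglongrightarrow> 0 + (\<Sum>j<d. fdiffs j Y 0 * of_nat (m choose j))" for m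
      unfolding A_def B_def by (intro tendsto_add tendsto_two_point_near tendsto_two_point_far A B r0 r r')
    then have lim: "(\<lambda>K. A K (h K + of_nat m) + B K (h K + of_nat m)) \<longlonglongrightarrow> (\<Sum>j<d. fdiffs j Y 0 * of_nat (m choose j))" for m
      by simp
    show "(\<lambda>K. q K (K + m)) \<longlonglongrightarrow> (\<Sum>j<d. fdiffs j Y 0 * of_nat (m choose j))" for m
      by (rule Lim_transform_eventually[OF lim[of m]]) (use ev in \<open>eventually_elim, simp add: q_def\<close>)
  qed
qed

text \<open>Differences at 0 are the coordinates with respect to the binomial basis.\<close>

lemma fdiffs_choose: "fdiffs i (\<lambda>m. of_nat (m choose j) :: 'k::comm_ring_1) 0 = (if i = j then 1 else 0)"
proof (induction i arbitrary: j)
  case 0 then show ?case by (cases j) auto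
next
  case (Suc i)
  show ?case
  proof (cases j)
    case 0
    then have "fdiff (\<lambda>m. of_nat (m choose j) :: 'k) = (\<lambda>_. 0)" by (simp add: fdiff_def fun_eq_iff)
    then show ?thesis using 0 unfolding fdiffs_Suc' by simp
  next
    case (Suc j')
    then have "fdiff (\<lambda>m. of_nat (m choose j) :: 'k) = (\<lambda>m. of_nat (m choose j'))" by (simp add: fdiff_def fun_eq_iff)
    then show ?thesis using Suc Suc.IH[of j'] unfolding fdiffs_Suc' by simp
  qed
qed

section \<open>Linear maps on a subspace and Jordan chains\<close>

definition linear_on :: "('k \<Rightarrow> 'v::ab_group_add \<Rightarrow> 'v) \<Rightarrow> 'v set \<Rightarrow> ('v \<Rightarrow> 'v) \<Rightarrow> bool" where
  "linear_on s C f \<longleftrightarrow> (\<forall>x\<in>C. f x \<in> C) \<and> (\<forall>x\<in>C. \<forall>y\<in>C. f (x + y) = f x + f y) \<and> (\<forall>c. \<forall>x\<in>C. f (s c x) = s c (f x))"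

context normed_scalars
begin

lemma linear_onD:
  assumes "linear_on s C f" 
  shows "x \<in> C \<Longrightarrow> f x \<in> C" "x \<in> C \<Longrightarrow> y \<in> C \<Longrightarrow> f (x + y) = f x + f y" "x \<in> C \<Longrightarrow> f (c \<odot> x) = c \<odot> f x"
  using assms unfolding linear_on_def by auto

lemma linear_on_zero: "linear_on s C f \<Longrightarrow> subspace C \<Longrightarrow> f 0 = 0"
  using linear_onD(2)[of C f 0 0] subspace_0 by force

lemma linear_on_diff: "linear_on s C f \<Longrightarrow> subspace C \<Longrightarrow> x \<in> C \<Longrightarrow> y \<in> C \<Longrightarrow> f (x - y) = f x - f y"
  using linear_onD(2)[of C f "x - y" y] subspace_diff[of C x y] by simp

lemma linear_on_sum:
  assumes "linear_on s C f" "subspace C" "\<And>i. i \<in> A \<Longrightarrow> g i \<in> C"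
  shows "f (\<Sum>i\<in>A. g i) = (\<Sum>i\<in>A. f (g i))"
  using assms(3)
proof (induction A rule: infinite_finite_induct)
  case (insert a A)
  have "f (g a + sum g A) = f (g a) + f (sum g A)"
    by (rule linear_onD(2)[OF assms(1)]) (use insert in \<open>auto intro: subspace_sum[OF assms(2)]\<close>)
  then show ?case using insert by simp
qed (simp_all add: linear_on_zero[OF assms(1,2)])

lemma linear_on_funpow: "linear_on s C f \<Longrightarrow> linear_on s C (f ^^ n)"
  by (induction n) (simp_all add: linear_on_def)

text \<open>\<open>T\<close> minus the identity shifts the chain down, so on the coefficients it
  acts as \<open>fdiff\<close>. Adding the difference to the coefficient at \<open>z\<close> yields
  the coefficient at \<open>z + 1\<close>.\<close>

lemma jordan_chain_power:
  assumes T: "linear_on s C T" and C: "subspace C" and b: "\<And>i. i < n \<Longrightarrow> b i \<in> C"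
    and T0: "T (b 0) = b 0" and TS: "\<And>i. Suc i < n \<Longrightarrow> T (b (Suc i)) = b (Suc i) + b i"
    and f: "\<And>z. fdiffs n f z = 0"
  shows "(T ^^ K) (\<Sum>i<n. fdiffs i f z \<odot> b i) = (\<Sum>i<n. fdiffs i f (z + K) \<odot> b i)"
proof -
  have bC: "x \<odot> b i \<in> C" if "i < n" for x i using b[OF that] by (rule subspace_scale[OF C])
  have step: "T (\<Sum>i<n. fdiffs i f z \<odot> b i) = (\<Sum>i<n. fdiffs i f (Suc z) \<odot> b i)" for z
  proof -
    \<comment> \<open>Summation by parts with a boundary term, which disappears at
      \<open>m = n\<close> because the \<open>n\<close>-th difference is 0.\<close>
    have "(\<Sum>i<m. fdiffs i f z \<odot> T (b i)) + (if m = 0 then 0 else fdiffs m f z \<odot> b (m - 1)) = (\<Sum>i<m. fdiffs i f (Suc z) \<odot> b i)"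
      if "m \<le> n" for m
      using that
    proof (induction m)
      case (Suc m)
      then have IH: "(\<Sum>i<m. fdiffs i f z \<odot> T (b i)) + (if m = 0 then 0 else fdiffs m f z \<odot> b (m - 1)) = (\<Sum>i<m. fdiffs i f (Suc z) \<odot> b i)" by simp
      have Tb: "T (b m) = b m + (if m = 0 then 0 else b (m - 1))"
        using T0 TS[of "m - 1"] Suc.prems by (cases m) auto
      have S: "fdiffs m f (Suc z) = fdiffs m f z + fdiffs (Suc m) f z" by (simp add: fdiff_def)
      show ?case unfolding sum.lessThan_Suc IH[symmetric] Tb S
        by (auto simp: scale_left_distrib scale_right_distrib algebra_simps)
    qed simp
    from this[of n] have "(\<Sum>i<n. fdiffs i f z \<odot> T (b i)) = (\<Sum>i<n. fdiffs i f (Suc z) \<odot> b i)"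
      using f by (cases "n = 0") simp_all
    moreover have "T (\<Sum>i<n. fdiffs i f z \<odot> b i) = (\<Sum>i<n. fdiffs i f z \<odot> T (b i))"
      using linear_on_sum[OF T C, of "{..<n}" "\<lambda>i. fdiffs i f z \<odot> b i"] bC linear_onD(3)[OF T b] by simp
    ultimately show ?thesis by simp
  qed
  show ?thesis by (induction K) (simp_all add: step)
qed

text \<open>On a Jordan chain of length \<open>2 d\<close> for the eigenvalue one, \<open>T\<close> acts like the translation of
  polynomials of degree less than \<open>2 d\<close>, written in the basis of binomial coefficients.\<close>

lemma jordan_chain_steering:
  assumes T: "linear_on s C T" and C: "subspace C" and b: "\<And>i. i < 2 * d \<Longrightarrow> b i \<in> C"
    and T0: "T (b 0) = b 0" and TS: "\<And>i. Suc i < 2 * d \<Longrightarrow> T (b (Suc i)) = b (Suc i) + b i"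
    and j: "j < d"
  shows "\<exists>a a' :: nat \<Rightarrow> nat \<Rightarrow> 'k. (\<forall>i. (\<lambda>K. a K i) \<longlonglongrightarrow> 0) \<and> (\<forall>i. (\<lambda>K. a' K i) \<longlonglongrightarrow> 0) \<and>
    (\<forall>K>d. (T ^^ K) (\<alpha> \<odot> b j + (\<Sum>i\<in>{d..<2 * d}. a K i \<odot> b i)) = \<beta> \<odot> b j + (\<Sum>i\<in>{d..<2 * d}. a' K i \<odot> b i))"
proof -
  \<comment> \<open>The polynomials of the single chain vectors \<open>\<alpha> \<odot> b j\<close>
    and \<open>\<beta> \<odot> b j\<close>. The coefficients below \<open>d\<close> depend only on
    the interpolated values and are exact; those from \<open>d\<close> on tend to the differences of
    \<open>X\<close> and \<open>Y\<close> of order at least \<open>d > j\<close>, which are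
    0.\<close>
  define X where "X m = \<alpha> * of_nat (m choose j)" for m
  define Y where "Y m = \<beta> * of_nat (m choose j)" for m
  have dX: "fdiffs i X 0 = (if i = j then \<alpha> else 0)" and dY: "fdiffs i Y 0 = (if i = j then \<beta> else 0)" for i
    unfolding X_def Y_def fdiffs_mult fdiffs_choose by auto
  have XY: "(\<Sum>i<d. fdiffs i X 0 * of_nat (m choose i)) = X m" "(\<Sum>i<d. fdiffs i Y 0 * of_nat (m choose i)) = Y m" for m
    unfolding dX dY using j by (simp_all add: if_distrib[of "\<lambda>x. x * _"] X_def Y_def cong: if_cong)
  obtain q where q': "\<forall>K z. fdiffs (2 * d) (q K) z = 0"
    "\<forall>K m. K > d \<longrightarrow> m < d \<longrightarrow> q K m = X m \<and> q K (K + m) = Y m"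
    "\<forall>m. (\<lambda>K. q K m) \<longlonglongrightarrow> X m" "\<forall>m. (\<lambda>K. q K (K + m)) \<longlonglongrightarrow> Y m"
    using interpolating_sequence[of d X Y] unfolding XY by blast
  then have q: "\<And>K z. fdiffs (2 * d) (q K) z = 0"
    "\<And>K m. K > d \<Longrightarrow> m < d \<Longrightarrow> q K m = X m" "\<And>K m. K > d \<Longrightarrow> m < d \<Longrightarrow> q K (K + m) = Y m"
    "\<And>m. (\<lambda>K. q K m) \<longlonglongrightarrow> X m" "\<And>m. (\<lambda>K. q K (K + m)) \<longlonglongrightarrow> Y m" by simp_all
  define a where "a K i = (if i \<in> {d..<2 * d} then fdiffs i (q K) 0 else 0)" for K i
  define a' where "a' K i = (if i \<in> {d..<2 * d} then fdiffs i (q K) K else 0)" for K i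
  show ?thesis
  proof (rule exI[of _ a], rule exI[of _ a'], intro conjI allI impI)
    have "(\<lambda>K. fdiffs i (q K) 0) \<longlonglongrightarrow> fdiffs i X 0" for i by (rule tendsto_fdiffs) (rule q(4))
    moreover have "fdiffs i X 0 = 0" if "i \<ge> d" for i using that j by (simp add: dX)
    ultimately have lim_a: "(\<lambda>K. fdiffs i (q K) 0) \<longlonglongrightarrow> 0" if "i \<ge> d" for i using that by (metis (no_types))
    show "(\<lambda>K. a K i) \<longlonglongrightarrow> 0" for i
    proof (cases "i \<in> {d..<2 * d}")
      case False
      then have "(\<lambda>K. a K i) = (\<lambda>_. 0)" by (auto simp: a_def)
      then show ?thesis by simp
    next
      case True
      then show ?thesis using lim_a by (simp add: a_def)
    qed
    have "(\<lambda>K. fdiffs i (\<lambda>m. q K (K + m)) 0) \<longlonglongrightarrow> fdiffs i Y 0" for i by (rule tendsto_fdiffs) (rule q(5))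
    then have "(\<lambda>K. fdiffs i (q K) K) \<longlonglongrightarrow> fdiffs i Y 0" for i unfolding fdiffs_shift by simp
    moreover have "fdiffs i Y 0 = 0" if "i \<ge> d" for i using that j by (simp add: dY)
    ultimately have lim_a2: "(\<lambda>K. fdiffs i (q K) K) \<longlonglongrightarrow> 0" if "i \<ge> d" for i using that by (metis (no_types))
    show "(\<lambda>K. a' K i) \<longlonglongrightarrow> 0" for i
    proof (cases "i \<in> {d..<2 * d}")
      case False
      then have "(\<lambda>K. a' K i) = (\<lambda>_. 0)" by (auto simp: a'_def)
      then show ?thesis by simp
    next
      case True
      then show ?thesis using lim_a2 by (simp add: a'_def)
    qed
    fix K assume K: "K > d"
    have split: "(\<Sum>i<2 * d. c i \<odot> b i) = (\<Sum>i<d. c i \<odot> b i) + (\<Sum>i\<in>{d..<2 * d}. c i \<odot> b i)" for c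
    proof -
      have "{..<2 * d} = {..<d} \<union> {d..<2 * d}" by auto
      then show ?thesis by (simp add: sum.union_disjoint ivl_disj_int)
    qed
    have l: "(\<Sum>i<d. (if i = j then c else 0) \<odot> b i) = c \<odot> b j" for c
    proof -
      have "(\<Sum>i<d. (if i = j then c else 0) \<odot> b i) = (\<Sum>i<d. if i = j then c \<odot> b i else 0)" by (rule sum.cong) auto
      then show ?thesis using j by simp
    qed
    have 0: "fdiffs i (q K) 0 = (if i = j then \<alpha> else 0)" if "i < d" for i
      unfolding dX[symmetric] by (rule fdiffs_cong) (use q(2)[OF K] that in auto)
    have 1: "fdiffs i (q K) K = (if i = j then \<beta> else 0)" if "i < d" for i
    proof -
      have "fdiffs i (q K) K = fdiffs i (\<lambda>m. q K (K + m)) 0" unfolding fdiffs_shift by simp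
      also have "\<dots> = fdiffs i Y 0" by (rule fdiffs_cong) (use q(3)[OF K] that in auto)
      finally show ?thesis by (simp add: dY)
    qed
    have "(\<Sum>i<2 * d. fdiffs i (q K) 0 \<odot> b i) = \<alpha> \<odot> b j + (\<Sum>i\<in>{d..<2 * d}. a K i \<odot> b i)"
      unfolding split l[symmetric] using 0 by (simp add: a_def)
    moreover have "(\<Sum>i<2 * d. fdiffs i (q K) (0 + K) \<odot> b i) = \<beta> \<odot> b j + (\<Sum>i\<in>{d..<2 * d}. a' K i \<odot> b i)"
      unfolding split l[symmetric] using 1 by (simp add: a'_def)
    ultimately show "(T ^^ K) (\<alpha> \<odot> b j + (\<Sum>i\<in>{d..<2 * d}. a K i \<odot> b i)) = \<beta> \<odot> b j + (\<Sum>i\<in>{d..<2 * d}. a' K i \<odot> b i)"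
      using jordan_chain_power[where T = T and C = C and b = b and n = "2 * d" and f = "q K" and K = K and z = 0, OF T C b T0 TS q(1)] by simp
  qed
qed

end

section \<open>Finitely many infinite-dimensional summands\<close>

text \<open>Purely algebraic. Continuity follows later from vanishing on the sum of the
  infinite-dimensional summands.\<close>

lemma (in normed_scalars) separating_functional:
  assumes W: "subspace W" and z: "z \<notin> W"
  obtains g where "linear_functional s g" "\<And>w. w \<in> W \<Longrightarrow> g w = 0" "g z = 1"
proof -
  interpret k: vector_space "(*) :: 'k \<Rightarrow> 'k \<Rightarrow> 'k" by unfold_locales (simp_all add: algebra_simps)
  interpret vp: vector_space_pair s "(*) :: 'k \<Rightarrow> 'k \<Rightarrow> 'k" by unfold_locales
  obtain B where B: "B \<subseteq> W" "independent B" "W \<subseteq> span B" using maximal_independent_subset by blast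
  have "z \<notin> span B" using z span_minimal[OF B(1) W] by blast
  then have "independent (insert z B)" using B(2) independent_insertI by blast
  from vp.linear_independent_extend[OF this, of "\<lambda>b. if b = z then 1 else 0"]
  obtain g where g: "Vector_Spaces.linear s (*) g" "\<forall>b\<in>insert z B. g b = (if b = z then 1 else 0)" by blast
  have lf: "linear_functional s g" using g(1) by (simp add: linear_functional_def Vector_Spaces.linear_iff)
  have "g w = 0" if "w \<in> span B" for w
    using that
  proof (induction rule: span_induct_alt)
    case (step c b y)
    then have "b \<noteq> z" using z B(1) by blast
    then show ?case using step g(2) by (simp add: linear_functionalD[OF lf])
  qed (simp add: linear_functionalD[OF lf])
  then show ?thesis using g(2) B(3) by (intro that[OF lf]) auto
qed

section \<open>Supports of vectors and operators on the direct sum\<close>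

context lc_family
begin

text \<open>The \<open>r i\<close> may be chosen independently of one another, however fast they
  grow: finite support keeps every value finite.\<close>

lemma sum_seminorm:
  assumes r: "\<And>i. cont_seminorm s (X i) (r i)"
  shows "cont_seminorm (dsum_scale s) DT (\<lambda>f. \<Sum>i | f i \<noteq> 0. r i (f i))"
  unfolding cont_seminorm_DT_iff
proof (intro conjI allI)
  let ?R = "\<lambda>f. \<Sum>i | f i \<noteq> 0. r i (f i)"
  have R: "?R f = (\<Sum>i\<in>A. r i (f i))" if "finite A" "{i. f i \<noteq> 0} \<subseteq> A" for f A
    by (rule sum.mono_neutral_left) (use that cont_seminorm_0[OF lc r] in auto)
  have fin: "finite {i. f i \<noteq> 0}" if "f \<in> C" for f using that by (simp add: dsum_carrier_def)
  show "seminorm_on (dsum_scale s) C ?R"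
    unfolding seminorm_on_def
  proof (intro conjI ballI allI)
    fix f g assume fg: "f \<in> C" "g \<in> C"
    let ?A = "{i. f i \<noteq> 0} \<union> {i. g i \<noteq> 0}"
    have A: "finite ?A" using fin fg by simp
    have "?R (f + g) = (\<Sum>i\<in>?A. r i (f i + g i))" by (subst R[OF A]) auto
    also have "\<dots> \<le> (\<Sum>i\<in>?A. r i (f i) + r i (g i))"
      by (intro sum_mono seminorm_add[OF cont_seminorm_on[OF lc r]] coord_in_X fg)
    also have "\<dots> = ?R f + ?R g" using R[OF A, of f] R[OF A, of g] by (simp add: sum.distrib)
    finally show "?R (f + g) \<le> ?R f + ?R g" .
  next
    fix c f assume f: "f \<in> C"
    have "?R (dsum_scale s c f) = (\<Sum>i | f i \<noteq> 0. r i (c \<odot> f i))"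
      by (subst R[OF fin[OF f]]) (auto simp: dsum_scale_def)
    also have "\<dots> = norm c * ?R f"
      unfolding sum_distrib_left by (intro sum.cong seminorm_scale[OF cont_seminorm_on[OF lc r]] coord_in_X f refl)
    finally show "?R (dsum_scale s c f) = norm c * ?R f" .
  qed
  fix i
  have "?R (dsum_inj i x) = r i x" for x
  proof -
    have "{j. dsum_inj i x j \<noteq> 0} \<subseteq> {i}" by (auto simp: dsum_inj_def)
    then show ?thesis using R[of "{i}" "dsum_inj i x"] by simp
  qed
  then show "cont_seminorm s (X i) (\<lambda>x. ?R (dsum_inj i x))" using r by simp
qed

definition supported :: "'i set \<Rightarrow> ('i \<Rightarrow> 'v) set" where
  "supported M = {f \<in> C. \<forall>i. i \<notin> M \<longrightarrow> f i = 0}"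

lemma supported_decompose: "finite M \<Longrightarrow> f \<in> supported M \<Longrightarrow> f = (\<Sum>i\<in>M. dsum_inj i (f i))"
  by (rule dsum_decompose) (auto simp: supported_def)

lemma subspace_supported: "d.subspace (supported M)"
  using subspace_C unfolding supported_def d.subspace_def by (auto simp: dsum_scale_def)

lemma supported_mono: "M \<subseteq> M' \<Longrightarrow> supported M \<subseteq> supported M'"
  unfolding supported_def by auto

lemma inj_supported: "x \<in> topspace (X i) \<Longrightarrow> i \<in> M \<Longrightarrow> dsum_inj i x \<in> supported M"
  unfolding supported_def using inj_in_C[of x i] by (auto simp: dsum_inj_def)

text \<open>If \<open>T\<close> mapped \<open>X n\<close> into infinitely many coordinates, a seminorm on the direct sum could be chosen so
  large on these coordinates that it is not dominated by any \<open>P k\<close> after composition with \<open>T\<close>.\<close>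

lemma operator_on_summand_finite_support:
  assumes T: "linear_on (dsum_scale s) C T" and cont: "continuous_map DT DT T"
    and met: "metrizable_space (X n)"
  shows "finite {i. \<exists>u\<in>topspace (X n). T (dsum_inj n u) i \<noteq> 0}" (is "finite ?S")
proof (rule ccontr)
  assume "infinite ?S"
  then obtain \<sigma> :: "nat \<Rightarrow> 'i" where \<sigma>: "inj \<sigma>" "range \<sigma> \<subseteq> ?S" using infinite_countable_subset by blast
  obtain P where P: "fundamental_seminorms (X n) P" using metrizable_fundamental_seminorms[OF lc met] by blast
  have "\<forall>k. \<exists>u. u \<in> topspace (X n) \<and> T (dsum_inj n u) (\<sigma> k) \<noteq> 0" using \<sigma>(2) by blast
  then obtain u where u: "\<And>k. u k \<in> topspace (X n)" "\<And>k. T (dsum_inj n (u k)) (\<sigma> k) \<noteq> 0" by metis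
  have Tu: "T (dsum_inj n (u k)) \<in> C" for k by (rule d.linear_onD(1)[OF T inj_in_C[OF u(1)]])
  have "\<exists>r. cont_seminorm s (X (\<sigma> k)) r \<and> r (T (dsum_inj n (u k)) (\<sigma> k)) > P k (u k)" for k
  proof -
    obtain q where q: "cont_seminorm s (X (\<sigma> k)) q" "q (T (dsum_inj n (u k)) (\<sigma> k)) > 0"
      using seminorms_separate[OF lc coord_in_X[OF Tu] u(2)] by blast
    let ?a = "q (T (dsum_inj n (u k)) (\<sigma> k))"
    have "(\<bar>P k (u k)\<bar> + 1) / ?a * ?a > P k (u k)" using q(2) by simp
    moreover have "cont_seminorm s (X (\<sigma> k)) (\<lambda>x. (\<bar>P k (u k)\<bar> + 1) / ?a * q x)"
      by (rule cont_seminorm_mult[OF lc q(1)]) (use q(2) in simp)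
    ultimately show ?thesis by (intro exI[of _ "\<lambda>x. (\<bar>P k (u k)\<bar> + 1) / ?a * q x"]) simp
  qed
  then have "\<forall>k. \<exists>r. cont_seminorm s (X (\<sigma> k)) r \<and> r (T (dsum_inj n (u k)) (\<sigma> k)) > P k (u k)" ..
  then obtain r where r: "\<And>k. cont_seminorm s (X (\<sigma> k)) (r k)" "\<And>k. r k (T (dsum_inj n (u k)) (\<sigma> k)) > P k (u k)"
    by metis
  define r' where "r' i = (if i \<in> range \<sigma> then r (inv \<sigma> i) else (\<lambda>_. 0))" for i
  have r'\<sigma>: "r' (\<sigma> k) = r k" for k using \<sigma>(1) by (simp add: r'_def)
  have r': "cont_seminorm s (X i) (r' i)" for i
  proof (cases "i \<in> range \<sigma>")
    case True then show ?thesis using r(1) r'\<sigma> by auto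
  next
    case False then show ?thesis by (simp add: r'_def cont_seminorm_zero[OF lc])
  qed
  let ?q = "\<lambda>f. \<Sum>i | f i \<noteq> 0. r' i (f i)"
  have "\<forall>q. cont_seminorm (dsum_scale s) DT q \<longrightarrow> cont_seminorm (dsum_scale s) DT (\<lambda>x. q (T x))"
    using continuous_linear_iff_seminorms[OF lc_DT lc_DT, of T] cont T
    unfolding topspace_DT linear_on_def by simp
  from this[rule_format, OF sum_seminorm[OF r']]
  have "cont_seminorm (dsum_scale s) DT (\<lambda>f. ?q (T f))" .
  then have "cont_seminorm s (X n) (\<lambda>x. ?q (T (dsum_inj n x)))" by (simp add: cont_seminorm_DT_iff)
  then obtain k where k: "\<forall>x\<in>topspace (X n). ?q (T (dsum_inj n x)) \<le> P k x"
    using P unfolding fundamental_seminorms_def by blast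
  have "r' (\<sigma> k) (T (dsum_inj n (u k)) (\<sigma> k)) \<le> ?q (T (dsum_inj n (u k)))"
    by (rule member_le_sum)
       (use u(2) Tu cont_seminorm_ge0[OF lc r' coord_in_X[OF Tu]] in \<open>auto simp: dsum_carrier_def\<close>)
  then show False using k u(1)[of k] r(2)[of k] r'\<sigma>[of k] by fastforce
qed

lemma operator_finite_support:
  assumes T: "linear_on (dsum_scale s) C T" and cont: "continuous_map DT DT T"
    and met: "\<And>i. metrizable_space (X i)" and M: "finite M"
  obtains M' where "finite M'" "T ` supported M \<subseteq> supported M'"
proof (rule that)
  let ?S = "\<lambda>n. {i. \<exists>u\<in>topspace (X n). T (dsum_inj n u) i \<noteq> 0}"
  show "finite (\<Union>n\<in>M. ?S n)" using M operator_on_summand_finite_support[OF T cont met] by blast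
  show "T ` supported M \<subseteq> supported (\<Union>n\<in>M. ?S n)"
  proof safe
    fix f assume f: "f \<in> supported M"
    then have fC: "f \<in> C" by (simp add: supported_def)
    have "T f = T (\<Sum>n\<in>M. dsum_inj n (f n))" using supported_decompose[OF M f] by simp
    also have "\<dots> = (\<Sum>n\<in>M. T (dsum_inj n (f n)))"
      by (rule d.linear_on_sum[OF T subspace_C]) (rule inj_in_C[OF coord_in_X[OF fC]])
    also have "\<dots> \<in> supported (\<Union>n\<in>M. ?S n)"
    proof (rule d.subspace_sum[OF subspace_supported])
      fix n assume "n \<in> M"
      then show "T (dsum_inj n (f n)) \<in> supported (\<Union>n\<in>M. ?S n)"
        unfolding supported_def using coord_in_X[OF fC, of n] d.linear_onD(1)[OF T inj_in_C[OF coord_in_X[OF fC]]] by blast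
    qed
    finally show "T f \<in> supported (\<Union>n\<in>M. ?S n)" .
  qed
qed

end

lemma (in normed_scalars) linear_on_span_image:
  assumes T: "linear_on s C T" and C: "subspace C" and A: "A \<subseteq> C" and x: "x \<in> span A"
  shows "T x \<in> span (T ` A)"
proof -
  have "x \<in> C \<and> T x \<in> span (T ` A)"
    using x
  proof (induction rule: span_induct_alt)
    case base show ?case using linear_on_zero[OF T C] subspace_0[OF C] span_zero by simp
  next
    case (step c a y)
    then have a: "a \<in> C" "c \<odot> a \<in> C" using A subspace_scale[OF C] by auto
    have "T (c \<odot> a + y) = c \<odot> T a + T y" using linear_onD(2,3)[OF T] a step by simp
    then show ?case using step a by (auto intro: subspace_add[OF C] span_add span_scale span_base)
  qed
  then show ?thesis ..
qed

lemma (in normed_scalars) linear_on_image_subspace: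
  assumes T: "linear_on s C T" and C: "subspace C" and A: "A \<subseteq> C" "subspace A"
  shows "subspace (T ` A)"
proof -
  have "span (T ` A) \<subseteq> T ` A"
  proof
    fix y assume "y \<in> span (T ` A)"
    then show "y \<in> T ` A"
    proof (induction rule: span_induct_alt)
      case base show ?case using linear_on_zero[OF T C] subspace_0[OF A(2)] by force
    next
      case (step c b y)
      then obtain a a' where a: "a \<in> A" "b = T a" "a' \<in> A" "y = T a'" by blast
      have "c \<odot> a \<in> A" by (rule subspace_scale[OF A(2) a(1)])
      then have "c \<odot> b + y = T (c \<odot> a + a')"
        using linear_onD(2,3)[OF T] a A(1) by (simp add: subset_iff)
      then show ?case using subspace_add[OF A(2) \<open>c \<odot> a \<in> A\<close> a(3)] by blast
    qed
  qed
  then show ?thesis using span_superset subspace_span by (metis subset_antisym)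
qed

context lc_family
begin

text \<open>Let \<open>Y\<close> be the sum of the infinite-dimensional summands and \<open>x\<close> a hypercyclic vector. The spaces
  \<open>W 0 = Y + span {x}\<close>, \<open>W (k + 1) = W k + T (W k)\<close> have finite codimension in one another, and these
  codimensions decrease. Once they are constant, \<open>T\<close> is injective from \<open>W (j + 1) / W j\<close> to
  \<open>W (j + 2) / W (j + 1)\<close>, so the orbit, which cannot stay in one \<open>W k\<close>, is eventually linearly independent
  modulo some \<open>W j\<close>. A functional that vanishes on \<open>Y\<close> and is constant on a tail of the orbit is continuous.\<close>

lemma not_hypercyclic:
  assumes hb: "hahn_banach s" and met: "\<And>i. metrizable_space (X i)"
    and fin: "finite {i. \<not> finite_dimensional s (topspace (X i))}" and inf: "infinite (UNIV :: 'i set)"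
  shows "\<not> hypercyclic (dsum_scale s) DT T"
proof
  assume hyp: "hypercyclic (dsum_scale s) DT T"
  let ?N = "{i. \<not> finite_dimensional s (topspace (X i))}"
  have cont: "continuous_map DT DT T" using hyp by (simp add: hypercyclic_def continuous_operator_def)
  have T: "linear_on (dsum_scale s) C T"
    using hyp continuous_map_funspace[OF cont]
    unfolding hypercyclic_def continuous_operator_def linear_on_def topspace_DT by auto
  obtain x where x: "x \<in> C" "DT closure_of {(T ^^ n) x |n. True} = C"
    using hyp by (auto simp: hypercyclic_def topspace_DT)
  have orbC: "(T ^^ n) x \<in> C" for n by (rule d.linear_onD(1)[OF d.linear_on_funpow[OF T] x(1)])
  have dense: "\<exists>n. q ((T ^^ n) x - y) < 1" if "y \<in> C" "cont_seminorm (dsum_scale s) DT q" for y q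
  proof -
    have "{(T ^^ n) x |n. True} \<subseteq> topspace DT" using orbC by (auto simp: topspace_DT)
    from d.dense_iff_seminorms[OF lc_DT this]
    have "\<exists>z\<in>{(T ^^ n) x |n. True}. q (z - y) < 1" using x(2) that unfolding topspace_DT by blast
    then show ?thesis by blast
  qed
  \<comment> \<open>On a finite-dimensional summand every seminorm is continuous; on the others
    \<open>g\<close> is zero.\<close>
  have functional: "cont_seminorm (dsum_scale s) DT (\<lambda>f. norm (g f))"
    if g: "linear_functional (dsum_scale s) g" "\<And>y. y \<in> supported ?N \<Longrightarrow> g y = 0" for g
    unfolding cont_seminorm_DT_iff
  proof (intro conjI allI)
    show "seminorm_on (dsum_scale s) C (\<lambda>f. norm (g f))"
      unfolding seminorm_on_def by (simp add: linear_functionalD[OF g(1)] norm_mult norm_triangle_ineq)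
    fix i
    have sn: "seminorm_on s (topspace (X i)) (\<lambda>x. norm (g (dsum_inj i x)))"
      unfolding seminorm_on_def
      by (simp add: dsum_inj_add inj_scale linear_functionalD[OF g(1)] norm_mult norm_triangle_ineq)
    show "cont_seminorm s (X i) (\<lambda>x. norm (g (dsum_inj i x)))"
    proof (cases "i \<in> ?N")
      case True
      then show ?thesis
        by (intro cont_seminorm_dominated[OF lc sn cont_seminorm_zero[OF lc], of 0]) (simp add: g(2) inj_supported)
    next
      case False
      then show ?thesis by (intro finite_dimensional_cont_seminorm[OF hb lc _ sn]) simp
    qed
  qed
  define W where "W = rec_nat (d.span (supported ?N \<union> {x})) (\<lambda>_ S. {a + T b |a b. a \<in> S \<and> b \<in> S})"
  have W0: "W 0 = d.span (supported ?N \<union> {x})" and WS: "W (Suc k) = {a + T b |a b. a \<in> W k \<and> b \<in> W k}" for k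
    by (simp_all add: W_def)
  have NC: "supported M \<subseteq> C" for M by (auto simp: supported_def)
  have W: "d.subspace (W k) \<and> W k \<subseteq> C" for k
  proof (induction k)
    case 0
    have "supported ?N \<union> {x} \<subseteq> C" using NC x(1) by blast
    then show ?case unfolding W0 using d.span_minimal[OF _ subspace_C] d.subspace_span by blast
  next
    case (Suc k)
    have "W (Suc k) = {a + b |a b. a \<in> W k \<and> b \<in> T ` W k}" unfolding WS by blast
    moreover have "d.subspace {a + b |a b. a \<in> W k \<and> b \<in> T ` W k}"
      by (rule d.subspace_sums) (use d.linear_on_image_subspace[OF T subspace_C] Suc in blast)+
    ultimately have "d.subspace (W (Suc k))" by simp
    moreover have "W (Suc k) \<subseteq> C"
      unfolding WS using Suc d.linear_onD(1)[OF T] by (auto intro!: d.subspace_add[OF subspace_C])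
    ultimately show ?case by blast
  qed
  note Wsub = W[THEN conjunct1] and WC = W[THEN conjunct2, THEN subsetD]
  have W_Suc: "W k \<subseteq> W (Suc k)" and TW: "T ` W k \<subseteq> W (Suc k)" for k
  proof -
    have 0: "0 \<in> W k" "T 0 = 0" using d.subspace_0[OF Wsub] d.linear_on_zero[OF T subspace_C] by auto
    show "W k \<subseteq> W (Suc k)" unfolding WS using 0 by force
    show "T ` W k \<subseteq> W (Suc k)" unfolding WS using 0 by force
  qed
  have W_mono: "W j \<subseteq> W k" if "j \<le> k" for j k
    using that by (induction k rule: dec_induct) (use W_Suc in blast)+
  have YW: "supported ?N \<subseteq> W k" for k
    using W_mono[of 0 k] d.span_superset[of "supported ?N \<union> {x}"] unfolding W0 by auto
  have orbW: "(T ^^ n) x \<in> W n" for n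
  proof (induction n)
    case 0 show ?case unfolding W0 by (auto intro: d.span_base)
  next
    case (Suc n) then show ?case using TW[of n] by auto
  qed
  have Wfin: "\<exists>M. finite M \<and> W k \<subseteq> supported M" for k
  proof (induction k)
    case 0
    have "finite (?N \<union> {i. x i \<noteq> 0})" using fin x(1) by (simp add: dsum_carrier_def)
    moreover have "x \<in> supported (?N \<union> {i. x i \<noteq> 0})" using x(1) by (auto simp: supported_def)
    then have "W 0 \<subseteq> supported (?N \<union> {i. x i \<noteq> 0})"
      unfolding W0 using supported_mono[of ?N "?N \<union> {i. x i \<noteq> 0}"]
      by (intro d.span_minimal subspace_supported) auto
    ultimately show ?case by blast
  next
    case (Suc k)
    then obtain M where M: "finite M" "W k \<subseteq> supported M" by blast
    obtain M' where M': "finite M'" "T ` supported M \<subseteq> supported M'"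
      using operator_finite_support[OF T cont met M(1)] by blast
    have "a + T b \<in> supported (M \<union> M')" if "a \<in> W k" "b \<in> W k" for a b
    proof (rule d.subspace_add[OF subspace_supported])
      show "a \<in> supported (M \<union> M')" using that(1) M(2) supported_mono[of M "M \<union> M'"] by blast
      show "T b \<in> supported (M \<union> M')" using that(2) M(2) M'(2) supported_mono[of M' "M \<union> M'"] by blast
    qed
    then have "W (Suc k) \<subseteq> supported (M \<union> M')" unfolding WS by blast
    then show ?case using M(1) M'(1) by blast
  qed
  \<comment> \<open>\<open>W k\<close> is supported in finitely many coordinates. A vector in a
    further summand can be separated from it by a functional that vanishes on \<open>W k\<close>,
    hence on \<open>Y\<close>, and is therefore continuous, contrary to density.\<close>
  have leave: "\<exists>n. (T ^^ n) x \<notin> W k" for k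
  proof (rule ccontr)
    assume "\<not> ?thesis"
    then have orb: "(T ^^ n) x \<in> W k" for n by blast
    obtain M where M: "finite M" "W k \<subseteq> supported M" using Wfin by blast
    obtain i where i: "i \<notin> M" using ex_new_if_finite[OF inf M(1)] by blast
    obtain u where u: "u \<in> topspace (X i)" "u \<noteq> 0" using tvs_facts(3)[OF lc[of i]] zero_in_topspace[OF lc[of i]] by blast
    have "dsum_inj i u \<notin> W k" using M(2) i u(2) dsum_inj_same[of i u] unfolding supported_def by force
    then obtain g where g: "linear_functional (dsum_scale s) g" "\<And>w. w \<in> W k \<Longrightarrow> g w = 0" "g (dsum_inj i u) = 1"
      using d.separating_functional[OF Wsub] by blast
    have "cont_seminorm (dsum_scale s) DT (\<lambda>f. norm (g f))" using functional[OF g(1)] g(2) YW by blast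
    then obtain n where "norm (g ((T ^^ n) x - dsum_inj i u)) < 1" using dense[OF inj_in_C[OF u(1)]] by blast
    then show False using g(2)[OF orb[of n]] g(3) by (simp add: linear_functionalD[OF g(1)])
  qed
  \<comment> \<open>\<open>B\<close> generates \<open>W (k + 1)\<close> modulo \<open>W k\<close>;
    its least size is the codimension.\<close>
  define gen where "gen k B \<longleftrightarrow> finite B \<and> B \<subseteq> C \<and> W (Suc k) \<subseteq> d.span (W k \<union> B)" for k B
  have "\<exists>B. gen 0 B"
  proof -
    obtain M where M: "finite M" "T ` supported ?N \<subseteq> supported M"
      using operator_finite_support[OF T cont met fin] by blast
    have "\<forall>i. \<exists>B. i \<notin> ?N \<longrightarrow> finite B \<and> span B = topspace (X i)" by (auto simp: finite_dimensional_def)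
    then obtain b where b: "\<And>i. i \<notin> ?N \<Longrightarrow> finite (b i) \<and> span (b i) = topspace (X i)" by metis
    \<comment> \<open>The image of \<open>Y\<close> meets only the summands in \<open>M\<close>. The
      infinite-dimensional ones lie in \<open>W 0\<close>; finite spanning sets of the others,
      together with \<open>T x\<close>, generate the rest.\<close>
    define B where "B = insert (T x) (\<Union>i\<in>M - ?N. dsum_inj i ` b i)"
    have bX: "b i \<subseteq> topspace (X i)" if "i \<notin> ?N" for i using b[OF that] span_superset by blast
    have B: "finite B" "B \<subseteq> C" unfolding B_def using M(1) b inj_in_C[OF subsetD[OF bX]] d.linear_onD(1)[OF T x(1)] by auto
    let ?S = "d.span (W 0 \<union> B)"
    have inj_span: "dsum_inj i u \<in> ?S" if "i \<in> M - ?N" "u \<in> span (b i)" for i u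
      using that(2)
    proof (induction rule: span_induct_alt)
      case base show ?case by (simp only: dsum_inj_zero d.span_zero)
    next
      case (step c a y)
      have "dsum_inj i a \<in> B" unfolding B_def using that(1) step(1) by blast
      then show ?case unfolding dsum_inj_add inj_scale
        by (intro d.span_add d.span_scale step.IH) (auto intro: d.span_base)
    qed
    have "supported M \<subseteq> ?S"
    proof
      fix f assume f: "f \<in> supported M"
      then have fC: "f \<in> C" by (simp add: supported_def)
      have "(\<Sum>i\<in>M. dsum_inj i (f i)) \<in> ?S"
      proof (rule d.span_sum)
        fix i assume i: "i \<in> M"
        show "dsum_inj i (f i) \<in> ?S"
        proof (cases "i \<in> ?N")
          case True
          have "dsum_inj i (f i) \<in> W 0" by (rule subsetD[OF YW inj_supported[OF coord_in_X[OF fC] True]])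
          then show ?thesis by (intro d.span_base UnI1)
        next
          case False
          then have "f i \<in> span (b i)" using b[OF False] coord_in_X[OF fC] by simp
          then show ?thesis using i False by (intro inj_span) auto
        qed
      qed
      then show "f \<in> ?S" using supported_decompose[OF M(1) f] by (simp only:)
    qed
    then have "T ` supported ?N \<subseteq> ?S" using M(2) by (rule order_trans[rotated])
    moreover have "T x \<in> ?S" by (intro d.span_base UnI2) (simp add: B_def)
    ultimately have "T ` (supported ?N \<union> {x}) \<subseteq> ?S" by (simp add: image_Un)
    then have "d.span (T ` (supported ?N \<union> {x})) \<subseteq> ?S" by (rule d.span_minimal) (rule d.subspace_span)
    moreover have "T b \<in> d.span (T ` (supported ?N \<union> {x}))" if "b \<in> W 0" for b
      by (rule d.linear_on_span_image[OF T subspace_C _ that[unfolded W0]]) (use NC x(1) in auto)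
    ultimately have "T b \<in> ?S" if "b \<in> W 0" for b using that by blast
    moreover have "a \<in> ?S" if "a \<in> W 0" for a using that by (intro d.span_base UnI1)
    ultimately have "W (Suc 0) \<subseteq> ?S" unfolding WS by (auto intro: d.span_add)
    then show ?thesis using B unfolding gen_def by blast
  qed
  then have "\<exists>n k B. gen k B \<and> card B = n" by blast
  \<comment> \<open>The least size over all levels. Since \<open>T\<close> maps generators of one
    level to generators of the next, it is attained at every level from \<open>k\<close> on.\<close>
  define n0 where "n0 = (LEAST n. \<exists>k B. gen k B \<and> card B = n)"
  have "\<exists>k B. gen k B \<and> card B = n0" unfolding n0_def by (rule LeastI_ex) fact
  then obtain k B0 where kB: "gen k B0" "card B0 = n0" by blast
  have n0_le: "n0 \<le> card B" if "gen j B" for j B unfolding n0_def by (rule Least_le) (use that in blast)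
  have gen_step: "T b' \<in> S" if "gen j B" "T ` B \<subseteq> S" "W (Suc j) \<subseteq> S" "d.subspace S" "b' \<in> W (Suc j)" for j B S b'
  proof -
    have "b' \<in> d.span (W j \<union> B)" using that(1,5) unfolding gen_def by blast
    then have "T b' \<in> d.span (T ` (W j \<union> B))"
      by (rule d.linear_on_span_image[OF T subspace_C, rotated]) (use that(1) WC in \<open>auto simp: gen_def\<close>)
    moreover have "d.span (T ` (W j \<union> B)) \<subseteq> S"
      by (rule d.span_minimal[OF _ that(4)]) (use that(2,3) TW[of j] in auto)
    ultimately show ?thesis by blast
  qed
  have gen_Suc: "gen (Suc j) B'" 
    if "gen j B" "finite B'" "B' \<subseteq> C" "T ` B \<subseteq> d.span (W (Suc j) \<union> B')" for j B B'
  proof -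
    have WS': "W (Suc j) \<subseteq> d.span (W (Suc j) \<union> B')" using d.span_superset by blast
    have "a + T b' \<in> d.span (W (Suc j) \<union> B')" if "a \<in> W (Suc j)" "b' \<in> W (Suc j)" for a b'
      using gen_step[OF \<open>gen j B\<close> \<open>T ` B \<subseteq> _\<close> WS' d.subspace_span that(2)] that(1) WS' by (intro d.span_add) auto
    then show ?thesis unfolding gen_def WS[of "Suc j"] using that by blast
  qed
  have ex_gen: "\<exists>B. gen j B \<and> card B = n0" if "j \<ge> k" for j
    using that
  proof (induction j rule: dec_induct)
    case base then show ?case using kB by blast
  next
    case (step j)
    then obtain B where B: "gen j B" "card B = n0" by blast
    have TB: "finite (T ` B)" "T ` B \<subseteq> C" using B(1) d.linear_onD(1)[OF T] by (auto simp: gen_def)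
    have "gen (Suc j) (T ` B)" by (rule gen_Suc[OF B(1) TB]) (auto intro: d.span_base)
    moreover have "card (T ` B) \<le> n0" using card_image_le[of B T] B by (auto simp: gen_def)
    ultimately show ?case using n0_le by force
  qed
  \<comment> \<open>Injectivity of \<open>T\<close> between successive quotients. If
    \<open>T u\<close> fell into \<open>W (j + 1)\<close>, a non-trivial combination of the images
    of the generators would too; one image could then be dropped, against the minimality of
    \<open>n0\<close>.\<close>
  have escape: "T u \<notin> W (Suc j)" if j: "j \<ge> k" and u: "u \<in> W (Suc j)" "u \<notin> W j" for j u
  proof
    assume Tu: "T u \<in> W (Suc j)"
    obtain B where B: "gen j B" "card B = n0" using ex_gen[OF j] by blast
    have BC: "finite B" "B \<subseteq> C" using B(1) by (auto simp: gen_def)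
    have "u \<in> d.span (W j \<union> B)" using B(1) u(1) by (auto simp: gen_def)
    then obtain y w where yw: "u = y + w" "y \<in> W j" "w \<in> d.span B"
      unfolding d.span_Un d.span_eq_iff[THEN iffD2, OF Wsub] by blast
    obtain c where c: "w = (\<Sum>b\<in>B. dsum_scale s (c b) b)" using yw(3) d.span_finite[OF BC(1)] by auto
    obtain b0 where b0: "b0 \<in> B" "c b0 \<noteq> 0"
    proof (rule ccontr)
      assume "\<not> thesis"
      then have "\<And>b. b \<in> B \<Longrightarrow> c b = 0" using that by blast
      then have "w = 0" using c by (simp add: d.scale_zero_left)
      then show False using yw u(2) by simp
    qed
    let ?B' = "T ` (B - {b0})"
    let ?S = "d.span (W (Suc j) \<union> ?B')"
    have sum: "T w = (\<Sum>b\<in>B. dsum_scale s (c b) (T b))"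
    proof -
      have "T w = (\<Sum>b\<in>B. T (dsum_scale s (c b) b))"
        unfolding c by (rule d.linear_on_sum[OF T subspace_C]) (use BC d.subspace_scale[OF subspace_C] in blast)
      then show ?thesis using d.linear_onD(3)[OF T] BC(2) by (simp add: subset_iff)
    qed
    have wC: "w \<in> C" using yw(3) d.span_minimal[OF BC(2) subspace_C] by blast
    have "T u = T y + T w" unfolding yw(1) by (rule d.linear_onD(2)[OF T WC[OF yw(2)] wC])
    then have "T w = T u - T y" by simp
    moreover have "T y \<in> W (Suc j)" using TW yw(2) by blast
    ultimately have Tw: "T w \<in> W (Suc j)" using d.subspace_diff[OF Wsub Tu] by simp
    have rest: "(\<Sum>b\<in>B - {b0}. dsum_scale s (c b) (T b)) \<in> ?S"
      by (intro d.span_sum d.span_scale) (auto intro: d.span_base)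
    have "dsum_scale s (c b0) (T b0) = T w - (\<Sum>b\<in>B - {b0}. dsum_scale s (c b) (T b))"
      unfolding sum using sum.remove[OF BC(1) b0(1), of "\<lambda>b. dsum_scale s (c b) (T b)"]
      by (simp only: add_diff_cancel_right')
    also have "\<dots> \<in> ?S" by (rule d.span_diff[OF d.span_base[OF UnI1[OF Tw]] rest])
    finally have "dsum_scale s (inverse (c b0)) (dsum_scale s (c b0) (T b0)) \<in> ?S" by (rule d.span_scale)
    then have Tb0: "T b0 \<in> ?S" by (simp only: d.scale_scale left_inverse[OF b0(2)] d.scale_one)
    have "gen (Suc j) ?B'"
    proof (rule gen_Suc[OF B(1)])
      show "finite ?B'" "?B' \<subseteq> C" using BC d.linear_onD(1)[OF T] by auto
      have "T b \<in> ?S" if "b \<in> B" for b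
        using that Tb0 by (cases "b = b0") (auto intro!: d.span_base)
      then show "T ` B \<subseteq> ?S" by blast
    qed
    moreover have "card ?B' < n0"
    proof -
      have "card ?B' \<le> card (B - {b0})" using BC(1) by (intro card_image_le) simp
      also have "\<dots> < card B" by (rule card_Diff1_less[OF BC(1) b0(1)])
      finally show ?thesis using B(2) by simp
    qed
    ultimately show False using n0_le by force
  qed
  obtain N where N: "(T ^^ N) x \<notin> W k" using leave by blast
  define z where "z n = (T ^^ (N + n)) x" for n
  have zS: "z (Suc n) = T (z n)" for n by (simp add: z_def)
  \<comment> \<open>\<open>z 0\<close> is outside \<open>W k\<close>, so the level that it enters
    first is above \<open>k\<close>. By \<open>escape\<close> each further application of
    \<open>T\<close> then raises the level by exactly one.\<close>
  obtain j where j: "j \<ge> k" "z 0 \<in> W (Suc j)" "z 0 \<notin> W j"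
  proof -
    define m where "m = (LEAST m. z 0 \<in> W m)"
    have "z 0 \<in> W N" using orbW[of N] by (simp add: z_def)
    then have m: "z 0 \<in> W m" "\<And>l. l < m \<Longrightarrow> z 0 \<notin> W l"
      unfolding m_def by (rule LeastI, use not_less_Least in blast)
    have "k < m"
    proof (rule ccontr)
      assume "\<not> k < m"
      then show False using W_mono[of m k] m(1) N by (auto simp: z_def)
    qed
    then show ?thesis using that[of "m - 1"] m by auto
  qed
  have z: "z n \<in> W (Suc (j + n)) \<and> z n \<notin> W (j + n)" for n
  proof (induction n)
    case (Suc n)
    then show ?case using escape[of "j + n" "z n"] TW[of "Suc (j + n)"] j(1) zS by auto
  qed (use j in simp)
  \<comment> \<open>Killing the differences makes a functional constant along \<open>z\<close>. The
    vector \<open>z 0\<close> is not in their span modulo \<open>W j\<close>, because each new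
    difference lies outside the level that contains the previous ones and
    \<open>z 0\<close>.\<close>
  define D where "D n = (\<lambda>i. z (Suc i) - z i) ` {..<n}" for n
  define U where "U n = d.span (W j \<union> D n)" for n
  have UW: "U n \<subseteq> W (Suc (j + n))" for n
    unfolding U_def
  proof (rule d.span_minimal[OF _ Wsub])
    have "z (Suc i) - z i \<in> W (Suc (j + n))" if "i < n" for i
      using that z[of "Suc i"] z[of i] W_mono[of "Suc (j + Suc i)" "Suc (j + n)"] W_mono[of "Suc (j + i)" "Suc (j + n)"]
      by (intro d.subspace_diff[OF Wsub]) auto
    then show "W j \<union> D n \<subseteq> W (Suc (j + n))" using W_mono[of j "Suc (j + n)"] by (auto simp: D_def)
  qed
  have z0U: "z 0 \<notin> U n" for n
  proof (induction n)
    case 0 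
    have "U 0 = W j" unfolding U_def D_def using d.span_eq_iff[THEN iffD2, OF Wsub] by simp
    then show ?case using j(3) by simp
  next
    case (Suc n)
    show ?case
    proof
      assume "z 0 \<in> U (Suc n)"
      moreover have "W j \<union> D (Suc n) = insert (z (Suc n) - z n) (W j \<union> D n)"
        by (auto simp: D_def lessThan_Suc)
      ultimately obtain c where c: "z 0 - dsum_scale s c (z (Suc n) - z n) \<in> U n"
        unfolding U_def by (auto simp: d.span_breakdown_eq)
      have "c \<noteq> 0" using c Suc by (auto simp: d.scale_zero_left)
      let ?V = "W (Suc (j + n))"
      have v: "z 0 - dsum_scale s c (z (Suc n) - z n) \<in> ?V" "z 0 \<in> ?V" "z n \<in> ?V"
        using c UW[of n] z[of n] W_mono[of "Suc j" "Suc (j + n)"] j(2) by auto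
      have "dsum_scale s c (z (Suc n) - z n) \<in> ?V" using d.subspace_diff[OF Wsub v(2,1)] by simp
      then have "dsum_scale s (inverse c) (dsum_scale s c (z (Suc n) - z n)) \<in> ?V" by (rule d.subspace_scale[OF Wsub])
      then have "z (Suc n) - z n \<in> ?V" by (simp only: d.scale_scale left_inverse[OF \<open>c \<noteq> 0\<close>] d.scale_one)
      then have "z (Suc n) - z n + z n \<in> ?V" using v(3) by (rule d.subspace_add[OF Wsub])
      then show False using z[of "Suc n"] by simp
    qed
  qed
  have U_mono: "U m \<subseteq> U n" if "m \<le> n" for m n
    unfolding U_def D_def by (rule d.span_mono) (use that in auto)
  have "d.subspace (\<Union>n. U n)"
    unfolding d.subspace_def
  proof (intro conjI ballI allI)
    show "0 \<in> (\<Union>n. U n)" unfolding U_def using d.span_zero by blast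
    fix a b assume "a \<in> (\<Union>n. U n)" "b \<in> (\<Union>n. U n)"
    then obtain m n where "a \<in> U m" "b \<in> U n" by blast
    then have "a \<in> U (max m n)" "b \<in> U (max m n)" using U_mono[of m "max m n"] U_mono[of n "max m n"] by auto
    then have "a + b \<in> U (max m n)" unfolding U_def by (rule d.span_add)
    then show "a + b \<in> (\<Union>n. U n)" by blast
  next
    fix c a assume "a \<in> (\<Union>n. U n)"
    then show "dsum_scale s c a \<in> (\<Union>n. U n)" unfolding U_def using d.span_scale by blast
  qed
  moreover have "z 0 \<notin> (\<Union>n. U n)" using z0U by blast
  ultimately obtain g where g: "linear_functional (dsum_scale s) g" "\<And>w. w \<in> (\<Union>n. U n) \<Longrightarrow> g w = 0" "g (z 0) = 1"
    using d.separating_functional by blast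
  have gz: "g (z n) = 1" for n
  proof (induction n)
    case (Suc n)
    have "z (Suc n) - z n \<in> D (Suc n)" by (auto simp: D_def)
    then have "z (Suc n) - z n \<in> U (Suc n)" unfolding U_def by (auto intro: d.span_base)
    then have "g (z (Suc n) - z n) = 0" using g(2) by blast
    then show ?case using Suc by (simp add: linear_functionalD[OF g(1)])
  qed (rule g(3))
  have "supported ?N \<subseteq> U 0" unfolding U_def using YW[of j] d.span_superset by blast
  then have gc: "cont_seminorm (dsum_scale s) DT (\<lambda>f. norm (g f))" using functional[OF g(1)] g(2) by blast
  \<comment> \<open>A bound for \<open>g\<close> on the whole orbit: the 1 accounts for the tail,
    where \<open>g\<close> is constantly 1, and the sum for the first \<open>N\<close>
    points.\<close>
  define R where "R = 1 + (\<Sum>i<N. norm (g ((T ^^ i) x)))"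
  have R1: "R \<ge> 1" unfolding R_def by (simp add: sum_nonneg)
  have R: "norm (g ((T ^^ n) x)) \<le> R" for n
  proof (cases "n < N")
    case True
    then have "norm (g ((T ^^ n) x)) \<le> (\<Sum>i<N. norm (g ((T ^^ i) x)))" by (intro member_le_sum) auto
    then show ?thesis by (simp add: R_def)
  next
    case False
    then have "(T ^^ n) x = z (n - N)" by (simp add: z_def)
    then show ?thesis using gz R1 by simp
  qed
  \<comment> \<open>\<open>g\<close> takes the value \<open>R + 1\<close> here, at distance at least
    1 from its values on the orbit.\<close>
  have "dsum_scale s (of_real (R + 1)) (z 0) \<in> C"
    by (rule d.subspace_scale[OF subspace_C]) (use orbC in \<open>simp add: z_def\<close>)
  from dense[OF this gc] obtain n where n: "norm (g ((T ^^ n) x) - of_real (R + 1)) < 1"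
    by (auto simp: linear_functionalD[OF g(1)] g(3))
  have "norm (of_real (R + 1) :: 'k) \<le> norm (g ((T ^^ n) x)) + norm (g ((T ^^ n) x) - of_real (R + 1))"
    using norm_triangle_ineq4[of "g ((T ^^ n) x)" "g ((T ^^ n) x) - of_real (R + 1)"] by simp
  moreover have "norm (of_real (R + 1) :: 'k) = R + 1" using R1 by (simp only: norm_of_real)
  ultimately show False using n R[of n] by linarith
qed

end

section \<open>A hypercyclic perturbation of the identity\<close>

definition cont_op :: "('k::real_normed_field \<Rightarrow> 'v::ab_group_add \<Rightarrow> 'v) \<Rightarrow> 'v topology \<Rightarrow> 'v topology \<Rightarrow> ('v \<Rightarrow> 'v) \<Rightarrow> bool" where
  "cont_op s E T A \<longleftrightarrow> (\<forall>x\<in>topspace E. A x \<in> topspace T) \<and>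
     (\<forall>x\<in>topspace E. \<forall>y\<in>topspace E. A (x + y) = A x + A y) \<and>
     (\<forall>c. \<forall>x\<in>topspace E. A (s c x) = s c (A x)) \<and>
     (\<forall>q. cont_seminorm s T q \<longrightarrow> cont_seminorm s E (\<lambda>x. q (A x)))"

lemma cont_opD:
  assumes "cont_op s E T A"
  shows "x \<in> topspace E \<Longrightarrow> A x \<in> topspace T"
    "x \<in> topspace E \<Longrightarrow> y \<in> topspace E \<Longrightarrow> A (x + y) = A x + A y"
    "x \<in> topspace E \<Longrightarrow> A (s c x) = s c (A x)"
    "cont_seminorm s T q \<Longrightarrow> cont_seminorm s E (\<lambda>x. q (A x))"
  using assms unfolding cont_op_def by auto

context normed_scalars
begin

text \<open>The correction \<open>a\<close> has to stay in \<open>R\<close> under the first \<open>k\<close> powers of \<open>T\<close>: only then does it leave the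
  coordinates outside \<open>R\<close> untouched at the earlier times at which the orbit hits its targets.\<close>

definition steerable :: "('v \<Rightarrow> 'v) \<Rightarrow> 'v set \<Rightarrow> nat \<Rightarrow> ('v \<Rightarrow> real) \<Rightarrow> 'v \<Rightarrow> 'v \<Rightarrow> bool" where
  "steerable T R k p u y \<longleftrightarrow> (\<forall>\<epsilon>>0. \<forall>\<^sub>F K in sequentially. \<exists>a a'.
     (\<forall>i\<le>k. (T ^^ i) a \<in> R) \<and> a' \<in> R \<and> p a < \<epsilon> \<and> p a' < \<epsilon> \<and> (T ^^ K) (u + a) = y + a')"

text \<open>Both vectors must be steered in the same number of steps. This is why
  \<open>steerable\<close> demands all large \<open>K\<close> rather than one.\<close>

lemma steerable_add:
  assumes T: "linear_on s C T" and C: "subspace C" and R: "subspace R" "R \<subseteq> C" and p: "seminorm_on s R p"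
    and u: "u \<in> C" "u' \<in> C" and st: "steerable T R k p u y" "steerable T R k p u' y'"
  shows "steerable T R k p (u + u') (y + y')"
  unfolding steerable_def
proof (intro allI impI)
  fix \<epsilon> :: real assume "\<epsilon> > 0"
  then have e: "\<epsilon> / 2 > 0" by simp
  show "\<forall>\<^sub>F K in sequentially. \<exists>a a'. (\<forall>i\<le>k. (T ^^ i) a \<in> R) \<and> a' \<in> R \<and> p a < \<epsilon> \<and> p a' < \<epsilon> \<and>
     (T ^^ K) (u + u' + a) = y + y' + a'"
    using st(1)[unfolded steerable_def, rule_format, OF e] st(2)[unfolded steerable_def, rule_format, OF e]
  proof eventually_elim
    case (elim K)
    then obtain a a' b b' where ab: "\<forall>i\<le>k. (T ^^ i) a \<in> R" "a' \<in> R" "p a < \<epsilon> / 2" "p a' < \<epsilon> / 2" "(T ^^ K) (u + a) = y + a'"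
      "\<forall>i\<le>k. (T ^^ i) b \<in> R" "b' \<in> R" "p b < \<epsilon> / 2" "p b' < \<epsilon> / 2" "(T ^^ K) (u' + b) = y' + b'" by blast
    have aR: "a \<in> R" "b \<in> R" using ab(1,6)[rule_format, of 0] by simp_all
    then have aC: "a \<in> C" "b \<in> C" using R(2) by auto
    note Tn = linear_on_funpow[OF T]
    show ?case
    proof (rule exI[of _ "a + b"], rule exI[of _ "a' + b'"], intro conjI allI impI)
      show "(T ^^ i) (a + b) \<in> R" if "i \<le> k" for i
        using ab(1,6) that linear_onD(2)[OF Tn aC] subspace_add[OF R(1)] by simp
      show "a' + b' \<in> R" using subspace_add[OF R(1) ab(2,7)] .
      show "p (a + b) < \<epsilon>" "p (a' + b') < \<epsilon>"
        using seminorm_add[OF p aR] seminorm_add[OF p ab(2,7)] ab by linarith+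
      have eq: "u + u' + (a + b) = (u + a) + (u' + b)" by simp
      have "(T ^^ K) (u + u' + (a + b)) = (T ^^ K) (u + a) + (T ^^ K) (u' + b)"
        unfolding eq by (rule linear_onD(2)[OF Tn subspace_add[OF C u(1) aC(1)] subspace_add[OF C u(2) aC(2)]])
      then show "(T ^^ K) (u + u' + (a + b)) = y + y' + (a' + b')" using ab(5,10) by simp
    qed
  qed
qed

lemma steerable_zero:
  assumes "linear_on s C T" "subspace C" "subspace R" "seminorm_on s R p"
  shows "steerable T R k p 0 0"
proof -
  have "(T ^^ n) 0 = 0" for n by (rule linear_on_zero[OF linear_on_funpow[OF assms(1)] assms(2)])
  then show ?thesis
    unfolding steerable_def using subspace_0[OF assms(3)] seminorm_zero[OF assms(4) subspace_0[OF assms(3)]]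
    by (intro allI impI always_eventually exI[of _ 0]) simp
qed

definition has_ancestors :: "('v \<Rightarrow> 'v) \<Rightarrow> 'v set \<Rightarrow> 'v set \<Rightarrow> 'v \<Rightarrow> bool" where
  "has_ancestors N C R g \<longleftrightarrow> (\<exists>h n. h 0 = g \<and> (\<forall>k. h k \<in> C \<and> N (h (Suc k)) = h k) \<and> (\<forall>k\<ge>n. h k \<in> R))"

text \<open>\<open>g\<close> is put in front of the chain of \<open>h\<close>, which is rescaled by
  \<open>inverse c\<close>.\<close>

lemma has_ancestors_step:
  assumes N: "linear_on s C N" and C: "subspace C" and R: "subspace R" 
    and h: "has_ancestors N C R h" and g: "N h = c \<odot> g" "c \<noteq> 0" "g \<in> C"
  shows "has_ancestors N C R g"
proof -
  obtain l n where l: "l 0 = h" "\<And>k. l k \<in> C" "\<And>k. N (l (Suc k)) = l k" "\<And>k. k \<ge> n \<Longrightarrow> l k \<in> R"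
    using h unfolding has_ancestors_def by blast
  define l' where "l' k = (case k of 0 \<Rightarrow> g | Suc k \<Rightarrow> inverse c \<odot> l k)" for k
  show ?thesis
    unfolding has_ancestors_def
  proof (rule exI[of _ l'], rule exI[of _ "Suc n"], intro conjI allI impI)
    show "l' 0 = g" by (simp add: l'_def)
    show "l' k \<in> C" for k using g(3) subspace_scale[OF C l(2)] by (simp add: l'_def split: nat.split)
    have Nl: "N (inverse c \<odot> l k) = inverse c \<odot> N (l k)" for k by (rule linear_onD(3)[OF N l(2)])
    show "N (l' (Suc k)) = l' k" for k
    proof (cases k)
      case 0
      have "N (l' (Suc k)) = inverse c \<odot> N (l 0)" using Nl 0 by (simp add: l'_def)
      also have "\<dots> = g" unfolding l(1) g(1) using g(2) by simp
      finally show ?thesis using 0 by (simp add: l'_def)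
    next
      case (Suc k') then show ?thesis using Nl[of k] l(3) by (simp add: l'_def)
    qed
    show "l' k \<in> R" if "Suc n \<le> k" for k
      using that l(4) subspace_scale[OF R] by (cases k) (simp_all add: l'_def)
  qed
qed

text \<open>The images of \<open>g\<close> under \<open>N\<close> below it and the ancestors above
  it form one Jordan chain with \<open>b j = g\<close>, to which
  \<open>jordan_chain_steering\<close> applies. It is cut off where its upper half lies deep enough
  in \<open>R\<close>.\<close>

lemma steerable_generator:
  assumes N: "linear_on s C N" and C: "subspace C" and R: "subspace R" "R \<subseteq> C" and p: "seminorm_on s R p"
    and T: "\<And>x. T x = x + N x" and nil: "(N ^^ Suc j) g = 0" and anc: "has_ancestors N C R g"
  shows "steerable T R k p (\<alpha> \<odot> g) (\<beta> \<odot> g)"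
proof -
  obtain h n where h: "h 0 = g" "\<And>k. h k \<in> C" "\<And>k. N (h (Suc k)) = h k" "\<And>k. k \<ge> n \<Longrightarrow> h k \<in> R"
    using anc unfolding has_ancestors_def by blast
  have TC: "linear_on s C T"
    using N unfolding linear_on_def T by (auto simp: subspace_add[OF C] scale_right_distrib)
  define b where "b i = (if i < j then (N ^^ (j - i)) g else h (i - j))" for i
  have bC: "b i \<in> C" for i
    using h linear_onD(1)[OF linear_on_funpow[OF N], of g] unfolding b_def by (metis)
  have Nb: "N (b (Suc i)) = b i" for i
  proof -
    consider "Suc i < j" | "Suc i = j" | "i \<ge> j" by linarith
    then show ?thesis
    proof cases
      case 1
      then have "j - i = Suc (j - Suc i)" by simp
      then show ?thesis using 1 by (simp add: b_def)
    next
      case 2 then show ?thesis using h(1) by (auto simp: b_def)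
    next
      case 3 then show ?thesis using h(3) by (simp add: b_def Suc_diff_le)
    qed
  qed
  have N0: "N (b 0) = 0" using nil h(1) by (cases "j = 0") (simp_all add: b_def)
  have TS: "T (b (Suc i)) = b (Suc i) + b i" and T0: "T (b 0) = b 0" for i
    unfolding T using Nb N0 by simp_all
  have bj: "b j = g" using h(1) by (simp add: b_def)
  have bR: "(T ^^ l) (b i) \<in> R" if "i \<ge> j + n + l" for i l
    using that
  proof (induction l arbitrary: i)
    case 0 then show ?case using h(4) by (simp add: b_def)
  next
    case (Suc l)
    then obtain i' where i': "i = Suc i'" by (cases i) auto
    have "(T ^^ Suc l) (b i) = (T ^^ l) (b i + b i')" unfolding i' by (simp only: funpow_Suc_right o_apply TS)
    also have "\<dots> = (T ^^ l) (b i) + (T ^^ l) (b i')" by (rule linear_onD(2)[OF linear_on_funpow[OF TC] bC bC])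
    also have "\<dots> \<in> R" using Suc.prems i' by (intro subspace_add[OF R(1)] Suc.IH) auto
    finally show ?case .
  qed
  \<comment> \<open>\<open>j < d\<close> puts \<open>g\<close> into the lower half. The powers up to
    \<open>k\<close> descend at most \<open>k\<close> places in the chain, so from index
    \<open>d\<close> on they stay among the \<open>b i\<close> with \<open>i \<ge> j + n\<close>,
    which are in \<open>R\<close>.\<close>
  define d where "d = Suc (j + n + k)"
  have jd: "j < d" by (simp add: d_def)
  obtain a a' :: "nat \<Rightarrow> nat \<Rightarrow> 'k" where a: "\<forall>i. (\<lambda>K. a K i) \<longlonglongrightarrow> 0" "\<forall>i. (\<lambda>K. a' K i) \<longlonglongrightarrow> 0"
    "\<forall>K>d. (T ^^ K) (\<alpha> \<odot> b j + (\<Sum>i\<in>{d..<2 * d}. a K i \<odot> b i)) = \<beta> \<odot> b j + (\<Sum>i\<in>{d..<2 * d}. a' K i \<odot> b i)"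
    using jordan_chain_steering[where T = T and C = C and b = b and d = d and j = j and \<alpha> = \<alpha> and \<beta> = \<beta>, OF TC C bC T0 TS jd] by blast
  have small: "\<forall>\<^sub>F K in sequentially. p (\<Sum>i\<in>{d..<2 * d}. e K i \<odot> b i) < \<epsilon>"
    if "\<epsilon> > 0" "\<forall>i. (\<lambda>K. e K i) \<longlonglongrightarrow> 0" for e :: "nat \<Rightarrow> nat \<Rightarrow> 'k" and \<epsilon>
  proof -
    have "(\<lambda>K. \<Sum>i\<in>{d..<2 * d}. norm (e K i) * p (b i)) \<longlonglongrightarrow> (\<Sum>i\<in>{d..<2 * d}. norm (0 :: 'k) * p (b i))"
      using that(2) by (intro tendsto_intros) auto
    then have "(\<lambda>K. \<Sum>i\<in>{d..<2 * d}. norm (e K i) * p (b i)) \<longlonglongrightarrow> 0" by simp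
    then have ev: "\<forall>\<^sub>F K in sequentially. (\<Sum>i\<in>{d..<2 * d}. norm (e K i) * p (b i)) < \<epsilon>"
      using that(1) by (rule order_tendstoD(2))
    have le: "p (\<Sum>i\<in>{d..<2 * d}. e K i \<odot> b i) \<le> (\<Sum>i\<in>{d..<2 * d}. norm (e K i) * p (b i))" for K
    proof -
      have bi: "b i \<in> R" if "i \<in> {d..<2 * d}" for i using bR[of 0 i] that by (simp add: d_def)
      have "p (\<Sum>i\<in>{d..<2 * d}. e K i \<odot> b i) \<le> (\<Sum>i\<in>{d..<2 * d}. p (e K i \<odot> b i))"
        by (rule seminorm_sum[OF p R(1) subspace_scale[OF R(1) bi]])
      also have "\<dots> = (\<Sum>i\<in>{d..<2 * d}. norm (e K i) * p (b i))"
        by (rule sum.cong[OF refl seminorm_scale[OF p bi]])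
      finally show ?thesis .
    qed
    show ?thesis by (rule eventually_mono[OF ev]) (rule le_less_trans[OF le])
  qed
  have inR: "(T ^^ l) (\<Sum>i\<in>{d..<2 * d}. e i \<odot> b i) \<in> R" if "l \<le> k" for l and e :: "nat \<Rightarrow> 'k"
  proof -
    have "(T ^^ l) (\<Sum>i\<in>{d..<2 * d}. e i \<odot> b i) = (\<Sum>i\<in>{d..<2 * d}. e i \<odot> (T ^^ l) (b i))"
      using linear_on_sum[OF linear_on_funpow[OF TC] C, of "{d..<2 * d}" "\<lambda>i. e i \<odot> b i"] subspace_scale[OF C bC]
        linear_onD(3)[OF linear_on_funpow[OF TC] bC] by simp
    also have "\<dots> \<in> R" using that by (intro subspace_sum[OF R(1)] subspace_scale[OF R(1)] bR) (auto simp: d_def)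
    finally show ?thesis .
  qed
  show ?thesis
    unfolding steerable_def
  proof (intro allI impI)
    fix \<epsilon> :: real assume e: "\<epsilon> > 0"
    show "\<forall>\<^sub>F K in sequentially. \<exists>a a'. (\<forall>i\<le>k. (T ^^ i) a \<in> R) \<and> a' \<in> R \<and> p a < \<epsilon> \<and> p a' < \<epsilon> \<and>
       (T ^^ K) (\<alpha> \<odot> g + a) = \<beta> \<odot> g + a'"
      using small[OF e a(1)] small[OF e a(2)] eventually_gt_at_top[of d]
    proof eventually_elim
      case (elim K)
      then show ?case
        using a(3) inR[of _ "a K"] inR[of 0 "a' K"] unfolding bj
        by - (rule exI[of _ "\<Sum>i\<in>{d..<2 * d}. a K i \<odot> b i"], rule exI[of _ "\<Sum>i\<in>{d..<2 * d}. a' K i \<odot> b i"], auto)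
    qed
  qed
qed

text \<open>\<open>u\<close> is steered to 0 and 0 to \<open>y\<close>, generator by generator; the
  sum of both steers \<open>u\<close> to \<open>y\<close>.\<close>

lemma steerable_span:
  assumes N: "linear_on s C N" and C: "subspace C" and R: "subspace R" "R \<subseteq> C" and p: "seminorm_on s R p"
    and T: "\<And>x. T x = x + N x" and G: "G \<subseteq> C"
    and nil: "\<And>g. g \<in> G \<Longrightarrow> \<exists>j. (N ^^ Suc j) g = 0" and anc: "\<And>g. g \<in> G \<Longrightarrow> has_ancestors N C R g"
    and u: "u \<in> span G" and y: "y \<in> span G"
  shows "steerable T R k p u y"
proof -
  have TC: "linear_on s C T"
    using N unfolding linear_on_def T by (auto simp: subspace_add[OF C] scale_right_distrib)
  have gen: "steerable T R k p (\<alpha> \<odot> g) (\<beta> \<odot> g)" if "g \<in> G" for g \<alpha> \<beta>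
    using nil[OF that] steerable_generator[OF N C R p T _ anc[OF that]] by blast
  have sp: "span G \<subseteq> C" by (rule span_minimal[OF G C])
  note zero = steerable_zero[OF TC C R(1) p]
  have 1: "u \<in> C \<and> steerable T R k p u 0"
    using u
  proof (induction rule: span_induct_alt)
    case base show ?case using zero subspace_0[OF C] by simp
  next
    case (step c g w)
    have g: "c \<odot> g \<in> C" using step(1) G subspace_scale[OF C] by blast
    have "steerable T R k p (c \<odot> g + w) (0 \<odot> g + 0)"
      by (rule steerable_add[OF TC C R p g _ gen[OF step(1)]]) (use step in auto)
    then show ?case using g step subspace_add[OF C] by simp
  qed
  have 2: "steerable T R k p 0 y"
    using y
  proof (induction rule: span_induct_alt)
    case base show ?case by (rule zero)
  next
    case (step c g w)
    have g: "0 \<odot> g \<in> C" using subspace_0[OF C] by simp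
    have "steerable T R k p (0 \<odot> g + 0) (c \<odot> g + w)"
      by (rule steerable_add[OF TC C R p g subspace_0[OF C] gen[OF step(1)] step(2)])
    then show ?case by simp
  qed
  have "steerable T R k p (u + 0) (0 + y)"
    by (rule steerable_add[OF TC C R p _ subspace_0[OF C] _ 2]) (use 1 in auto)
  then show ?thesis by simp
qed

end

text \<open>The indices of the vectors \<open>v (m t)\<close> are split by residues modulo 3: the index \<open>3 i + 1\<close> is sent to the
  summand \<open>t\<close> if that is not one of the \<open>m k\<close>, the index \<open>3 i + 2\<close> stays in \<open>X (m 0)\<close> (for \<open>t = 0\<close>), and
  \<open>3 i + 3\<close> is sent to the next summand. Since \<open>i\<close> decreases, the resulting operator \<open>N\<close> is locally nilpotent, and
  every \<open>v j i\<close> has an infinite chain of preimages under \<open>N\<close> that finally runs in \<open>X (m 0)\<close>.\<close>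

locale chain_operator = lc_family s X for s :: "'k::real_normed_field \<Rightarrow> 'v::ab_group_add \<Rightarrow> 'v" (infixr "\<odot>" 75)
    and X :: "nat \<Rightarrow> 'v topology" +
  fixes m :: "nat \<Rightarrow> nat" and v :: "nat \<Rightarrow> nat \<Rightarrow> 'v" and A :: "'v \<Rightarrow> 'v" and B L :: "nat \<Rightarrow> 'v \<Rightarrow> 'v"
    and a :: "nat \<Rightarrow> 'k" and b l :: "nat \<Rightarrow> nat \<Rightarrow> 'k"
  assumes inj_m: "inj m" and v_in: "\<And>j i. v j i \<in> topspace (X j)"
    and A: "cont_op s (X (m 0)) (X (m 0)) A" 
    and B: "\<And>t. cont_op s (X (m t)) (X (m (Suc t))) (B t)"
    and L: "\<And>t. t \<notin> range m \<Longrightarrow> cont_op s (X (m t)) (X t) (L t)"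
    and A_v: "\<And>i. A (v (m 0) (3 * i)) = 0" "\<And>i. A (v (m 0) (3 * i + 1)) = 0" 
      "\<And>i. A (v (m 0) (3 * i + 2)) = a i \<odot> v (m 0) i"
    and B_v: "\<And>t i. B t (v (m t) (3 * i + 3)) = b t i \<odot> v (m (Suc t)) i" "\<And>t. B t (v (m t) 0) = 0"
      "\<And>t i. B t (v (m t) (3 * i + 1)) = 0" "\<And>t i. B t (v (m t) (3 * i + 2)) = 0"
    and L_v: "\<And>t i. t \<notin> range m \<Longrightarrow> L t (v (m t) (3 * i)) = 0" 
      "\<And>t i. t \<notin> range m \<Longrightarrow> L t (v (m t) (3 * i + 1)) = l t i \<odot> v t i"
      "\<And>t i. t \<notin> range m \<Longrightarrow> L t (v (m t) (3 * i + 2)) = 0"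
    and nz: "\<And>i. a i \<noteq> 0" "\<And>t i. b t i \<noteq> 0" "\<And>t i. t \<notin> range m \<Longrightarrow> l t i \<noteq> 0"
begin

text \<open>Written by the target coordinate: the root is fed by itself, any other
  \<open>m t\<close> by its predecessor, and a leaf \<open>j\<close> by \<open>m j\<close>. Since
  \<open>m\<close> is injective, a summand feeds at most three coordinates and finite supports are
  preserved.\<close>

definition N :: "(nat \<Rightarrow> 'v) \<Rightarrow> nat \<Rightarrow> 'v" where
  "N f j = (if j = m 0 then A (f j)
     else if j \<in> range m then B (inv m j - 1) (f (m (inv m j - 1))) else L j (f (m j)))"

lemma N_root: "N f (m 0) = A (f (m 0))" 
  and N_main: "N f (m (Suc t)) = B t (f (m t))"
  and N_leaf: "j \<notin> range m \<Longrightarrow> N f j = L j (f (m j))"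
  using inj_m by (auto simp: N_def inj_eq)

lemma index_cases:
  obtains "j = m 0" | t where "j = m (Suc t)" | "j \<notin> range m"
  by (metis not0_implies_Suc rangeE)

lemma cont_op_zero: "cont_op s (X i) (X j) Q \<Longrightarrow> Q 0 = 0"
  using cont_opD(2)[of s "X i" "X j" Q 0 0] zero_in_topspace[OF lc[of i]] by simp

lemma zeros: "A 0 = 0" "B t 0 = 0" "t \<notin> range m \<Longrightarrow> L t 0 = 0"
  using cont_op_zero[OF A] cont_op_zero[OF B] cont_op_zero[OF L] by auto

lemma N_linear: "linear_on (dsum_scale s) C N"
  unfolding linear_on_def
proof (intro conjI ballI allI)
  fix f assume f: "f \<in> C"
  have "N f j \<in> topspace (X j)" for j
    by (cases j rule: index_cases)
       (auto simp: N_root N_main N_leaf intro!: cont_opD(1)[OF A] cont_opD(1)[OF B] cont_opD(1)[OF L] coord_in_X[OF f])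
  moreover have "finite {j. N f j \<noteq> 0}"
  proof (rule finite_subset)
    let ?S = "m -` {i. f i \<noteq> 0}"
    show "{j. N f j \<noteq> 0} \<subseteq> insert (m 0) ((\<lambda>t. m (Suc t)) ` ?S \<union> ?S)"
    proof
      fix j assume j: "j \<in> {j. N f j \<noteq> 0}"
      show "j \<in> insert (m 0) ((\<lambda>t. m (Suc t)) ` ?S \<union> ?S)"
      proof (cases j rule: index_cases)
        case (2 t)
        then have "f (m t) \<noteq> 0" using j zeros by (auto simp: N_main)
        then show ?thesis using 2 by blast
      next
        case 3
        then have "f (m j) \<noteq> 0" using j zeros by (auto simp: N_leaf)
        then show ?thesis by blast
      qed simp
    qed
    show "finite (insert (m 0) ((\<lambda>t. m (Suc t)) ` ?S \<union> ?S))"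
      using f finite_vimageI[OF _ inj_m, of "{i. f i \<noteq> 0}"] by (simp add: dsum_carrier_def)
  qed
  ultimately show "N f \<in> C" by (simp add: dsum_carrier_def)
next
  fix f g assume f: "f \<in> C" and g: "g \<in> C"
  note c = coord_in_X[OF f] coord_in_X[OF g]
  show "N (f + g) = N f + N g"
  proof
    fix j show "N (f + g) j = (N f + N g) j"
      by (cases j rule: index_cases)
         (simp_all add: N_root N_main N_leaf cont_opD(2)[OF A c] cont_opD(2)[OF B c] cont_opD(2)[OF L c])
  qed
next
  fix c f assume f: "f \<in> C"
  show "N (dsum_scale s c f) = dsum_scale s c (N f)"
  proof
    fix j show "N (dsum_scale s c f) j = dsum_scale s c (N f) j"
      using coord_in_X[OF f]
      by (cases j rule: index_cases)
         (simp_all add: dsum_scale_def N_root N_main N_leaf cont_opD(3)[OF A] cont_opD(3)[OF B] cont_opD(3)[OF L])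
  qed
qed

lemma N_inj_leaf: "j \<notin> range m \<Longrightarrow> N (dsum_inj j x) = 0"
proof
  fix i assume j: "j \<notin> range m"
  then have "dsum_inj j x (m t) = 0" for t by (intro dsum_inj_other) blast
  then show "N (dsum_inj j x) i = 0 i"
    using zeros by (cases i rule: index_cases) (simp_all add: N_root N_main N_leaf)
qed

lemma N_inj_main:
  "N (dsum_inj (m t) x) = (if t = 0 then dsum_inj (m 0) (A x) else 0) + dsum_inj (m (Suc t)) (B t x)
     + (if t \<in> range m then 0 else dsum_inj t (L t x))"
proof
  fix i
  have e: "dsum_inj (m t) x (m t') = (if t' = t then x else 0)" for t'
    using inj_m by (simp add: dsum_inj_def inj_eq)
  have nr: "t' \<notin> range m \<Longrightarrow> m t'' \<noteq> t'" for t' t'' by blast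
  show "N (dsum_inj (m t) x) i = ((if t = 0 then dsum_inj (m 0) (A x) else 0) + dsum_inj (m (Suc t)) (B t x)
     + (if t \<in> range m then 0 else dsum_inj t (L t x))) i"
  proof (cases i rule: index_cases)
    case 1
    have "m (Suc t) \<noteq> m 0" using inj_m by (simp add: inj_eq)
    then show ?thesis unfolding 1 N_root e using zeros nr by (auto simp: dsum_inj_def)
  next
    case (2 t')
    have "m (Suc t) = m (Suc t') \<longleftrightarrow> t = t'" "m (Suc t') \<noteq> m 0" using inj_m by (auto simp: inj_eq)
    then show ?thesis unfolding 2 N_main e using zeros nr by (auto simp: dsum_inj_def)
  next
    case 3
    then have "i \<noteq> m 0" "i \<noteq> m (Suc t)" by auto
    then show ?thesis unfolding N_leaf[OF 3] e using 3 zeros by (auto simp: dsum_inj_def)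
  qed
qed

definition E :: "nat \<Rightarrow> nat \<Rightarrow> nat \<Rightarrow> 'v" where
  "E j i = dsum_inj j (v j i)"

lemma E_in_C: "E j i \<in> C"
  unfolding E_def by (rule inj_in_C[OF v_in])

lemma N_E:
  "j \<notin> range m \<Longrightarrow> N (E j i) = 0"
  "N (E (m t) 0) = 0"
  "N (E (m t) (3 * i + 1)) = (if t \<in> range m then 0 else dsum_scale s (l t i) (E t i))"
  "N (E (m 0) (3 * i + 2)) = dsum_scale s (a i) (E (m 0) i)"
  "t \<noteq> 0 \<Longrightarrow> N (E (m t) (3 * i + 2)) = 0"
  "N (E (m t) (3 * i + 3)) = dsum_scale s (b t i) (E (m (Suc t)) i)"
proof -
  have A3: "A (v (m 0) (3 * i + 3)) = 0" "A (v (m 0) 0) = 0" for i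
    using A_v(1)[of "Suc i"] A_v(1)[of 0] by (simp_all add: numeral_3_eq_3)
  have L3: "t \<notin> range m \<Longrightarrow> L t (v (m t) (3 * i + 3)) = 0" "t \<notin> range m \<Longrightarrow> L t (v (m t) 0) = 0" for t i
    using L_v(1)[of t "Suc i"] L_v(1)[of t 0] by (simp_all add: numeral_3_eq_3)
  show "j \<notin> range m \<Longrightarrow> N (E j i) = 0" unfolding E_def by (rule N_inj_leaf)
  show "N (E (m t) 0) = 0"
    unfolding E_def N_inj_main using A3(2) B_v(2) L3(2) by auto
  show "N (E (m t) (3 * i + 1)) = (if t \<in> range m then 0 else dsum_scale s (l t i) (E t i))"
    unfolding E_def N_inj_main using A_v(2) B_v(3) L_v(2) by (auto simp: inj_scale)
  show "N (E (m 0) (3 * i + 2)) = dsum_scale s (a i) (E (m 0) i)"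
    unfolding E_def N_inj_main using A_v(3) B_v(4) L_v(3) by (auto simp: inj_scale)
  show "t \<noteq> 0 \<Longrightarrow> N (E (m t) (3 * i + 2)) = 0"
    unfolding E_def N_inj_main using B_v(4) L_v(3) by auto
  show "N (E (m t) (3 * i + 3)) = dsum_scale s (b t i) (E (m (Suc t)) i)"
    unfolding E_def N_inj_main using A3(1) B_v(1) L3(1) by (auto simp: inj_scale)
qed

lemma N_nilpotent_main: "\<exists>k. (N ^^ Suc k) (E (m t) i) = 0"
proof (induction i arbitrary: t rule: less_induct)
  case (less i)
  have step: "\<exists>k. (N ^^ Suc k) (E (m t) i) = 0"
    if "N (E (m t) i) = dsum_scale s c g" "g \<in> C" "(N ^^ Suc k) g = 0" for c g k
  proof -
    have "(N ^^ Suc (Suc k)) (E (m t) i) = (N ^^ Suc k) (dsum_scale s c g)"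
      using that(1) by (simp only: funpow_Suc_right o_apply)
    also have "\<dots> = dsum_scale s c ((N ^^ Suc k) g)" by (rule d.linear_onD(3)[OF d.linear_on_funpow[OF N_linear] that(2)])
    also have "\<dots> = 0" unfolding that(3) by (rule d.scale_zero_right)
    finally show ?thesis by blast
  qed
  have zero: "\<exists>k. (N ^^ Suc k) (E (m t) i) = 0" if "N (E (m t) i) = 0"
    using that by (intro exI[of _ 0]) simp
  consider "i = 0" | i' where "i = 3 * i' + 1" | i' where "i = 3 * i' + 2" | i' where "i = 3 * i' + 3"
  proof -
    have "i = 3 * (i div 3) + i mod 3" "i mod 3 < 3" by simp_all
    moreover have "i mod 3 = 0 \<Longrightarrow> i \<noteq> 0 \<Longrightarrow> i = 3 * (i div 3 - 1) + 3" by auto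
    ultimately show ?thesis using that by (metis One_nat_def add.right_neutral less_2_cases_iff less_Suc_eq numeral_2_eq_2 numeral_3_eq_3)
  qed
  then show ?case
  proof cases
    case 1 show ?thesis unfolding 1 by (rule zero[unfolded 1, OF N_E(2)])
  next
    case (2 i')
    show ?thesis
    proof (cases "t \<in> range m")
      case True
      then have "N (E (m t) i) = 0" unfolding 2 N_E(3) by (simp only: if_True)
      then show ?thesis by (rule zero)
    next
      case False
      then have 1: "N (E (m t) i) = dsum_scale s (l t i') (E t i')" unfolding 2 N_E(3) by (simp only: if_False)
      have "(N ^^ Suc 0) (E t i') = 0" using N_E(1)[OF False] by simp
      then show ?thesis by (rule step[OF 1 E_in_C])
    qed
  next
    case (3 i')
    show ?thesis
    proof (cases "t = 0")
      case True
      have "i' < i" using 3 by simp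
      then obtain k where k: "(N ^^ Suc k) (E (m 0) i') = 0" using less by blast
      have "N (E (m t) i) = dsum_scale s (a i') (E (m 0) i')" unfolding 3 True by (rule N_E(4))
      then show ?thesis by (rule step[OF _ E_in_C k])
    next
      case False
      have "N (E (m t) i) = 0" unfolding 3 by (rule N_E(5)[OF False])
      then show ?thesis by (rule zero)
    qed
  next
    case (4 i')
    have "i' < i" using 4 by simp
    then obtain k where k: "(N ^^ Suc k) (E (m (Suc t)) i') = 0" using less by blast
    have "N (E (m t) i) = dsum_scale s (b t i') (E (m (Suc t)) i')" unfolding 4 by (rule N_E(6))
    then show ?thesis by (rule step[OF _ E_in_C k])
  qed
qed

lemma N_nilpotent: "\<exists>k. (N ^^ Suc k) (E j i) = 0"
proof (cases "j \<in> range m")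
  case True then show ?thesis using N_nilpotent_main by auto
next
  case False
  have "(N ^^ Suc 0) (E j i) = 0" using N_E(1)[OF False] by simp
  then show ?thesis ..
qed

text \<open>The algebraic span only. The limit of the corrections may leave it, but it remains in
  the summand \<open>m 0\<close>.\<close>

definition R :: "(nat \<Rightarrow> 'v) set" where
  "R = d.span (range (E (m 0)))"

lemma subspace_R: "d.subspace R"
  unfolding R_def by (rule d.subspace_span)

lemma R_in_C: "R \<subseteq> C"
  unfolding R_def by (rule d.span_minimal[OF _ subspace_C]) (use E_in_C in blast)

lemma R_supported: "f \<in> R \<Longrightarrow> f = dsum_inj (m 0) (f (m 0))"
proof -
  assume "f \<in> R"
  then have "f \<in> supported {m 0}"
    unfolding R_def
    by (rule subsetD[OF d.span_minimal[OF _ subspace_supported], rotated]) (auto simp: E_def inj_supported v_in)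
  then show ?thesis using supported_decompose[of "{m 0}" f] by simp
qed

lemma has_ancestors_root: "d.has_ancestors N C R (E (m 0) i)"
proof -
  \<comment> \<open>Pairs of coefficient and index. Each ancestor moves from index \<open>i\<close>
    to \<open>3 * i + 2\<close> and divides by \<open>a i\<close> to compensate for the
    weight.\<close>
  define u where "u = rec_nat (1 :: 'k, i) (\<lambda>_ (c, i). (c / a i, 3 * i + 2))"
  have u0: "u 0 = (1, i)" and uS: "u (Suc k) = (fst (u k) / a (snd (u k)), 3 * snd (u k) + 2)" for k
    by (simp_all add: u_def case_prod_unfold)
  define h where "h k = dsum_scale s (fst (u k)) (E (m 0) (snd (u k)))" for k
  have hR: "h k \<in> R" for k unfolding h_def R_def by (intro d.span_scale d.span_base) blast
  have "N (h (Suc k)) = h k" for k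
  proof -
    have "N (h (Suc k)) = dsum_scale s (fst (u (Suc k))) (N (E (m 0) (snd (u (Suc k)))))"
      unfolding h_def by (rule d.linear_onD(3)[OF N_linear E_in_C])
    also have "\<dots> = dsum_scale s (fst (u k) / a (snd (u k)) * a (snd (u k))) (E (m 0) (snd (u k)))"
      unfolding uS fst_conv snd_conv N_E(4) d.scale_scale ..
    also have "\<dots> = h k" using nz(1) by (simp add: h_def)
    finally show ?thesis .
  qed
  moreover have "h 0 = E (m 0) i" unfolding h_def u0 by (simp add: d.scale_one)
  ultimately show ?thesis
    unfolding d.has_ancestors_def using hR R_in_C by (intro exI[of _ h]) (auto intro!: exI[of _ 0])
qed

lemma has_ancestors_main: "d.has_ancestors N C R (E (m t) i)"
proof (induction t arbitrary: i)
  case 0 show ?case by (rule has_ancestors_root)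
next
  case (Suc t)
  show ?case
    by (rule d.has_ancestors_step[OF N_linear subspace_C subspace_R Suc N_E(6) nz(2) E_in_C])
qed

lemma has_ancestors_E: "d.has_ancestors N C R (E j i)"
proof (cases "j \<in> range m")
  case True then show ?thesis using has_ancestors_main by auto
next
  case False
  then have "N (E (m j) (3 * i + 1)) = dsum_scale s (l j i) (E j i)" unfolding N_E(3) by (simp only: if_False)
  then show ?thesis
    by (rule d.has_ancestors_step[OF N_linear subspace_C subspace_R has_ancestors_main _ nz(3)[OF False] E_in_C])
qed

definition T :: "(nat \<Rightarrow> 'v) \<Rightarrow> nat \<Rightarrow> 'v" where
  "T f = f + N f"

lemma T_linear: "linear_on (dsum_scale s) C T"
  using N_linear unfolding linear_on_def T_def by (auto simp: d.subspace_add[OF subspace_C] d.scale_right_distrib)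

definition G :: "(nat \<Rightarrow> 'v) set" where
  "G = d.span (range (case_prod E))"

lemma R_subset_G: "R \<subseteq> G"
  unfolding R_def G_def by (rule d.span_mono) auto

lemma steerable_G:
  assumes "seminorm_on (dsum_scale s) R p" "u \<in> G" "y \<in> G"
  shows "d.steerable T R k p u y"
  by (rule d.steerable_span[OF N_linear subspace_C subspace_R R_in_C assms(1) T_def _ _ _ assms(2,3)[unfolded G_def]])
     (use E_in_C N_nilpotent has_ancestors_E in auto)

lemma T_seminorm:
  assumes q: "cont_seminorm (dsum_scale s) DT q"
  shows "cont_seminorm (dsum_scale s) DT (\<lambda>f. q (T f))"
  unfolding cont_seminorm_DT_iff
proof (intro conjI allI)
  have qs: "seminorm_on (dsum_scale s) C q" using d.cont_seminorm_on[OF lc_DT q] by (simp add: topspace_DT)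
  have qi: "cont_seminorm s (X i) (\<lambda>x. q (dsum_inj i x))" for i using q by (simp add: cont_seminorm_DT_iff)
  show sn: "seminorm_on (dsum_scale s) C (\<lambda>f. q (T f))"
    using qs d.linear_onD[OF T_linear] unfolding seminorm_on_def by simp
  fix i
  have sni: "seminorm_on s (topspace (X i)) (\<lambda>x. q (T (dsum_inj i x)))"
    using sn inj_in_C unfolding seminorm_on_def by (simp add: dsum_inj_add inj_scale)
  show "cont_seminorm s (X i) (\<lambda>x. q (T (dsum_inj i x)))"
  proof (cases "i \<in> range m")
    case False
    then show ?thesis unfolding T_def N_inj_leaf[OF False] using qi by simp
  next
    case True
    then obtain t where i: "i = m t" by blast
    have z: "q 0 = 0" using d.seminorm_zero[OF qs d.subspace_0[OF subspace_C]] .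
    have cA: "cont_seminorm s (X i) (\<lambda>x. if t = 0 then q (dsum_inj (m 0) (A x)) else 0)"
      using cont_opD(4)[OF A qi] cont_seminorm_zero[OF lc] i by (cases "t = 0") auto
    have cB: "cont_seminorm s (X i) (\<lambda>x. q (dsum_inj (m (Suc t)) (B t x)))"
      using cont_opD(4)[OF B qi] i by auto
    have cL: "cont_seminorm s (X i) (\<lambda>x. if t \<in> range m then 0 else q (dsum_inj t (L t x)))"
      using cont_opD(4)[OF L qi] cont_seminorm_zero[OF lc] i by (cases "t \<in> range m") auto
    let ?p = "\<lambda>x. (q (dsum_inj i x) + (if t = 0 then q (dsum_inj (m 0) (A x)) else 0)) + 
      (q (dsum_inj (m (Suc t)) (B t x)) + (if t \<in> range m then 0 else q (dsum_inj t (L t x))))"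
    have p: "cont_seminorm s (X i) ?p" by (intro cont_seminorm_add[OF lc] qi cA cB cL)
    show ?thesis
    proof (rule cont_seminorm_dominated[OF lc sni p, of 1])
      fix x assume x: "x \<in> topspace (X i)"
      define f1 where "f1 = (if t = 0 then dsum_inj (m 0) (A x) else 0)"
      define f2 where "f2 = dsum_inj (m (Suc t)) (B t x)"
      define f3 where "f3 = (if t \<in> range m then 0 else dsum_inj t (L t x))"
      have 0: "0 \<in> C" by (rule d.subspace_0[OF subspace_C])
      have in_C: "dsum_inj i x \<in> C" "f1 \<in> C" "f2 \<in> C" "f3 \<in> C"
        unfolding f1_def f2_def f3_def using 0 x i
        by (auto intro!: inj_in_C cont_opD(1)[OF A] cont_opD(1)[OF B] cont_opD(1)[OF L])
      have "T (dsum_inj i x) = (dsum_inj i x + f1) + (f2 + f3)"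
        unfolding T_def i N_inj_main f1_def f2_def f3_def by (simp add: add.assoc)
      then have "q (T (dsum_inj i x)) \<le> q (dsum_inj i x + f1) + q (f2 + f3)"
        using d.seminorm_add[OF qs d.subspace_add[OF subspace_C in_C(1,2)] d.subspace_add[OF subspace_C in_C(3,4)]] by simp
      also have "\<dots> \<le> (q (dsum_inj i x) + q f1) + (q f2 + q f3)"
        by (intro add_mono d.seminorm_add[OF qs] in_C)
      also have "\<dots> = ?p x" unfolding f1_def f2_def f3_def using z by auto
      finally show "q (T (dsum_inj i x)) \<le> 1 * ?p x" by simp
    qed
  qed
qed

lemma T_funpow_seminorm:
  "cont_seminorm (dsum_scale s) DT q \<Longrightarrow> cont_seminorm (dsum_scale s) DT (\<lambda>f. q ((T ^^ n) f))"
proof (induction n arbitrary: q)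
  case (Suc n)
  have "cont_seminorm (dsum_scale s) DT (\<lambda>f. q (T f))" by (rule T_seminorm[OF Suc.prems])
  from Suc.IH[OF this] show ?case by simp
qed simp

lemma T_continuous_operator: "continuous_operator (dsum_scale s) DT T"
proof -
  have "continuous_map DT DT T"
    using continuous_linear_iff_seminorms[OF lc_DT lc_DT, of T] T_linear T_seminorm
    unfolding topspace_DT linear_on_def by simp
  then show ?thesis using T_linear unfolding continuous_operator_def topspace_DT linear_on_def by simp
qed

end

section \<open>The hypercyclic vector\<close>

lemma geometric_tail_le: "(\<Sum>i\<in>{Suc r..<n}. (1/2 :: real) ^ i) \<le> (1/2) ^ r"
proof -
  have "(\<Sum>i\<in>{Suc r..<Suc r + d}. (1/2 :: real) ^ i) = (1/2) ^ r - (1/2) ^ (r + d)" for d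
  proof (induction d)
    case (Suc d)
    have "(\<Sum>i\<in>{Suc r..<Suc r + Suc d}. (1/2 :: real) ^ i) = (\<Sum>i\<in>{Suc r..<Suc r + d}. (1/2) ^ i) + (1/2) ^ (Suc r + d)"
      by simp
    also have "\<dots> = (1/2) ^ r - (1/2) ^ (r + d) + (1/2) ^ (r + d) / 2" unfolding Suc by simp
    finally show ?case by simp
  qed simp
  from this[of "n - Suc r"] show ?thesis by (cases "n \<ge> Suc r") auto
qed

lemma diff_eq_diff_diff: "x - y = (z - y) - (z - x)" for x :: "'a::ab_group_add"
  by simp

context chain_operator
begin

lemma hypercyclic_T:
  assumes fr: "frechet_space s (X (m 0))"
    and D: "\<And>j k. D j k \<in> topspace (X j)" "\<And>j k. D j k \<in> span (range (v j))"
    and D_dense: "\<And>j y q. y \<in> topspace (X j) \<Longrightarrow> cont_seminorm s (X j) q \<Longrightarrow> \<exists>k::nat. q (D j k - y) < 1"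
  shows "hypercyclic (dsum_scale s) DT T"
proof -
  let ?X0 = "X (m 0)"
  let ?inj = "dsum_inj (m 0)"
  have met: "metrizable_space ?X0" using fr by (simp add: frechet_space_def)
  obtain P where P: "fundamental_seminorms ?X0 P" using metrizable_fundamental_seminorms[OF lc met] by blast
  have Pc: "cont_seminorm s ?X0 (P k)" for k using P by (simp add: fundamental_seminorms_def)
  have P_mono: "P j x \<le> P k x" if "j \<le> k" "x \<in> topspace ?X0" for j k x
    using P that by (simp add: fundamental_seminorms_def)
  define \<pi> where "\<pi> k f = P k (f (m 0))" for k and f :: "nat \<Rightarrow> 'v"
  have \<pi>: "cont_seminorm (dsum_scale s) DT (\<pi> k)" for k
    unfolding \<pi>_def by (rule cont_seminorm_coord[OF Pc])
  define w where "w ks = (\<Sum>j<length ks. dsum_inj j (D j (ks ! j)))" for ks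
  \<comment> \<open>Lists of naturals select finitely many approximants \<open>D\<close>. Every list
    recurs at arbitrarily large \<open>n\<close>, where the error of the hit is small.\<close>
  define y where "y n = w (list_decode (fst (prod_decode n)))" for n
  have inj_G: "dsum_inj j z \<in> G" if "z \<in> span (range (v j))" for j z
    using that
  proof (induction rule: span_induct_alt)
    case base show ?case unfolding dsum_inj_zero G_def by (rule d.span_zero)
  next
    case (step c z z')
    then obtain i where "z = v j i" by blast
    then have "dsum_inj j z \<in> G" unfolding G_def by (intro d.span_base) (auto simp: E_def image_iff)
    then show ?case unfolding dsum_inj_add inj_scale using step.IH unfolding G_def
      by (intro d.span_add d.span_scale)
  qed
  have w_G: "w ks \<in> G" for ks
    unfolding w_def G_def by (rule d.span_sum) (rule inj_G[OF D(2), unfolded G_def])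
  have G_C: "G \<subseteq> C" unfolding G_def by (rule d.span_minimal[OF _ subspace_C]) (use E_in_C in auto)
  have Tn: "linear_on (dsum_scale s) C (T ^^ n)" for n by (rule d.linear_on_funpow[OF T_linear])

  \<comment> \<open>The sum of the earlier hitting times bounds each of them. Keeping
    \<open>a\<close> small and in \<open>R\<close> for so many steps protects all earlier hits from
    the new correction.\<close>
  define Q :: "(nat \<Rightarrow> (nat \<Rightarrow> 'v) \<times> nat) \<Rightarrow> nat \<Rightarrow> (nat \<Rightarrow> 'v) \<times> nat \<Rightarrow> bool"
    where "Q h n r \<longleftrightarrow> (case r of (a, K) \<Rightarrow>
      (\<forall>i\<le>(\<Sum>j<n. snd (h j)). (T ^^ i) a \<in> R \<and> \<pi> n ((T ^^ i) a) < (1/2) ^ n) \<and>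
      (\<exists>a'\<in>R. \<pi> n a' < (1/2) ^ n \<and> (T ^^ K) ((\<Sum>j<n. fst (h j)) + a) = y n + a'))" for h n r
  have "\<exists>h. \<forall>n. Q h n (h n)"
  proof (rule dependent_wellorder_choice)
    fix r n and h h' :: "nat \<Rightarrow> (nat \<Rightarrow> 'v) \<times> nat"
    assume eq: "\<And>i. i < n \<Longrightarrow> h i = h' i"
    have "(\<Sum>j<n. snd (h j)) = (\<Sum>j<n. snd (h' j))" by (rule sum.cong) (use eq in auto)
    moreover have "(\<Sum>j<n. fst (h j)) = (\<Sum>j<n. fst (h' j))" by (rule sum.cong) (use eq in auto)
    ultimately show "Q h n r = Q h' n r" by (simp add: Q_def)
  next
    fix n and h :: "nat \<Rightarrow> (nat \<Rightarrow> 'v) \<times> nat"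
    assume h: "\<And>i. i < n \<Longrightarrow> Q h i (h i)"
    have "fst (h i) \<in> R" if "i < n" for i
    proof -
      have "Q h i (fst (h i), snd (h i))" using h[OF that] by simp
      then have "(T ^^ 0) (fst (h i)) \<in> R" unfolding Q_def by blast
      then show ?thesis by simp
    qed
    then have u: "(\<Sum>j<n. fst (h j)) \<in> R" by (intro d.subspace_sum[OF subspace_R]) auto
    define k where "k = (\<Sum>j<n. snd (h j))"
    \<comment> \<open>One seminorm that controls the first \<open>k\<close> iterates of the
      correction at once.\<close>
    define p where "p f = (\<Sum>i\<le>k. \<pi> n ((T ^^ i) f))" for f
    have "cont_seminorm (dsum_scale s) DT p"
      unfolding p_def by (intro d.cont_seminorm_sum[OF lc_DT] T_funpow_seminorm \<pi>)
    then have "seminorm_on (dsum_scale s) C p" using d.cont_seminorm_on[OF lc_DT] by (simp add: topspace_DT)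
    then have p: "seminorm_on (dsum_scale s) R p" using d.seminorm_on_subset R_in_C by blast
    have p_ge: "\<pi> n ((T ^^ i) f) \<le> p f" if "i \<le> k" "f \<in> R" for i f
      unfolding p_def
    proof (rule member_le_sum)
      fix j
      have "(T ^^ j) f \<in> topspace DT" unfolding topspace_DT using d.linear_onD(1)[OF Tn] that(2) R_in_C by blast
      then show "0 \<le> \<pi> n ((T ^^ j) f)" by (rule d.cont_seminorm_ge0[OF lc_DT \<pi>])
    qed (use that in auto)
    have "d.steerable T R k p (\<Sum>j<n. fst (h j)) (y n)"
      by (rule steerable_G[OF p]) (use u R_subset_G w_G in \<open>auto simp: y_def\<close>)
    then have "\<forall>\<^sub>F K in sequentially. \<exists>a a'. (\<forall>i\<le>k. (T ^^ i) a \<in> R) \<and> a' \<in> R \<and> p a < (1/2) ^ n \<and> p a' < (1/2) ^ n \<and>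
      (T ^^ K) ((\<Sum>j<n. fst (h j)) + a) = y n + a'"
      unfolding d.steerable_def by (rule allE[of _ "(1/2) ^ n"]) simp
    from eventually_happens'[OF sequentially_bot this]
    obtain K a a' where aa': "\<forall>i\<le>k. (T ^^ i) a \<in> R" "a' \<in> R" "p a < (1/2) ^ n" "p a' < (1/2) ^ n"
      "(T ^^ K) ((\<Sum>j<n. fst (h j)) + a) = y n + a'" by blast
    have aR: "a \<in> R" using aa'(1)[rule_format, of 0] by simp
    have "\<pi> n ((T ^^ i) a) < (1/2) ^ n" if "i \<le> k" for i using p_ge[OF that aR] aa'(3) by simp
    moreover have "\<pi> n a' < (1/2) ^ n" using p_ge[of 0 a'] aa'(2,4) by simp
    ultimately have "Q h n (a, K)" unfolding Q_def k_def[symmetric] using aa' by auto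
    then show "\<exists>r. Q h n r" by blast
  qed
  then obtain h where h: "\<And>n. Q h n (h n)" by blast
  define a where "a i = fst (h i)" for i
  define K where "K i = snd (h i)" for i
  have hQ: "Q h n (a n, K n)" for n using h[of n] by (simp add: a_def K_def)
  have aK: "(T ^^ i) (a n) \<in> R" "\<pi> n ((T ^^ i) (a n)) < (1/2) ^ n" if "i \<le> (\<Sum>j<n. K j)" for i n
    using hQ[of n] that unfolding Q_def K_def[symmetric] by auto
  have aR: "a n \<in> R" and a\<pi>: "\<pi> n (a n) < (1/2) ^ n" for n using aK[of 0 n] by simp_all
  have hit: "\<exists>a'\<in>R. \<pi> n a' < (1/2) ^ n \<and> (T ^^ K n) ((\<Sum>j<n. a j) + a n) = y n + a'" for n
    using hQ[of n] unfolding Q_def a_def[symmetric] by auto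
  have later: "(T ^^ K r) (a n) \<in> R" "\<pi> n ((T ^^ K r) (a n)) < (1/2) ^ n" if "r < n" for r n
  proof -
    have "K r \<le> (\<Sum>j<n. K j)" by (rule member_le_sum) (use that in auto)
    then show "(T ^^ K r) (a n) \<in> R" "\<pi> n ((T ^^ K r) (a n)) < (1/2) ^ n" by (rule aK)+
  qed
  define \<alpha> where "\<alpha> n = a n (m 0)" for n
  have \<alpha>: "\<alpha> n \<in> topspace ?X0" "a n = ?inj (\<alpha> n)" for n
    using coord_in_X subsetD[OF R_in_C aR] R_supported[OF aR] by (auto simp: \<alpha>_def)
  have "\<exists>l\<in>topspace ?X0. \<forall>q. cont_seminorm s ?X0 q \<longrightarrow> (\<lambda>n. q ((\<Sum>i<n. \<alpha> i) - l)) \<longlonglongrightarrow> 0"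
  proof (rule frechet_series[OF fr \<alpha>(1)])
    fix q assume q: "cont_seminorm s ?X0 q"
    then obtain k where k: "\<forall>x\<in>topspace ?X0. q x \<le> P k x" using P by (auto simp: fundamental_seminorms_def)
    have "norm (q (\<alpha> n)) \<le> (1/2) ^ n" if "n \<ge> k" for n
    proof -
      have "q (\<alpha> n) \<le> P n (\<alpha> n)" using k \<alpha>(1) P_mono[OF that \<alpha>(1)] order_trans by blast
      also have "\<dots> < (1/2) ^ n" using a\<pi>[of n] by (simp add: \<pi>_def \<alpha>_def)
      finally show ?thesis using cont_seminorm_ge0[OF lc q \<alpha>(1)] by simp
    qed
    then show "summable (\<lambda>n. q (\<alpha> n))"
      by (intro summable_comparison_test[OF _ summable_geometric[of "1/2 :: real"]]) auto
  qed
  then obtain l where l: "l \<in> topspace ?X0" "\<And>q. cont_seminorm s ?X0 q \<Longrightarrow> (\<lambda>n. q ((\<Sum>i<n. \<alpha> i) - l)) \<longlonglongrightarrow> 0"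
    by blast
  define x where "x = ?inj l"
  have xC: "x \<in> C" unfolding x_def by (rule inj_in_C[OF l(1)])
  define S where "S n = (\<Sum>i<n. a i)" for n
  have SR: "S n \<in> R" for n unfolding S_def by (rule d.subspace_sum[OF subspace_R aR])
  have SC: "S n \<in> C" for n using SR R_in_C by blast
  \<comment> \<open>At time \<open>K r\<close> the partial sum up to \<open>a r\<close> misses
    \<open>y r\<close> by \<open>a'\<close>, and the later corrections add at most a geometric tail:
    together \<open>2 * (1/2) ^ r\<close>. Everything involved lies in the root, where
    \<open>q\<close> is dominated by one \<open>P k\<close>.\<close>
  have near: "\<exists>k. \<forall>r\<ge>k. q ((T ^^ K r) x - y r) \<le> 2 * (1/2) ^ r" if q: "cont_seminorm (dsum_scale s) DT q" for q
  proof -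
    have qs: "seminorm_on (dsum_scale s) C q" using d.cont_seminorm_on[OF lc_DT q] by (simp add: topspace_DT)
    have "cont_seminorm s ?X0 (\<lambda>x. q (?inj x))" using q by (simp add: cont_seminorm_DT_iff)
    then obtain k where k: "\<forall>x\<in>topspace ?X0. q (?inj x) \<le> P k x" using P by (auto simp: fundamental_seminorms_def)
    have q_R: "q f \<le> \<pi> r f" if "f \<in> R" "r \<ge> k" for f r
    proof -
      have f: "f (m 0) \<in> topspace ?X0" using coord_in_X that(1) R_in_C by blast
      have "q f = q (?inj (f (m 0)))" using R_supported[OF that(1)] by simp
      also have "\<dots> \<le> P k (f (m 0))" using k f by blast
      also have "\<dots> \<le> \<pi> r f" unfolding \<pi>_def by (rule P_mono[OF that(2) f])
      finally show ?thesis .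
    qed
    have "q ((T ^^ K r) x - y r) \<le> 2 * (1/2) ^ r" if r: "r \<ge> k" for r
    proof -
      have yC: "y r \<in> C" using w_G G_C by (auto simp: y_def)
      obtain a' where a': "a' \<in> R" "\<pi> r a' < (1/2) ^ r" "(T ^^ K r) (S r + a r) = y r + a'"
        using hit[of r] unfolding S_def by blast
      have TC: "(T ^^ K r) f \<in> C" if "f \<in> C" for f by (rule d.linear_onD(1)[OF Tn that])
      have bound: "q ((T ^^ K r) (S n) - y r) \<le> 2 * (1/2) ^ r" if n: "n \<ge> Suc r" for n
      proof -
        have "S n = (S r + a r) + (\<Sum>i\<in>{Suc r..<n}. a i)"
          using sum.atLeastLessThan_concat[of 0 "Suc r" n a] n by (simp add: S_def lessThan_atLeast0)
        then have "(T ^^ K r) (S n) = (T ^^ K r) (S r + a r) + (T ^^ K r) (\<Sum>i\<in>{Suc r..<n}. a i)"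
          using aR R_in_C SC by (simp only:) (intro d.linear_onD(2)[OF Tn] d.subspace_add[OF subspace_C] d.subspace_sum[OF subspace_C], auto)
        also have "(T ^^ K r) (\<Sum>i\<in>{Suc r..<n}. a i) = (\<Sum>i\<in>{Suc r..<n}. (T ^^ K r) (a i))"
          by (rule d.linear_on_sum[OF Tn subspace_C]) (use aR R_in_C in blast)
        finally have eq: "(T ^^ K r) (S n) - y r = a' + (\<Sum>i\<in>{Suc r..<n}. (T ^^ K r) (a i))"
          unfolding a'(3) by (simp only: add.assoc add_diff_cancel_left')
        have in_R: "(T ^^ K r) (a i) \<in> R" if "i \<in> {Suc r..<n}" for i using later(1)[of r i] that by simp
        have a'C: "a' \<in> C" using a'(1) R_in_C by blast
        have sC: "(\<Sum>i\<in>{Suc r..<n}. (T ^^ K r) (a i)) \<in> C"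
          by (rule subsetD[OF R_in_C d.subspace_sum[OF subspace_R in_R]])
        have "q ((T ^^ K r) (S n) - y r) \<le> q a' + q (\<Sum>i\<in>{Suc r..<n}. (T ^^ K r) (a i))"
          unfolding eq by (rule d.seminorm_add[OF qs a'C sC])
        also have "q (\<Sum>i\<in>{Suc r..<n}. (T ^^ K r) (a i)) \<le> (\<Sum>i\<in>{Suc r..<n}. q ((T ^^ K r) (a i)))"
          by (rule d.seminorm_sum[OF qs subspace_C]) (use in_R R_in_C in blast)
        also have "\<dots> \<le> (\<Sum>i\<in>{Suc r..<n}. (1/2) ^ i)"
        proof (rule sum_mono)
          fix i assume i: "i \<in> {Suc r..<n}"
          have "q ((T ^^ K r) (a i)) \<le> \<pi> i ((T ^^ K r) (a i))" by (rule q_R[OF in_R[OF i]]) (use i r in simp)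
          also have "\<dots> < (1/2) ^ i" by (rule later(2)) (use i in simp)
          finally show "q ((T ^^ K r) (a i)) \<le> (1/2) ^ i" by simp
        qed
        also have "\<dots> \<le> (1/2) ^ r" by (rule geometric_tail_le)
        finally show ?thesis using q_R[OF a'(1) r] a'(2) by linarith
      qed
      \<comment> \<open>The bound holds for partial sums; continuity of the fixed power of
        \<open>T\<close> on the root carries it over to \<open>x\<close>.\<close>
      have qT: "cont_seminorm s ?X0 (\<lambda>z. q ((T ^^ K r) (?inj z)))"
        using T_funpow_seminorm[OF q] by (simp add: cont_seminorm_DT_iff)
      have Sinj: "S n - x = ?inj ((\<Sum>i<n. \<alpha> i) - l)" for n
      proof -
        have "S n = ?inj (\<Sum>i<n. \<alpha> i)" unfolding S_def \<alpha>(2) by (induction n) (simp_all add: dsum_inj_add)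
        then show ?thesis unfolding x_def by (auto simp: dsum_inj_def fun_eq_iff)
      qed
      have "q ((T ^^ K r) x - y r) \<le> 2 * (1/2) ^ r + q ((T ^^ K r) (S n - x))" if n: "n \<ge> Suc r" for n
      proof -
        have "(T ^^ K r) (S n - x) = (T ^^ K r) (S n) - (T ^^ K r) x" by (rule d.linear_on_diff[OF Tn subspace_C SC xC])
        then have eq: "(T ^^ K r) x - y r = ((T ^^ K r) (S n) - y r) - (T ^^ K r) (S n - x)"
          by (simp only: diff_eq_diff_diff[of "(T ^^ K r) x" "y r" "(T ^^ K r) (S n)"])
        have "q ((T ^^ K r) x - y r) \<le> q ((T ^^ K r) (S n) - y r) + q ((T ^^ K r) (S n - x))"
          unfolding eq
          by (rule d.seminorm_diff[OF qs subspace_C d.subspace_diff[OF subspace_C TC[OF SC] yC] TC[OF d.subspace_diff[OF subspace_C SC xC]]])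
        then show ?thesis using bound[OF n] by linarith
      qed
      moreover have "(\<lambda>n. 2 * (1/2) ^ r + q ((T ^^ K r) (S n - x))) \<longlonglongrightarrow> 2 * (1/2) ^ r + 0"
        unfolding Sinj by (intro tendsto_add tendsto_const l(2)[OF qT])
      ultimately show ?thesis by (intro LIMSEQ_le_const) auto
    qed
    then show ?thesis by blast
  qed
  have dense: "\<exists>n. q ((T ^^ n) x - z) < 1" if z: "z \<in> C" and q: "cont_seminorm (dsum_scale s) DT q" for z q
  proof -
    have qs: "seminorm_on (dsum_scale s) C q" using d.cont_seminorm_on[OF lc_DT q] by (simp add: topspace_DT)
    obtain M where M: "\<And>i. z i \<noteq> 0 \<Longrightarrow> i < M"
      using z finite_nat_set_iff_bounded[of "{i. z i \<noteq> 0}"] by (auto simp: dsum_carrier_def)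
    \<comment> \<open>The errors in the \<open>M\<close> coordinates then add up to less than 1/2.
      \<open>Suc\<close> keeps the factor positive for \<open>M = 0\<close>.\<close>
    have "\<exists>k. 2 * real (Suc M) * q (dsum_inj j (D j k - z j)) < 1" for j
    proof -
      have "cont_seminorm s (X j) (\<lambda>x. 2 * real (Suc M) * q (dsum_inj j x))"
        by (rule cont_seminorm_mult[OF lc]) (use q in \<open>simp_all add: cont_seminorm_DT_iff\<close>)
      then show ?thesis using D_dense[OF coord_in_X[OF z]] by blast
    qed
    then obtain \<kappa> where \<kappa>: "\<And>j. 2 * real (Suc M) * q (dsum_inj j (D j (\<kappa> j) - z j)) < 1" by metis
    define ks where "ks = map \<kappa> [0..<M]"
    have wz: "w ks - z = (\<Sum>j<M. dsum_inj j (D j (\<kappa> j) - z j))"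
    proof -
      have "z = (\<Sum>j<M. dsum_inj j (z j))" by (rule dsum_decompose) (use M in auto)
      moreover have "w ks = (\<Sum>j<M. dsum_inj j (D j (\<kappa> j)))" unfolding w_def ks_def by (intro sum.cong) auto
      moreover have "dsum_inj j (D j (\<kappa> j) - z j) = dsum_inj j (D j (\<kappa> j)) - dsum_inj j (z j)" for j
        by (auto simp: dsum_inj_def fun_eq_iff)
      ultimately show ?thesis by (simp only: sum_subtractf)
    qed
    have dC: "dsum_inj j (D j (\<kappa> j) - z j) \<in> C" for j
      by (intro inj_in_C subspace_diff[OF subspace_X] D(1) coord_in_X z)
    have "q (w ks - z) \<le> (\<Sum>j<M. q (dsum_inj j (D j (\<kappa> j) - z j)))"
      unfolding wz by (rule d.seminorm_sum[OF qs subspace_C dC])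
    also have "\<dots> \<le> (\<Sum>j<M. 1 / (2 * real (Suc M)))"
      by (rule sum_mono) (use \<kappa> in \<open>simp add: field_simps less_imp_le\<close>)
    also have "\<dots> < 1 / 2" by (simp add: field_simps)
    finally have qw: "q (w ks - z) < 1 / 2" .
    obtain k where k: "\<And>r. r \<ge> k \<Longrightarrow> q ((T ^^ K r) x - y r) \<le> 2 * (1/2) ^ r" using near[OF q] by blast
    \<comment> \<open>\<open>r \<ge> 3\<close> makes the error \<open>2 * (1/2) ^ r\<close> at most
      1/4.\<close>
    define r where "r = prod_encode (list_encode ks, max k 3)"
    have r: "y r = w ks" "r \<ge> k" "r \<ge> 3"
      using le_prod_encode_2[of "max k 3" "list_encode ks"] by (simp_all add: r_def y_def)
    have "(1/2 :: real) ^ r \<le> (1/2) ^ 3" using r(3) by (intro power_decreasing) auto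
    then have 1: "q ((T ^^ K r) x - w ks) \<le> 1 / 4" using k[OF r(2)] r(1) by (simp add: power3_eq_cube)
    have wC: "w ks \<in> C" using w_G G_C by blast
    have "q (((T ^^ K r) x - w ks) + (w ks - z)) \<le> q ((T ^^ K r) x - w ks) + q (w ks - z)"
      by (intro d.seminorm_add[OF qs] d.subspace_diff[OF subspace_C] d.linear_onD(1)[OF Tn] xC wC z)
    then have "q ((T ^^ K r) x - z) < 1" using 1 qw by simp
    then show ?thesis by blast
  qed
  have orb: "{(T ^^ n) x |n. True} \<subseteq> topspace DT" unfolding topspace_DT using d.linear_onD(1)[OF Tn xC] by blast
  have "DT closure_of {(T ^^ n) x |n. True} = topspace DT"
    unfolding d.dense_iff_seminorms[OF lc_DT orb]
  proof (intro ballI allI impI)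
    fix z q assume "z \<in> topspace DT" "cont_seminorm (dsum_scale s) DT q"
    then obtain n where "q ((T ^^ n) x - z) < 1" using dense unfolding topspace_DT by blast
    then show "\<exists>x\<in>{(T ^^ n) x |n. True}. q (x - z) < 1" by blast
  qed
  then show ?thesis
    unfolding hypercyclic_def using T_continuous_operator xC by (auto simp: topspace_DT)
qed

end

section \<open>The characterization\<close>

lemma (in normed_scalars) infinite_seminorm_infinite_dimensional:
  assumes lc: "locally_convex s T" and p: "infinite_seminorm T p"
  shows "\<not> finite_dimensional s (topspace T)"
proof
  assume "finite_dimensional s (topspace T)"
  then obtain B where B: "finite B" "span B = topspace T" by (auto simp: finite_dimensional_def)
  then have "B \<subseteq> topspace T" using span_superset by blast
  then obtain x where x: "x \<in> topspace T" "\<forall>y\<in>span B. p (x - y) \<noteq> 0"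
    using p B(1) unfolding infinite_seminorm_def by blast
  have "p (x - x) = 0" using cont_seminorm_0[OF lc] p by (simp add: infinite_seminorm_def)
  then show False using x B(2) by blast
qed

text \<open>The operator \<open>x \<mapsto> \<Sum>i. f (\<sigma> i) x \<odot> (c i \<odot> v
  i)\<close>. By \<open>cond\<close>, either the functionals on \<open>E\<close> are dominated by
  one seminorm and small weights give convergence, or \<open>v\<close> is eventually null in
  \<open>T\<close> and the weights can be 1.\<close>

lemma (in normed_scalars) exists_weighted_shift:
  assumes lc: "locally_convex s E" and fr: "frechet_space s T"
    and E: "space_data E e f D" "\<not> finite_dimensional s (topspace E)" and T: "space_data T v f' D'"
    and cond: "(\<exists>p. infinite_seminorm E p) \<or> \<not> (\<exists>p. infinite_seminorm T p)" and \<sigma>: "inj \<sigma>"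
  shows "\<exists>Q c. cont_op s E T Q \<and> (\<forall>i. c i \<noteq> 0) \<and> (\<forall>i. Q (e (\<sigma> i)) = c i \<odot> v i) \<and> (\<forall>k. k \<notin> range \<sigma> \<longrightarrow> Q (e k) = 0)"
proof -
  have lcT: "locally_convex s T" using fr by (simp add: frechet_space_def)
  have eE: "e i \<in> topspace E" and vT: "v i \<in> topspace T" for i using E(1) T by (simp_all add: space_data_def)
  have bi: "biorthogonal UNIV e f" and fc: "cont_seminorm s E (\<lambda>x. norm (f i x))" for i
    using E by (simp_all add: space_data_def)
  have lf: "linear_functional s (f i)" and fe: "f i (e j) = (if i = j then 1 else 0)" for i j
    using bi by (simp_all add: biorthogonal_def)
  have "\<exists>c :: nat \<Rightarrow> real. (\<forall>i. c i > 0) \<and> (\<forall>q. cont_seminorm s T q \<longrightarrow> (\<exists>p. cont_seminorm s E p \<and>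
       (\<forall>x\<in>topspace E. \<forall>n. (\<Sum>i<n. norm (f (\<sigma> i) x) * q (of_real (c i) \<odot> v i)) \<le> p x)))"
  proof (cases "\<exists>p. infinite_seminorm E p")
    case True
    then have "\<exists>p C. cont_seminorm s E p \<and> (\<forall>i. \<forall>x\<in>topspace E. norm (f i x) \<le> C i * p x)"
      using E(1) unfolding space_data_def by simp
    then obtain p and C :: "nat \<Rightarrow> real" where p: "cont_seminorm s E p" "\<forall>i. \<forall>x\<in>topspace E. norm (f i x) \<le> C i * p x"
      by blast
    have dom: "norm (f (\<sigma> i) x) \<le> C (\<sigma> i) * p x" if "x \<in> topspace E" for i x using p(2) that by blast
    obtain c :: "nat \<Rightarrow> real" where c: "\<And>i. c i > 0" "\<And>q. cont_seminorm s T q \<Longrightarrow> \<exists>r. cont_seminorm s E r \<and>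
       (\<forall>x\<in>topspace E. \<forall>n. (\<Sum>i<n. norm (f (\<sigma> i) x) * q (of_real (c i) \<odot> v i)) \<le> r x)"
      by (rule dominated_weights[OF lc fr p(1), of "\<lambda>i. f (\<sigma> i)" "\<lambda>i. C (\<sigma> i)" v]) (use dom vT in auto)
    then show ?thesis by (intro exI[of _ c]) simp
  next
    case False
    then have np: "\<not> (\<exists>p. infinite_seminorm T p)" using cond by blast
    have null: "eventually_null T v" using T unfolding space_data_def if_not_P[OF np] by blast
    have "\<exists>p. cont_seminorm s E p \<and> (\<forall>x\<in>topspace E. \<forall>n. (\<Sum>i<n. norm (f (\<sigma> i) x) * q (v i)) \<le> p x)"
      if "cont_seminorm s T q" for q
      by (rule eventually_null_bound[OF lc lcT fc vT null that])
    then show ?thesis by (intro exI[of _ "\<lambda>_. 1"]) simp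
  qed
  then obtain c :: "nat \<Rightarrow> real" where c: "\<forall>i. c i > 0" "\<forall>q. cont_seminorm s T q \<longrightarrow> (\<exists>p. cont_seminorm s E p \<and>
       (\<forall>x\<in>topspace E. \<forall>n. (\<Sum>i<n. norm (f (\<sigma> i) x) * q (of_real (c i) \<odot> v i)) \<le> p x))" by blast
  obtain Q where Q: "\<And>x. x \<in> topspace E \<Longrightarrow> Q x \<in> topspace T"
    "\<And>x y. x \<in> topspace E \<Longrightarrow> y \<in> topspace E \<Longrightarrow> Q (x + y) = Q x + Q y"
    "\<And>c x. x \<in> topspace E \<Longrightarrow> Q (c \<odot> x) = c \<odot> Q x"
    "\<And>q. cont_seminorm s T q \<Longrightarrow> cont_seminorm s E (\<lambda>x. q (Q x))"
    "\<And>x n. x \<in> topspace E \<Longrightarrow> (\<And>i. i \<ge> n \<Longrightarrow> f (\<sigma> i) x = 0) \<Longrightarrow> Q x = (\<Sum>i<n. f (\<sigma> i) x \<odot> (of_real (c i) \<odot> v i))"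
    by (rule series_operator[OF lc fr, of "\<lambda>i. f (\<sigma> i)" "\<lambda>i. of_real (c i) \<odot> v i"])
       (use lf c(2) subspace_scale[OF tvs_facts(1)[OF lcT] vT] in auto)
  have \<sigma>_eq: "\<sigma> i = \<sigma> j \<longleftrightarrow> i = j" for i j using \<sigma> by (simp add: inj_eq)
  show ?thesis
  proof (rule exI[of _ Q], rule exI[of _ "\<lambda>i. of_real (c i)"], intro conjI allI impI)
    show "cont_op s E T Q" unfolding cont_op_def using Q(1-4) by blast
    show "of_real (c i) \<noteq> (0 :: 'k)" for i using c(1)[rule_format, of i] by simp
    show "Q (e (\<sigma> i)) = of_real (c i) \<odot> v i" for i
    proof -
      have "Q (e (\<sigma> i)) = (\<Sum>k<Suc i. f (\<sigma> k) (e (\<sigma> i)) \<odot> (of_real (c k) \<odot> v k))"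
        by (rule Q(5)[OF eE]) (simp add: fe \<sigma>_eq)
      also have "\<dots> = (\<Sum>k<Suc i. if k = i then of_real (c k) \<odot> v k else 0)"
        by (rule sum.cong) (auto simp: fe \<sigma>_eq)
      finally show ?thesis by simp
    qed
    show "Q (e k) = 0" if "k \<notin> range \<sigma>" for k
    proof -
      have "\<sigma> i \<noteq> k" for i using that by blast
      then have "Q (e k) = (\<Sum>i<0. f (\<sigma> i) (e k) \<odot> (of_real (c i) \<odot> v i))"
        by (intro Q(5)[OF eE]) (simp add: fe)
      then show ?thesis by simp
    qed
  qed
qed

text \<open>The indices \<open>m 0, m 1, ...\<close> of infinite-dimensional summands along which the operator is built. A
  space all of whose continuous seminorms have kernels of finite codimension is mapped only to spaces of the
  same kind, so if there are finitely many summands of the other kind, these come first.\<close>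

lemma exists_index_chain:
  fixes I W :: "nat set"
  assumes IW: "I \<subseteq> W" and W: "infinite W"
  shows "\<exists>m. inj m \<and> range m \<subseteq> W \<and> (\<forall>t. m t \<in> I \<or> m (Suc t) \<notin> I \<and> (t \<notin> range m \<longrightarrow> t \<notin> I))"
proof (cases "finite I")
  case False
  then have "bij_betw (enumerate I) UNIV I" by (rule bij_enumerate)
  then show ?thesis using IW by (intro exI[of _ "enumerate I"]) (auto simp: bij_betw_def)
next
  case True
  define n where "n = card I"
  obtain h where h: "bij_betw h {0..<n} I" using ex_bij_betw_nat_finite[OF True] by (auto simp: n_def)
  have "infinite (W - I)" using W True by simp
  then have g: "bij_betw (enumerate (W - I)) UNIV (W - I)" by (rule bij_enumerate)
  define m where "m t = (if t < n then h t else enumerate (W - I) (t - n))" for t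
  have lo: "m t \<in> I" if "t < n" for t using that h by (auto simp: m_def bij_betw_def)
  have hi: "m t \<in> W - I" if "\<not> t < n" for t using that g unfolding m_def bij_betw_def by auto
  have "inj m"
  proof (rule injI)
    fix t t' assume e: "m t = m t'"
    have iff: "t < n \<longleftrightarrow> t' < n" using lo[of t] lo[of t'] hi[of t] hi[of t'] e by auto
    show "t = t'"
    proof (cases "t < n")
      case True
      then have "h t = h t'" "t' < n" using e iff by (simp_all add: m_def)
      then show ?thesis using bij_betw_imp_inj_on[OF h] True by (auto simp: inj_on_def)
    next
      case False
      then have "enumerate (W - I) (t - n) = enumerate (W - I) (t' - n)" "\<not> t' < n" using e iff by (simp_all add: m_def)
      then have "t - n = t' - n" using bij_betw_imp_inj_on[OF g] by (auto simp: inj_on_def)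
      then show ?thesis using False \<open>\<not> t' < n\<close> by simp
    qed
  qed
  moreover have "range m \<subseteq> W" using lo hi IW by blast
  moreover have "I \<subseteq> range m"
  proof
    fix i assume "i \<in> I"
    then obtain t where "t < n" "h t = i" using h unfolding bij_betw_def by auto
    then show "i \<in> range m" by (auto simp: m_def intro!: image_eqI[of _ _ t])
  qed
  moreover have "m t \<in> I \<or> m (Suc t) \<notin> I" for t using lo[of t] hi[of "Suc t"] by (cases "t < n") auto
  ultimately show ?thesis by (intro exI[of _ m]) blast
qed

theorem dsum_hypercyclic_iff:
  fixes s :: "'k::real_normed_field \<Rightarrow> 'v::ab_group_add \<Rightarrow> 'v" and X :: "nat \<Rightarrow> 'v topology"
  assumes hb: "hahn_banach s" and fr: "\<And>n. frechet_space s (X n)" and sep: "\<And>n. separable_space (X n)"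
  shows "(\<exists>f. hypercyclic (dsum_scale s) (dsum_topology s X) f) \<longleftrightarrow>
    infinite {n. \<not> finite_dimensional s (topspace (X n))}"
proof -
  have lcX: "locally_convex s (X n)" and met: "metrizable_space (X n)" for n
    using fr[of n] by (simp_all add: frechet_space_def)
  interpret lc_family s X
    by (intro lc_family.intro locally_convex_normed_scalars[OF lcX[of 0]] lc_family_axioms.intro lcX)
  let ?W = "{n. \<not> finite_dimensional s (topspace (X n))}"
  let ?I = "{n. \<exists>p. infinite_seminorm (X n) p}"
  show ?thesis
  proof
    assume "\<exists>f. hypercyclic (dsum_scale s) DT f"
    then show "infinite ?W" using not_hypercyclic[OF hb met] by auto
  next
    assume inf: "infinite ?W"
    have "\<forall>j. \<exists>v f D. space_data (X j) v f D" using exists_space_data[OF hb lcX met sep] by blast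
    then obtain v f D where data: "\<And>j. space_data (X j) (v j) (f j) (D j)" by metis
    have "?I \<subseteq> ?W" using infinite_seminorm_infinite_dimensional[OF lcX] by blast
    from exists_index_chain[OF this inf] obtain m where m: "inj m" "range m \<subseteq> ?W"
      "\<And>t. m t \<in> ?I \<or> m (Suc t) \<notin> ?I \<and> (t \<notin> range m \<longrightarrow> t \<notin> ?I)" by blast
    have mW: "\<not> finite_dimensional s (topspace (X (m t)))" for t using m(2) by blast
    have shift: "\<exists>Q c. cont_op s (X (m t)) (X j) Q \<and> (\<forall>i. c i \<noteq> 0) \<and> (\<forall>i. Q (v (m t) (\<sigma> i)) = s (c i) (v j i)) \<and>
        (\<forall>k. k \<notin> range \<sigma> \<longrightarrow> Q (v (m t) k) = 0)"
      if "m t \<in> ?I \<or> j \<notin> ?I" "inj \<sigma>" for t j and \<sigma> :: "nat \<Rightarrow> nat"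
      by (rule exists_weighted_shift[OF lcX fr data mW data _ that(2)]) (use that(1) in auto)
    \<comment> \<open>With \<open>3 * i\<close> in place of \<open>3 * i + 3\<close>, index 0 would
      be sent to index 0 for ever; the offset makes the index drop strictly and gives local
      nilpotency.\<close>
    have \<sigma>: "inj (\<lambda>i::nat. 3 * i + 1)" "inj (\<lambda>i::nat. 3 * i + 2)" "inj (\<lambda>i::nat. 3 * i + 3)"
      by (auto simp: inj_on_def)
    obtain A a where A: "cont_op s (X (m 0)) (X (m 0)) A" "\<forall>i. a i \<noteq> 0"
      "\<forall>i. A (v (m 0) (3 * i + 2)) = s (a i) (v (m 0) i)" "\<forall>k. k \<notin> range (\<lambda>i. 3 * i + 2) \<longrightarrow> A (v (m 0) k) = 0"
      using shift[of 0 "m 0", OF _ \<sigma>(2)] by blast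
    have "\<forall>t. \<exists>Q c. cont_op s (X (m t)) (X (m (Suc t))) Q \<and> (\<forall>i. c i \<noteq> 0) \<and>
        (\<forall>i. Q (v (m t) (3 * i + 3)) = s (c i) (v (m (Suc t)) i)) \<and>
        (\<forall>k. k \<notin> range (\<lambda>i. 3 * i + 3) \<longrightarrow> Q (v (m t) k) = 0)"
      using m(3) by (intro allI shift \<sigma>) blast
    then obtain B b where B: "\<And>t. cont_op s (X (m t)) (X (m (Suc t))) (B t)" "\<And>t i. b t i \<noteq> 0"
      "\<And>t i. B t (v (m t) (3 * i + 3)) = s (b t i) (v (m (Suc t)) i)"
      "\<And>t k. k \<notin> range (\<lambda>i. 3 * i + 3) \<Longrightarrow> B t (v (m t) k) = 0" by metis
    have "\<forall>t. \<exists>Q c. t \<notin> range m \<longrightarrow> cont_op s (X (m t)) (X t) Q \<and> (\<forall>i. c i \<noteq> 0) \<and>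
        (\<forall>i. Q (v (m t) (3 * i + 1)) = s (c i) (v t i)) \<and>
        (\<forall>k. k \<notin> range (\<lambda>i. 3 * i + 1) \<longrightarrow> Q (v (m t) k) = 0)"
    proof
      fix t
      show "\<exists>Q c. t \<notin> range m \<longrightarrow> cont_op s (X (m t)) (X t) Q \<and> (\<forall>i. c i \<noteq> 0) \<and>
        (\<forall>i. Q (v (m t) (3 * i + 1)) = s (c i) (v t i)) \<and>
        (\<forall>k. k \<notin> range (\<lambda>i. 3 * i + 1) \<longrightarrow> Q (v (m t) k) = 0)"
      proof (cases "t \<in> range m")
        case False
        \<comment> \<open>If \<open>m t\<close> is of the kind that cannot feed \<open>?I\<close>,
          then all of \<open>?I\<close> is in the range of \<open>m\<close>, so the leaf
          \<open>t\<close> is outside \<open>?I\<close>.\<close>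
        then have "m t \<in> ?I \<or> t \<notin> ?I" using m(3) by blast
        from shift[OF this \<sigma>(1)] show ?thesis by blast
      qed blast
    qed
    from choice[OF this] obtain L where "\<forall>t. \<exists>c. t \<notin> range m \<longrightarrow> cont_op s (X (m t)) (X t) (L t) \<and> (\<forall>i. c i \<noteq> 0) \<and>
        (\<forall>i. L t (v (m t) (3 * i + 1)) = s (c i) (v t i)) \<and>
        (\<forall>k. k \<notin> range (\<lambda>i. 3 * i + 1) \<longrightarrow> L t (v (m t) k) = 0)" by blast
    from choice[OF this] obtain l where "\<forall>t. t \<notin> range m \<longrightarrow> cont_op s (X (m t)) (X t) (L t) \<and> (\<forall>i. l t i \<noteq> 0) \<and>
        (\<forall>i. L t (v (m t) (3 * i + 1)) = s (l t i) (v t i)) \<and>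
        (\<forall>k. k \<notin> range (\<lambda>i. 3 * i + 1) \<longrightarrow> L t (v (m t) k) = 0)" by blast
    then have L: "\<And>t. t \<notin> range m \<Longrightarrow> cont_op s (X (m t)) (X t) (L t)" "\<And>t i. t \<notin> range m \<Longrightarrow> l t i \<noteq> 0"
      "\<And>t i. t \<notin> range m \<Longrightarrow> L t (v (m t) (3 * i + 1)) = s (l t i) (v t i)"
      "\<And>t k. t \<notin> range m \<Longrightarrow> k \<notin> range (\<lambda>i. 3 * i + 1) \<Longrightarrow> L t (v (m t) k) = 0" by blast+
    have n: "3 * i \<notin> range (\<lambda>i. 3 * i + 1)" "3 * i + 2 \<notin> range (\<lambda>i. 3 * i + 1)"
      "3 * i \<notin> range (\<lambda>i. 3 * i + 2)" "3 * i + 1 \<notin> range (\<lambda>i. 3 * i + 2)"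
      "0 \<notin> range (\<lambda>i::nat. 3 * i + 3)" "3 * i + 1 \<notin> range (\<lambda>i. 3 * i + 3)" "3 * i + 2 \<notin> range (\<lambda>i. 3 * i + 3)"
      for i :: nat by (rule notI, erule rangeE, presburger)+
    have vX: "v j i \<in> topspace (X j)" for j i using data[of j] by (simp add: space_data_def)
    interpret chain_operator s X m v A B L a b l
      by unfold_locales (use m(1) vX A B L n in \<open>simp_all\<close>)
    have "hypercyclic (dsum_scale s) DT T"
    proof (rule hypercyclic_T[OF fr, of D])
      show "D j k \<in> topspace (X j)" "D j k \<in> span (range (v j))" for j k
        using data[of j] by (simp_all add: space_data_def)
      show "\<exists>k. q (D j k - y) < 1" if "y \<in> topspace (X j)" "cont_seminorm s (X j) q" for j y q
        using data[of j] that by (simp add: space_data_def)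
    qed
    then show "\<exists>f. hypercyclic (dsum_scale s) DT f" by blast
  qed
qed

theorem theorem1p9:
  fixes sR :: "real \<Rightarrow> 'a::ab_group_add \<Rightarrow> 'a" and X :: "nat \<Rightarrow> 'a topology"
    and sC :: "complex \<Rightarrow> 'b::ab_group_add \<Rightarrow> 'b" and Y :: "nat \<Rightarrow> 'b topology"
  shows
    "((\<forall>n. frechet_space sR (X n) \<and> separable_space (X n)) \<longrightarrow>
        ((\<exists>f. hypercyclic (dsum_scale sR) (dsum_topology sR X) f) \<longleftrightarrow>
         infinite {n. \<not> finite_dimensional sR (topspace (X n))})) \<and>
     ((\<forall>n. frechet_space sC (Y n) \<and> separable_space (Y n)) \<longrightarrow>
        ((\<exists>f. hypercyclic (dsum_scale sC) (dsum_topology sC Y) f) \<longleftrightarrow>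
         infinite {n. \<not> finite_dimensional sC (topspace (Y n))}))"
proof (intro conjI impI)
  assume X: "\<forall>n. frechet_space sR (X n) \<and> separable_space (X n)"
  then have "vector_space sR" by (simp add: frechet_space_def locally_convex_def tvs_def)
  from dsum_hypercyclic_iff[OF hahn_banach_real[OF this]] X
  show "(\<exists>f. hypercyclic (dsum_scale sR) (dsum_topology sR X) f) \<longleftrightarrow>
    infinite {n. \<not> finite_dimensional sR (topspace (X n))}" by blast
next
  assume Y: "\<forall>n. frechet_space sC (Y n) \<and> separable_space (Y n)"
  then have "vector_space sC" by (simp add: frechet_space_def locally_convex_def tvs_def)
  from dsum_hypercyclic_iff[OF hahn_banach_complex[OF this]] Y
  show "(\<exists>f. hypercyclic (dsum_scale sC) (dsum_topology sC Y) f) \<longleftrightarrow>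
    infinite {n. \<not> finite_dimensional sC (topspace (Y n))}" by blast
qed

end
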